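(* Let $D$ be a $\Delta$-regular bounded open subset of $\mathbb R^d$ whose closure $\overline D$ is contained in some domain (connected open subset) of $\mathbb R^d\setminus\bigcup_{\alpha\in R_+}H_\alpha$. Let $f$ be a continuous function on $\mathbb R^d\setminus D$. If $f$ is locally Hölder continuous on $\bigcup_{\alpha\in R_+}\sigma_\alpha(D)$, then $H_D^{\Delta_k}f\in C^2(D)$ and, for every $x\in D$, $$\Delta_k\left(H_D^{\Delta_k}f\right)(x)=0.$$
   Context: Let $d\ge1$, $\langle\cdot,\cdot\rangle$ the Euclidean inner product on $\mathbb R^d$ and $|\cdot|$ its norm. For $\alpha\in\mathbb R^d\setminus\{0\}$, $H_\alpha$ is the hyperplane orthogonal to $\alpha$ and $\sigma_\alpha x=x-2\frac{\langle x,\alpha\rangle}{|\alpha|^2}\alpha$ is the reflection with respect to $H_\alpha$. $R\subset\mathbb R^d\setminus\{0\}$ is a root system (a finite set with $R\cap\mathbb R\alpha=\{\alpha,-\alpha\}$ and $\sigma_\alpha R=R$ for all $\alpha\in R$), $R_+$ is a fixed positive subsystem, and $k:R\to[0,\infty)$ is a multiplicity function (invariant under the group generated by the reflections $\sigma_\alpha$, $\alpha\in R$). The Dunkl Laplacian is $$\Delta_kf(x)=\Delta f(x)+2\sum_{\alpha\in R_+}k(\alpha)\left(\frac{\langle\nabla f(x),\alpha\rangle}{\langle\alpha,x\rangle}-\frac{|\alpha|^2}{2}\frac{f(x)-f(\sigma_\alpha x)}{\langle\alpha,x\rangle^2}\right);$$ for a function on $\mathbb R^d$ that is $C^2$ on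 $D$ this formula is used pointwise at $x\in D$. The invariant weight is $w_k(x)=\prod_{\alpha\in R_+}|\langle x,\alpha\rangle|^{2k(\alpha)}$. $C_c^\infty(D)$ is the space of infinitely differentiable functions with compact support in $D$ (extended by $0$ to $\mathbb R^d$). $D$ is $\Delta$-regular if for every continuous function $g$ on $\partial D$ there is a unique continuous function on $\overline D$ that equals $g$ on $\partial D$ and is harmonic on $D$. For $D$ as in the claim and every continuous $f$ on $\mathbb R^d\setminus D$, there is exactly one continuous function $h:\mathbb R^d\to\mathbb R$ with $h=f$ on $\mathbb R^d\setminus D$ and $\int_{\mathbb R^d}h(x)\Delta_k\varphi(x)w_k(x)\,dx=0$ for every $\varphi\in C_c^\infty(D)$; it is denoted $H_D^{\Delta_k}f$. *)

theory Defs
  imports "HOL-Analysis.Analysis"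
begin

section \<open>Differentiability classes\<close>

text \<open>
  \<open>Ck_on n S f\<close>: on the open set \<open>S\<close>, all iterated directional derivatives of \<open>f\<close> up to
  order \<open>n\<close> exist (in the Frechet sense below order \<open>n\<close>) and are continuous, that is, \<open>f\<close> is
  of class \<open>C\<^sup>n\<close> on \<open>S\<close>.
\<close>

primrec Ck_on :: "nat \<Rightarrow> 'a::euclidean_space set \<Rightarrow> ('a \<Rightarrow> real) \<Rightarrow> bool" where
  "Ck_on 0 S f \<longleftrightarrow> continuous_on S f"
| "Ck_on (Suc n) S f \<longleftrightarrow>
     (\<forall>x\<in>S. f differentiable (at x)) \<and> (\<forall>v. Ck_on n S (\<lambda>x. frechet_derivative f (at x) v))"

definition test_functions :: "'a::euclidean_space set \<Rightarrow> ('a \<Rightarrow> real) set" where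
  "test_functions D =
     {\<phi>. (\<forall>n. Ck_on n UNIV \<phi>) \<and> compact (closure {x. \<phi> x \<noteq> 0}) \<and> closure {x. \<phi> x \<noteq> 0} \<subseteq> D}"

definition grad :: "('a::euclidean_space \<Rightarrow> real) \<Rightarrow> 'a \<Rightarrow> 'a" where
  "grad f x = (\<Sum>b\<in>Basis. frechet_derivative f (at x) b *\<^sub>R b)"

definition laplacian :: "('a::euclidean_space \<Rightarrow> real) \<Rightarrow> 'a \<Rightarrow> real" where
  "laplacian f x =
     (\<Sum>b\<in>Basis. frechet_derivative (\<lambda>y. frechet_derivative f (at y) b) (at x) b)"

definition harmonic_on :: "'a::euclidean_space set \<Rightarrow> ('a \<Rightarrow> real) \<Rightarrow> bool" where
  "harmonic_on D u \<longleftrightarrow> Ck_on 2 D u \<and> (\<forall>x\<in>D. laplacian u x = 0)"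

text \<open>
  A function on \<open>closure D\<close> is represented by a total function, so uniqueness is required
  on \<open>closure D\<close> only.
\<close>

definition solves_dirichlet ::
  "'a::euclidean_space set \<Rightarrow> ('a \<Rightarrow> real) \<Rightarrow> ('a \<Rightarrow> real) \<Rightarrow> bool" where
  "solves_dirichlet D g u \<longleftrightarrow>
     continuous_on (closure D) u \<and> (\<forall>x\<in>frontier D. u x = g x) \<and> harmonic_on D u"

definition laplace_regular :: "'a::euclidean_space set \<Rightarrow> bool" where
  "laplace_regular D \<longleftrightarrow>
     (\<forall>g. continuous_on (frontier D) g \<longrightarrow>
        (\<exists>u. solves_dirichlet D g u \<and>
             (\<forall>v. solves_dirichlet D g v \<longrightarrow> (\<forall>x\<in>closure D. v x = u x))))"

text \<open>The constant and the exponent may depend on the point.\<close>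

definition locally_hoelder_on :: "'a::euclidean_space set \<Rightarrow> ('a \<Rightarrow> real) \<Rightarrow> bool" where
  "locally_hoelder_on S f \<longleftrightarrow>
     (\<forall>x\<in>S. \<exists>r>0. \<exists>C. \<exists>\<gamma>. 0 < \<gamma> \<and> \<gamma> \<le> 1 \<and>
        (\<forall>y\<in>ball x r \<inter> S. \<forall>z\<in>ball x r \<inter> S. \<bar>f y - f z\<bar> \<le> C * norm (y - z) powr \<gamma>))"


section \<open>Root systems\<close>

definition hyperplane :: "'a::euclidean_space \<Rightarrow> 'a set" where
  "hyperplane \<alpha> = {x. x \<bullet> \<alpha> = 0}"

definition reflection :: "'a::euclidean_space \<Rightarrow> 'a \<Rightarrow> 'a" where
  "reflection \<alpha> x = x - (2 * (x \<bullet> \<alpha>) / (norm \<alpha>)\<^sup>2) *\<^sub>R \<alpha>"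

definition root_system :: "'a::euclidean_space set \<Rightarrow> bool" where
  "root_system R \<longleftrightarrow>
     finite R \<and> 0 \<notin> R \<and>
     (\<forall>\<alpha>\<in>R. R \<inter> range (\<lambda>c. c *\<^sub>R \<alpha>) = {\<alpha>, - \<alpha>} \<and> reflection \<alpha> ` R = R)"

definition positive_subsystem :: "'a::euclidean_space set \<Rightarrow> 'a set \<Rightarrow> bool" where
  "positive_subsystem R P \<longleftrightarrow>
     (\<exists>\<beta>. (\<forall>\<alpha>\<in>R. \<alpha> \<bullet> \<beta> \<noteq> 0) \<and> P = {\<alpha>\<in>R. \<alpha> \<bullet> \<beta> > 0})"

text \<open>Reflections are involutions, so closing under composition already yields a group.\<close>

inductive_set reflection_group :: "'a::euclidean_space set \<Rightarrow> ('a \<Rightarrow> 'a) set"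
  for R :: "'a set" where
  id: "id \<in> reflection_group R"
| comp: "\<alpha> \<in> R \<Longrightarrow> g \<in> reflection_group R \<Longrightarrow> reflection \<alpha> \<circ> g \<in> reflection_group R"

definition multiplicity_function :: "'a::euclidean_space set \<Rightarrow> ('a \<Rightarrow> real) \<Rightarrow> bool" where
  "multiplicity_function R k \<longleftrightarrow>
     (\<forall>\<alpha>\<in>R. 0 \<le> k \<alpha> \<and> (\<forall>g\<in>reflection_group R. k (g \<alpha>) = k \<alpha>))"


section \<open>The Dunkl Laplacian and its Dirichlet problem\<close>

text \<open>
  In the following definitions \<open>P\<close> is the positive subsystem. On the hyperplanes
  \<open>hyperplane \<alpha>\<close> with \<open>\<alpha> \<in> P\<close>, the values of \<open>dunkl_laplacian\<close> (division by zero) and of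
  \<open>dunkl_weight\<close> for \<open>k \<alpha> = 0\<close> (\<open>0 powr 0 = 0\<close>) are artefacts; these hyperplanes are
  Lebesgue null sets.
\<close>

definition dunkl_laplacian ::
  "'a::euclidean_space set \<Rightarrow> ('a \<Rightarrow> real) \<Rightarrow> ('a \<Rightarrow> real) \<Rightarrow> 'a \<Rightarrow> real" where
  "dunkl_laplacian P k f x =
     laplacian f x +
     2 * (\<Sum>\<alpha>\<in>P. k \<alpha> *
        ((grad f x \<bullet> \<alpha>) / (\<alpha> \<bullet> x)
         - (norm \<alpha>)\<^sup>2 / 2 * ((f x - f (reflection \<alpha> x)) / (\<alpha> \<bullet> x)\<^sup>2)))"

definition dunkl_weight :: "'a::euclidean_space set \<Rightarrow> ('a \<Rightarrow> real) \<Rightarrow> 'a \<Rightarrow> real" where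
  "dunkl_weight P k x = (\<Prod>\<alpha>\<in>P. \<bar>x \<bullet> \<alpha>\<bar> powr (2 * k \<alpha>))"

text \<open>
  The defining property of the function \<open>H\<^sub>D f\<close>: it is the unique \<open>h\<close> with
  \<open>is_dunkl_dirichlet_solution P k D f h\<close>.
\<close>

definition is_dunkl_dirichlet_solution ::
  "'a::euclidean_space set \<Rightarrow> ('a \<Rightarrow> real) \<Rightarrow> 'a set \<Rightarrow> ('a \<Rightarrow> real) \<Rightarrow> ('a \<Rightarrow> real) \<Rightarrow> bool" where
  "is_dunkl_dirichlet_solution P k D f h \<longleftrightarrow>
     continuous_on UNIV h \<and> (\<forall>x\<in>- D. h x = f x) \<and>
     (\<forall>\<phi>\<in>test_functions D.
        (LINT x|lborel. h x * dunkl_laplacian P k \<phi> x * dunkl_weight P k x) = 0)"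

end

theory Submission
  imports Defs
begin

text \<open>
  Let \<open>w\<close> be the square root of the invariant weight, i.e. \<open>half_weight\<close>. Testing with
  \<open>\<phi> = \<psi> / w\<close> and using that Lebesgue measure and the weight are invariant under the reflections, the
  weak equation for \<open>h\<close> becomes a weak Poisson equation for \<open>g = w h\<close> on \<open>D\<close>, whose right hand side
  \<open>G\<close> is a smooth multiple of \<open>g\<close> plus a smooth combination of the functions \<open>f \<circ> \<sigma>\<^sub>\<alpha>\<close>; the latter are
  locally Hoelder on \<open>D\<close>, since \<open>D\<close> lies in one chamber and is mapped off itself by each reflection.

  Interior regularity for \<open>\<Delta>g = G\<close> is obtained without a Green function. Let \<open>\<Theta>\<close> be a smooth radial function
  supported in the unit ball and define \<open>\<eta>\<close> by \<open>\<nabla>\<Theta>(x) = - \<eta>(x) x\<close>. For the scaled kernels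
  \<open>\<eta>\<^sub>t(x) = t\<^sup>-\<^sup>d \<eta>(x/t)\<close> one has \<open>d/dt \<eta>\<^sub>t = t \<Delta>\<Theta>\<^sub>t\<close>, hence
  \<open>d/dt (g * \<eta>\<^sub>t) = t (G * \<Theta>\<^sub>t)\<close>. After differentiating the kernels \<open>j\<close> times the right hand side is
  of order \<open>t\<^sup>1\<^sup>-\<^sup>j\<close>, which is bounded for \<open>j \<le> 1\<close>; for \<open>j = 2\<close> the kernel has mean zero and
  Hoelder continuity of \<open>G\<close> improves it to \<open>t\<^sup>\<gamma>\<^sup>-\<^sup>1\<close>, which is integrable at \<open>0\<close>. So the derivatives of
  \<open>g * \<eta>\<^sub>t\<close> converge locally uniformly as \<open>t\<close> tends to \<open>0\<close>: up to order 1 for continuous \<open>G\<close>, which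
  makes \<open>g\<close> and hence \<open>G\<close> locally Hoelder, and then up to order 2.
\<close>

section \<open>Calculus of functions of class C^n\<close>

text \<open>The square root is the power of the weight that removes the first order part: that part
  of \<open>dunkl_laplacian\<close> is twice the derivative along the gradient of log
  \<open>half_weight\<close>, and conjugation trades it for a zeroth order term. What cannot be
  conjugated away are the reflected values. In the weak equation they sit on the test function and
  make the integrand reach outside D; moved to \<open>h\<close> by a change of variables, they
  become values of the given \<open>f\<close>, so a nonlocal problem turns into a local one. The
  source still contains the unknown g, at first only known to be continuous, and a continuous source
  does not in general give a C^2 solution; hence the detour through one derivative. Kernels
  supported in a small ball are themselves test functions, so the distributional equation can be
  applied to them directly. All integrals then run over one compact box inside D, without singular
  integrals or boundary terms. The kernels stay unnormalised; the integral of \<open>bump\<close> is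
  divided out at the end.\<close>

lemma Ck_on_cong:
  assumes "open S" "\<And>x. x \<in> S \<Longrightarrow> f x = g x" "Ck_on n S f"
  shows "Ck_on n S g"
  using assms(2,3)
proof (induction n arbitrary: f g)
  case 0
  then show ?case using continuous_on_cong[of S S f g] by simp
next
  case (Suc n)
  have g: "g differentiable at x" if "x \<in> S" for x
    using Suc.prems that \<open>open S\<close>
    by (metis Ck_on.simps(2) differentiable_def has_derivative_transform_within_open)
  have "frechet_derivative f (at x) = frechet_derivative g (at x)" if "x \<in> S" for x
    using Suc.prems that \<open>open S\<close> by (intro frechet_derivative_transform_within_open[of f x S]) auto
  then have "Ck_on n S (\<lambda>x. frechet_derivative g (at x) v)" for v
    using Suc.IH[of "\<lambda>x. frechet_derivative f (at x) v" "\<lambda>x. frechet_derivative g (at x) v"]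
      Suc.prems by simp
  then show ?case using g by simp
qed

text \<open>On an open set the Frechet derivative is unique, so \<open>frechet_derivative\<close>
  may be replaced by any explicit formula. The closure rules below raise the order through this
  rule, with a closed form for the derivative.\<close>

lemma Ck_on_Suc_if_derivative:
  assumes S: "open S" and f: "\<And>x. x \<in> S \<Longrightarrow> (f has_derivative f' x) (at x)"
    and f': "\<And>v. Ck_on n S (\<lambda>x. f' x v)"
  shows "Ck_on (Suc n) S f"
proof -
  have "f' x = frechet_derivative f (at x)" if "x \<in> S" for x
    using frechet_derivative_at[OF f[OF that]] .
  then have "Ck_on n S (\<lambda>x. frechet_derivative f (at x) v)" for v
    by (intro Ck_on_cong[OF S _ f'[of v]]) simp
  then show ?thesis
    using f by (auto simp: differentiable_def)
qed

lemma Ck_on_local: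
  assumes "\<And>x. x \<in> S \<Longrightarrow> \<exists>T. open T \<and> x \<in> T \<and> Ck_on n T f"
  shows "Ck_on n S f"
  using assms
proof (induction n arbitrary: f)
  case 0
  have "isCont f x" if "x \<in> S" for x
    using 0[OF that] by (auto simp: continuous_on_eq_continuous_at)
  then show ?case by (simp add: continuous_at_imp_continuous_on)
next
  case (Suc n)
  have "f differentiable at x" if "x \<in> S" for x
    using Suc.prems[OF that] by auto
  moreover have "Ck_on n S (\<lambda>x. frechet_derivative f (at x) v)" for v
    using Suc.prems by (intro Suc.IH) (metis Ck_on.simps(2))
  ultimately show ?case by simp
qed

lemma Ck_on_subset: "Ck_on n S f \<Longrightarrow> T \<subseteq> S \<Longrightarrow> Ck_on n T f"
  by (induction n arbitrary: f) (auto intro: continuous_on_subset)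

lemma Ck_on_SucD: "Ck_on (Suc n) S f \<Longrightarrow> Ck_on n S f"
proof (induction n arbitrary: f)
  case 0
  then show ?case
    by (auto intro!: continuous_at_imp_continuous_on differentiable_imp_continuous_within)
next
  case (Suc n)
  then show ?case by (metis Ck_on.simps(2))
qed

lemma Ck_on_continuous: "Ck_on n S f \<Longrightarrow> continuous_on S f"
  by (induction n) (auto simp del: Ck_on.simps(2) dest: Ck_on_SucD)

lemma Ck_on_has_derivative:
  "Ck_on (Suc n) S f \<Longrightarrow> x \<in> S \<Longrightarrow> (f has_derivative frechet_derivative f (at x)) (at x)"
  by (simp add: frechet_derivative_works)

lemma Ck_on_frechet: "Ck_on (Suc n) S f \<Longrightarrow> Ck_on n S (\<lambda>x. frechet_derivative f (at x) v)"
  by simp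

lemma Ck_on_const: "open S \<Longrightarrow> Ck_on n S (\<lambda>_. c)"
  by (induction n arbitrary: c) auto

lemma Ck_on_add:
  assumes "open S" "Ck_on n S f" "Ck_on n S g"
  shows "Ck_on n S (\<lambda>x. f x + g x)"
  using assms(2,3)
proof (induction n arbitrary: f g)
  case 0
  then show ?case by (auto intro: continuous_intros)
next
  case (Suc n)
  show ?case
  proof (rule Ck_on_Suc_if_derivative[OF \<open>open S\<close>])
    show "((\<lambda>x. f x + g x) has_derivative
        (\<lambda>v. frechet_derivative f (at x) v + frechet_derivative g (at x) v)) (at x)"
      if "x \<in> S" for x
      using Suc.prems that by (intro has_derivative_add Ck_on_has_derivative)
    show "Ck_on n S (\<lambda>x. frechet_derivative f (at x) v + frechet_derivative g (at x) v)" for v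
      using Suc.prems by (intro Suc.IH) auto
  qed
qed

lemma Ck_on_mult:
  assumes "open S" "Ck_on n S f" "Ck_on n S g"
  shows "Ck_on n S (\<lambda>x. f x * g x)"
  using assms(2,3)
proof (induction n arbitrary: f g)
  case 0
  then show ?case by (auto intro: continuous_intros)
next
  case (Suc n)
  show ?case
  proof (rule Ck_on_Suc_if_derivative[OF \<open>open S\<close>])
    show "((\<lambda>x. f x * g x) has_derivative
        (\<lambda>v. f x * frechet_derivative g (at x) v + frechet_derivative f (at x) v * g x)) (at x)"
      if "x \<in> S" for x
      using Suc.prems that by (intro has_derivative_mult Ck_on_has_derivative)
    show "Ck_on n S (\<lambda>x. f x * frechet_derivative g (at x) v + frechet_derivative f (at x) v * g x)"
      for v
      using Suc.prems
      by (intro Ck_on_add Suc.IH \<open>open S\<close> Ck_on_frechet) (auto simp del: Ck_on.simps dest: Ck_on_SucD)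
  qed
qed

lemma Ck_on_sum:
  assumes "open S" "\<And>i. i \<in> I \<Longrightarrow> Ck_on n S (f i)"
  shows "Ck_on n S (\<lambda>x. \<Sum>i\<in>I. f i x)"
  using assms(2)
proof (induction I rule: infinite_finite_induct)
  case (insert i I)
  then show ?case using Ck_on_add[OF \<open>open S\<close>, of n "f i" "\<lambda>x. \<Sum>i\<in>I. f i x"] by simp
qed (auto intro: Ck_on_const[OF \<open>open S\<close>])

lemma Ck_on_inner_left: "open S \<Longrightarrow> Ck_on n S (\<lambda>x. x \<bullet> a)"
proof (induction n)
  case (Suc n)
  show ?case
    by (rule Ck_on_Suc_if_derivative[OF \<open>open S\<close>, of _ "\<lambda>x v. v \<bullet> a"])
      (auto intro!: derivative_eq_intros Ck_on_const Suc.prems)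
qed (auto intro: continuous_intros)

lemma Ck_on_compose_affine:
  assumes "Ck_on n S f" and T: "open T" "(\<lambda>x. c + m *\<^sub>R x) ` T \<subseteq> S"
  shows "Ck_on n T (\<lambda>x. f (c + m *\<^sub>R x))"
  using assms(1)
proof (induction n arbitrary: f)
  case 0
  then show ?case
    by (auto intro!: continuous_on_compose2[of S f T] continuous_intros T)
next
  case (Suc n)
  show ?case
  proof (rule Ck_on_Suc_if_derivative[OF \<open>open T\<close>])
    fix x assume "x \<in> T"
    then have "c + m *\<^sub>R x \<in> S" using T by auto
    then have "(f has_derivative frechet_derivative f (at (c + m *\<^sub>R x))) (at (c + m *\<^sub>R x))"
      using Ck_on_has_derivative[OF Suc.prems] by blast
    moreover have "((\<lambda>x. c + m *\<^sub>R x) has_derivative (\<lambda>v. m *\<^sub>R v)) (at x)"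
      by (auto intro!: derivative_eq_intros)
    ultimately have "(f \<circ> (\<lambda>x. c + m *\<^sub>R x) has_derivative
        frechet_derivative f (at (c + m *\<^sub>R x)) \<circ> (\<lambda>v. m *\<^sub>R v)) (at x)"
      by (rule diff_chain_at[rotated])
    then show "((\<lambda>x. f (c + m *\<^sub>R x)) has_derivative
        (\<lambda>v. frechet_derivative f (at (c + m *\<^sub>R x)) (m *\<^sub>R v))) (at x)"
      by (simp add: o_def)
  next
    show "Ck_on n T (\<lambda>x. frechet_derivative f (at (c + m *\<^sub>R x)) (m *\<^sub>R v))" for v
      using Suc.prems by (intro Suc.IH[of "\<lambda>y. frechet_derivative f (at y) (m *\<^sub>R v)"]) simp
  qed
qed

text \<open>Bootstrapping: if the logarithmic derivative \<open>c\<close> is as smooth as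
  \<open>f\<close>, then order n of \<open>f\<close> gives order n of the product of
  \<open>f\<close> and \<open>c\<close>, hence order n + 1 of \<open>f\<close>. Reciprocals and the
  weight with its real exponents are treated this way.\<close>

lemma Ck_on_if_derivative_factors:
  assumes S: "open S" and f: "\<And>x. x \<in> S \<Longrightarrow> (f has_derivative (\<lambda>v. f x * c x v)) (at x)"
    and c: "\<And>n v. Ck_on n S f \<Longrightarrow> Ck_on n S (\<lambda>x. c x v)"
  shows "Ck_on n S f"
proof (induction n)
  case 0
  then show ?case
    using f by (auto intro!: continuous_at_imp_continuous_on has_derivative_continuous)
next
  case (Suc n)
  show ?case
    by (rule Ck_on_Suc_if_derivative[OF S f], assumption, rule Ck_on_mult[OF S Suc.IH c[OF Suc.IH]])
qed

lemma Ck_on_inverse_inner: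
  assumes "open S" "\<And>x. x \<in> S \<Longrightarrow> x \<bullet> a \<noteq> 0"
  shows "Ck_on n S (\<lambda>x. 1 / (x \<bullet> a))"
proof (rule Ck_on_if_derivative_factors[OF \<open>open S\<close>])
  show "((\<lambda>x. 1 / (x \<bullet> a)) has_derivative (\<lambda>v. 1 / (x \<bullet> a) * (- (v \<bullet> a) * (1 / (x \<bullet> a))))) (at x)"
    if "x \<in> S" for x
    using assms(2)[OF that] by (auto intro!: derivative_eq_intros simp: divide_simps power2_eq_square)
  show "Ck_on n S (\<lambda>x. - (v \<bullet> a) * (1 / (x \<bullet> a)))" if "Ck_on n S (\<lambda>x. 1 / (x \<bullet> a))" for n v
    using that by (intro Ck_on_mult Ck_on_const \<open>open S\<close>)
qed

section \<open>Directional derivatives: basis expansion and symmetry of second derivatives\<close>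

lemma has_derivative_basis_expansion:
  fixes f :: "'a::euclidean_space \<Rightarrow> real"
  assumes "(f has_derivative f') (at x)"
  shows "f' v = (\<Sum>b\<in>Basis. (v \<bullet> b) * f' b)"
proof -
  interpret f': linear f' using assms by (rule has_derivative_linear)
  have "f' v = f' (\<Sum>b\<in>Basis. (v \<bullet> b) *\<^sub>R b)" by (simp add: euclidean_representation)
  also have "\<dots> = (\<Sum>b\<in>Basis. (v \<bullet> b) * f' b)" by (simp add: f'.sum f'.scale)
  finally show ?thesis .
qed

text \<open>The second difference with steps \<open>h *\<^sub>R v\<close> and
  \<open>h *\<^sub>R w\<close> is symmetric in \<open>v\<close> and \<open>w\<close>. Two
  applications of the mean value theorem write it as h^2 times either mixed derivative at points
  tending to \<open>x\<close>; continuity of both mixed derivatives identifies the limits.\<close>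

lemma symmetric_second_derivative:
  fixes f :: "'a::euclidean_space \<Rightarrow> real"
  assumes "Ck_on 2 UNIV f"
  shows "frechet_derivative (\<lambda>y. frechet_derivative f (at y) v) (at x) w =
    frechet_derivative (\<lambda>y. frechet_derivative f (at y) w) (at x) v"
proof -
  define D where "D v f = (\<lambda>y. frechet_derivative f (at y) v)" for v and f :: "'a \<Rightarrow> real"
  have line: "((\<lambda>s. g (p + s *\<^sub>R v)) has_real_derivative D v g (p + s *\<^sub>R v)) (at s)"
    if "\<And>x. g differentiable (at x)" for g p v s
  proof -
    have "((\<lambda>s. p + s *\<^sub>R v) has_derivative (\<lambda>r. r *\<^sub>R v)) (at s)"
      by (auto intro!: derivative_eq_intros)
    moreover have g: "(g has_derivative frechet_derivative g (at (p + s *\<^sub>R v))) (at (p + s *\<^sub>R v))"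
      using that by (simp add: frechet_derivative_works)
    ultimately have "((\<lambda>s. g (p + s *\<^sub>R v)) has_derivative
        (\<lambda>r. frechet_derivative g (at (p + s *\<^sub>R v)) (r *\<^sub>R v))) (at s)"
      by (rule has_derivative_compose)
    then show ?thesis
      using linear_scale[OF has_derivative_linear[OF g]]
      by (simp add: has_field_derivative_def D_def mult.commute[of _ "frechet_derivative _ _ _"])
  qed
  have f1: "f differentiable (at x)" for x
    using assms by (simp add: eval_nat_numeral)
  have f2: "D v f differentiable (at x)" for v x
    using assms by (simp add: eval_nat_numeral D_def)
  have f3: "continuous_on UNIV (D w (D v f))" for v w
    using assms by (simp add: eval_nat_numeral D_def)
  have mixed: "\<exists>s t. 0 < s \<and> s < h \<and> 0 < t \<and> t < h \<and>
      f (x + h *\<^sub>R v + h *\<^sub>R w) - f (x + h *\<^sub>R v) - f (x + h *\<^sub>R w) + f x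
       = h * (h * D w (D v f) (x + s *\<^sub>R v + t *\<^sub>R w))" if "h > 0" for h v w
  proof -
    define F where "F s = f (x + h *\<^sub>R w + s *\<^sub>R v) - f (x + s *\<^sub>R v)" for s
    define F' where "F' s = D v f (x + h *\<^sub>R w + s *\<^sub>R v) - D v f (x + s *\<^sub>R v)" for s
    have F: "(F has_real_derivative F' s) (at s)" for s
      unfolding F_def F'_def
      by (rule DERIV_diff[OF line[OF f1, of "x + h *\<^sub>R w" v s] line[OF f1, of x v s]])
    have "\<exists>s>0. s < h \<and> F h - F 0 = (h - 0) * F' s"
      by (rule MVT2[OF \<open>h > 0\<close> F])
    then obtain s where s: "0 < s" "s < h" "F h - F 0 = (h - 0) * F' s"
      by auto
    define G where "G t = D v f (x + s *\<^sub>R v + t *\<^sub>R w)" for t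
    have G: "(G has_real_derivative D w (D v f) (x + s *\<^sub>R v + t *\<^sub>R w)) (at t)" for t
      unfolding G_def by (rule line[OF f2])
    have "\<exists>t>0. t < h \<and> G h - G 0 = (h - 0) * D w (D v f) (x + s *\<^sub>R v + t *\<^sub>R w)"
      by (rule MVT2[OF \<open>h > 0\<close> G])
    then obtain t where t: "0 < t" "t < h"
        "G h - G 0 = (h - 0) * D w (D v f) (x + s *\<^sub>R v + t *\<^sub>R w)"
      by auto
    have "F' s = G h - G 0"
      by (simp add: F'_def G_def algebra_simps)
    then have "f (x + h *\<^sub>R v + h *\<^sub>R w) - f (x + h *\<^sub>R v) - f (x + h *\<^sub>R w) + f x
       = h * (h * D w (D v f) (x + s *\<^sub>R v + t *\<^sub>R w))"
      using s(3) t(3) by (simp add: F_def algebra_simps)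
    then show ?thesis
      using s t by blast
  qed
  have lim: "(\<lambda>n. D w (D v f) (x + s n *\<^sub>R v + t n *\<^sub>R w)) \<longlonglongrightarrow> D w (D v f) x"
    if "\<And>n. 0 < s n \<and> s n < inverse (real (Suc n)) \<and> 0 < t n \<and> t n < inverse (real (Suc n))" for s t v w
  proof -
    have "s \<longlonglongrightarrow> 0" "t \<longlonglongrightarrow> 0"
      using that by (auto intro!: tendsto_sandwich[OF _ _ tendsto_const LIMSEQ_inverse_real_of_nat]
        always_eventually less_imp_le simp del: of_nat_Suc)
    then have "(\<lambda>n. x + s n *\<^sub>R v + t n *\<^sub>R w) \<longlonglongrightarrow> x + 0 *\<^sub>R v + 0 *\<^sub>R w"
      by (intro tendsto_intros)
    then show ?thesis
      using f3[of w v] by (auto simp: continuous_on_eq_continuous_at intro: isCont_tendsto_compose[of x])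
  qed
  let ?h = "\<lambda>n. inverse (real (Suc n))"
  have "\<forall>n. \<exists>s t s' t'. 0 < s \<and> s < ?h n \<and> 0 < t \<and> t < ?h n \<and> 0 < s' \<and> s' < ?h n \<and> 0 < t' \<and> t' < ?h n \<and>
     D w (D v f) (x + s *\<^sub>R v + t *\<^sub>R w) = D v (D w f) (x + s' *\<^sub>R w + t' *\<^sub>R v)"
  proof
    fix n
    have pos: "?h n > 0" by simp
    obtain s t where 1: "0 < s" "s < ?h n" "0 < t" "t < ?h n"
      "f (x + ?h n *\<^sub>R v + ?h n *\<^sub>R w) - f (x + ?h n *\<^sub>R v) - f (x + ?h n *\<^sub>R w) + f x
       = ?h n * (?h n * D w (D v f) (x + s *\<^sub>R v + t *\<^sub>R w))"
      using mixed[OF pos, of v w] by blast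
    obtain s' t' where 2: "0 < s'" "s' < ?h n" "0 < t'" "t' < ?h n"
      "f (x + ?h n *\<^sub>R w + ?h n *\<^sub>R v) - f (x + ?h n *\<^sub>R w) - f (x + ?h n *\<^sub>R v) + f x
       = ?h n * (?h n * D v (D w f) (x + s' *\<^sub>R w + t' *\<^sub>R v))"
      using mixed[OF pos, of w v] by blast
    have "?h n * (?h n * D w (D v f) (x + s *\<^sub>R v + t *\<^sub>R w)) = ?h n * (?h n * D v (D w f) (x + s' *\<^sub>R w + t' *\<^sub>R v))"
      unfolding 1(5)[symmetric] 2(5)[symmetric] by (simp add: algebra_simps)
    then have "D w (D v f) (x + s *\<^sub>R v + t *\<^sub>R w) = D v (D w f) (x + s' *\<^sub>R w + t' *\<^sub>R v)"
      using pos by (metis less_irrefl mult_left_cancel)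
    then show "\<exists>s t s' t'. 0 < s \<and> s < ?h n \<and> 0 < t \<and> t < ?h n \<and> 0 < s' \<and> s' < ?h n \<and> 0 < t' \<and> t' < ?h n \<and>
     D w (D v f) (x + s *\<^sub>R v + t *\<^sub>R w) = D v (D w f) (x + s' *\<^sub>R w + t' *\<^sub>R v)"
      using 1 2 by blast
  qed
  then obtain s t s' t' where st: "\<And>n. 0 < s n \<and> s n < ?h n \<and> 0 < t n \<and> t n < ?h n"
      "\<And>n. 0 < s' n \<and> s' n < ?h n \<and> 0 < t' n \<and> t' n < ?h n"
     and eq: "\<And>n. D w (D v f) (x + s n *\<^sub>R v + t n *\<^sub>R w) = D v (D w f) (x + s' n *\<^sub>R w + t' n *\<^sub>R v)"
    by metis
  have "D w (D v f) x = D v (D w f) x"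
    using lim[of s t w v] lim[of s' t' v w] st unfolding eq by (intro LIMSEQ_unique) auto
  then show ?thesis by (simp add: D_def)
qed

section \<open>A smooth bump and its potential\<close>

text \<open>The denominator \<open>u ^ m\<close> makes the family closed under differentiation: the
  derivative of member m is a combination of members m + 1 and m + 2, so smoothness of every order
  follows from one induction, uniform in m.\<close>

definition flat_exp :: "nat \<Rightarrow> real \<Rightarrow> real" where
  "flat_exp m u = (if u > 0 then exp (- 1 / u) / u ^ m else 0)"

text \<open>With n = m + 1, \<open>exp (1 / u)\<close> dominates (1 + 1/(n u))^n and thus (n
  u)^(-n). One more power than the denominator has leaves a spare factor \<open>u\<close>, which
  forces the limit 0 at 0.\<close>

lemma flat_exp_le_linear:
  shows "\<bar>flat_exp m u\<bar> \<le> real (Suc m) ^ Suc m * \<bar>u\<bar>"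
proof (cases "u > 0")
  case True
  let ?n = "Suc m"
  have "(1 / (real ?n * u)) ^ ?n \<le> (1 + (1 / u) / real ?n) ^ ?n"
    using True by (intro power_mono) (auto simp: divide_simps)
  also have "\<dots> \<le> exp (1 / u)"
    using True by (intro exp_ge_one_plus_x_over_n_power_n) (auto intro: order.trans[of _ 0])
  finally have "1 \<le> exp (1 / u) * (real ?n * u) ^ ?n"
    using True by (simp add: power_divide divide_simps del: power_Suc of_nat_Suc)
  then have "exp (- 1 / u) \<le> (real ?n * u) ^ ?n"
    by (simp add: exp_minus field_simps)
  also have "\<dots> = real ?n ^ ?n * u * u ^ m"
    by (simp add: power_mult_distrib)
  finally show ?thesis
    using True by (simp add: flat_exp_def divide_simps)
qed (simp add: flat_exp_def mult_nonneg_nonpos del: of_nat_Suc power_Suc)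

lemma flat_exp_has_derivative:
  "(flat_exp m has_real_derivative (flat_exp (m + 2) u - m * flat_exp (m + 1) u)) (at u)"
proof -
  consider "u > 0" | "u < 0" | "u = 0" by linarith
  then show ?thesis
  proof cases
    case 1
    have "((\<lambda>u. exp (- 1 / u) / u ^ m) has_real_derivative
        exp (- 1 / u) / u ^ (m + 2) - m * (exp (- 1 / u) / u ^ (m + 1))) (at u)"
      using 1
      by (auto intro!: derivative_eq_intros simp: power2_eq_square)
        (cases m; auto simp: divide_simps power2_eq_square algebra_simps)
    then show ?thesis
      using 1 by (auto simp: flat_exp_def
        intro: has_field_derivative_transform_within_open[of _ _ _ "{0<..}"])
  next
    case 2
    then show ?thesis
      by (auto simp: flat_exp_def intro: has_field_derivative_transform_within_open[of "\<lambda>_. 0" _ _ "{..<0}"])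
  next
    case 3
    \<comment> \<open>The difference quotient of \<open>flat_exp m\<close> at 0 is
      \<open>flat_exp (Suc m)\<close>, so differentiability at 0 is a limit statement about the next
      member.\<close>
    have "((\<lambda>y. flat_exp (Suc m) y) \<longlongrightarrow> 0) (at 0)"
    proof (rule Lim_null_comparison)
      show "\<forall>\<^sub>F y in at 0. norm (flat_exp (Suc m) y) \<le> real (Suc (Suc m)) ^ Suc (Suc m) * \<bar>y\<bar>"
        using flat_exp_le_linear[of "Suc m"] by (intro always_eventually) auto
      show "((\<lambda>y. real (Suc (Suc m)) ^ Suc (Suc m) * \<bar>y\<bar>) \<longlongrightarrow> 0) (at 0)"
        by (auto intro!: tendsto_eq_intros)
    qed
    moreover have "flat_exp (Suc m) = (\<lambda>y. (flat_exp m y - flat_exp m 0) / (y - 0))"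
      by (auto simp: flat_exp_def fun_eq_iff)
    ultimately show ?thesis
      using 3 by (simp add: has_field_derivative_iff) (simp add: flat_exp_def)
  qed
qed

text \<open>The derivative is arranged as a sum times an inner product, the shape to which the
  closure rules for \<open>Ck_on\<close> apply in the induction that follows.\<close>

lemma flat_exp_norm_has_derivative:
  "((\<lambda>x. flat_exp m (1 - x \<bullet> x)) has_derivative
     (\<lambda>v. (flat_exp (m + 2) (1 - x \<bullet> x) + (- real m) * flat_exp (m + 1) (1 - x \<bullet> x)) * (x \<bullet> (- 2 *\<^sub>R v)))) (at x)"
proof -
  have "((\<lambda>x. 1 - x \<bullet> x) has_derivative (\<lambda>v. - 2 * (x \<bullet> v))) (at x)"
    by (auto intro!: derivative_eq_intros simp: inner_commute)
  from has_derivative_compose[OF this flat_exp_has_derivative[THEN has_field_derivative_imp_has_derivative]]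
  show ?thesis by (simp add: algebra_simps)
qed

lemma Ck_on_flat_exp: "Ck_on n UNIV (\<lambda>x::'a::euclidean_space. flat_exp m (1 - x \<bullet> x))"
proof (induction n arbitrary: m)
  case 0
  show ?case
    by (auto intro!: continuous_at_imp_continuous_on has_derivative_continuous[OF flat_exp_norm_has_derivative])
next
  case (Suc n)
  show ?case
  proof (rule Ck_on_Suc_if_derivative[OF open_UNIV])
    show "((\<lambda>x::'a. flat_exp m (1 - x \<bullet> x)) has_derivative
     (\<lambda>v. (flat_exp (m + 2) (1 - x \<bullet> x) + (- real m) * flat_exp (m + 1) (1 - x \<bullet> x)) * (x \<bullet> (- 2 *\<^sub>R v)))) (at x)"
      for x
      by (rule flat_exp_norm_has_derivative)
    show "Ck_on n UNIV (\<lambda>x::'a. (flat_exp (m + 2) (1 - x \<bullet> x) + (- real m) * flat_exp (m + 1) (1 - x \<bullet> x)) *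
        (x \<bullet> (- 2 *\<^sub>R v)))" for v
      by (rule Ck_on_mult[OF open_UNIV Ck_on_add[OF open_UNIV Suc.IH
           Ck_on_mult[OF open_UNIV Ck_on_const[OF open_UNIV] Suc.IH]] Ck_on_inner_left[OF open_UNIV]])
  qed
qed

text \<open>This is the kernel \<eta> of the overview, with \<open>bump_potential\<close> as
  \<Theta>: \<open>flat_exp 2\<close> is the derivative of the profile \<open>flat_exp 0\<close>,
  and the factor 2 comes from the gradient -2 x of 1 - x \<bullet> x.\<close>

definition bump :: "'a::euclidean_space \<Rightarrow> real" where
  "bump x = 2 * flat_exp 2 (1 - x \<bullet> x)"

definition bump_potential :: "'a::euclidean_space \<Rightarrow> real" where
  "bump_potential x = flat_exp 0 (1 - x \<bullet> x)"

text \<open>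
  The last clause says \<open>d/dt (t\<^sup>-\<^sup>N \<kappa>(x/t)) = t\<^sup>-\<^sup>N\<^sup>-\<^sup>1 (laplacian \<Lambda>)(x/t)\<close>.
\<close>

definition kernel_pair :: "nat \<Rightarrow> ('a::euclidean_space \<Rightarrow> real) \<Rightarrow> ('a \<Rightarrow> real) \<Rightarrow> bool" where
  "kernel_pair N \<kappa> \<Lambda> \<longleftrightarrow> (\<forall>n. Ck_on n UNIV \<kappa>) \<and> (\<forall>n. Ck_on n UNIV \<Lambda>) \<and>
     (\<forall>x. 1 < norm x \<longrightarrow> \<kappa> x = 0 \<and> \<Lambda> x = 0) \<and>
     (\<forall>x. real N * \<kappa> x + frechet_derivative \<kappa> (at x) x = - laplacian \<Lambda> x)"

lemma Ck_on_bump: "Ck_on n UNIV bump"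
  unfolding bump_def by (intro Ck_on_mult Ck_on_const Ck_on_flat_exp open_UNIV)

lemma bump_nonneg: "0 \<le> bump x"
  by (simp add: bump_def flat_exp_def)

lemma bump_zero: "1 < norm x \<Longrightarrow> bump x = 0"
proof -
  assume "1 < norm x"
  then have "1 < (norm x)\<^sup>2" by (simp add: power2_eq_square less_1_mult)
  then show ?thesis by (simp add: bump_def flat_exp_def power2_norm_eq_inner)
qed

lemma bump_0_pos: "0 < bump 0"
  by (simp add: bump_def flat_exp_def)

text \<open>The gradient of the potential is - \<open>bump x\<close> times x. Its divergence is
  minus the sum of d times \<open>bump\<close> and the radial derivative of \<open>bump\<close>,
  which is the required identity with N the dimension d.\<close>

lemma kernel_pair_bump: "kernel_pair DIM('a) (bump :: 'a::euclidean_space \<Rightarrow> real) bump_potential"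
  unfolding kernel_pair_def
proof (intro conjI allI impI)
  show "Ck_on n UNIV bump" for n by (rule Ck_on_bump)
  show pot: "Ck_on n UNIV bump_potential" for n
    unfolding bump_potential_def by (rule Ck_on_flat_exp)
  fix x :: 'a
  {
    assume "1 < norm x"
    then have "1 < (norm x)\<^sup>2" by (simp add: power2_eq_square less_1_mult)
    then show "bump x = 0" "bump_potential x = 0"
      by (simp_all add: bump_def bump_potential_def flat_exp_def power2_norm_eq_inner)
  }
  have bd: "(bump has_derivative frechet_derivative bump (at x)) (at x)" for x :: 'a
    by (rule Ck_on_has_derivative[OF Ck_on_bump]) simp
  have "(bump_potential has_derivative (\<lambda>v. - bump x * (x \<bullet> v))) (at x)" for x :: 'a
    unfolding bump_potential_def bump_def using flat_exp_norm_has_derivative[of 0 x]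
    by (simp add: algebra_simps numeral_2_eq_2)
  then have grad: "frechet_derivative bump_potential (at x) = (\<lambda>v. - bump x * (x \<bullet> v))" for x :: 'a
    by (rule frechet_derivative_at[symmetric])
  have "((\<lambda>y. - bump y * (y \<bullet> b)) has_derivative
      (\<lambda>v. - bump x * (v \<bullet> b) + - frechet_derivative bump (at x) v * (x \<bullet> b))) (at x)" for b
    by (rule has_derivative_mult[OF has_derivative_minus[OF bd] has_derivative_inner_left[OF has_derivative_ident]])
  then have "frechet_derivative (\<lambda>y. - bump y * (y \<bullet> b)) (at x) =
      (\<lambda>v. - bump x * (v \<bullet> b) + - frechet_derivative bump (at x) v * (x \<bullet> b))" for b
    by (rule frechet_derivative_at[symmetric])
  then have "laplacian bump_potential x =
     (\<Sum>b\<in>Basis. - bump x * (b \<bullet> b) + - frechet_derivative bump (at x) b * (x \<bullet> b))"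
    by (simp add: laplacian_def grad)
  also have "\<dots> = (\<Sum>b\<in>(Basis::'a set). - bump x) - (\<Sum>b\<in>Basis. (x \<bullet> b) * frechet_derivative bump (at x) b)"
    by (simp add: sum_subtractf mult.commute)
  also have "\<dots> = - (real DIM('a) * bump x + frechet_derivative bump (at x) x)"
    unfolding has_derivative_basis_expansion[OF bd, symmetric] by simp
  finally show "real DIM('a) * bump x + frechet_derivative bump (at x) x = - laplacian bump_potential x"
    by simp
qed

lemma Ck_on_laplacian: "Ck_on (Suc (Suc n)) S f \<Longrightarrow> open S \<Longrightarrow> Ck_on n S (laplacian f)"
  unfolding laplacian_def[abs_def] by (intro Ck_on_sum) auto

lemma frechet_derivative_zero:
  assumes "open S" "x \<in> S" "\<And>y. y \<in> S \<Longrightarrow> f y = 0"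
  shows "frechet_derivative f (at x) = (\<lambda>_. 0)"
  using frechet_derivative_transform_within_open[of "\<lambda>_. 0" x S f] assms by auto

lemma laplacian_zero:
  assumes "open S" "x \<in> S" "\<And>y. y \<in> S \<Longrightarrow> f y = 0"
  shows "laplacian f x = 0"
  unfolding laplacian_def
  by (simp add: frechet_derivative_zero[OF assms(1,2)] frechet_derivative_zero[OF assms(1) _ assms(3)])

lemma frechet_derivative_zero_outside:
  assumes "1 < norm x" "\<And>y. 1 < norm y \<Longrightarrow> f y = 0"
  shows "frechet_derivative f (at x) = (\<lambda>_. 0)"
  by (rule frechet_derivative_zero[of "{y. 1 < norm y}"]) (use assms in \<open>auto intro!: open_Collect_less continuous_intros\<close>)

text \<open>The identity is differentiated in direction \<open>v\<close>. The coefficients x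
  \<bullet> b of the radial derivative yield one additional copy of the derivative of \<kappa>,
  which raises N by 1. The same 1 is the additional power of 1/t that appears when \<kappa>(x/t) is
  differentiated in x.\<close>

lemma kernel_pair_derivative:
  fixes \<kappa> \<Lambda> :: "'a::euclidean_space \<Rightarrow> real"
  assumes "kernel_pair N \<kappa> \<Lambda>"
  shows "kernel_pair (Suc N) (\<lambda>x. frechet_derivative \<kappa> (at x) v) (\<lambda>x. frechet_derivative \<Lambda> (at x) v)"
proof -
  have \<kappa>: "Ck_on n UNIV \<kappa>" and \<Lambda>: "Ck_on n UNIV \<Lambda>"
    and out: "1 < norm x \<Longrightarrow> \<kappa> x = 0" "1 < norm x \<Longrightarrow> \<Lambda> x = 0"
    and eq: "real N * \<kappa> x + frechet_derivative \<kappa> (at x) x = - laplacian \<Lambda> x" for n x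
    using assms by (auto simp: kernel_pair_def)
  define D where "D v f = (\<lambda>x. frechet_derivative f (at x) v)" for v and f :: "'a \<Rightarrow> real"
  have smooth: "Ck_on n UNIV (D v f)" if "\<And>n. Ck_on n UNIV f" for n v f
    using that[of "Suc n"] by (simp add: D_def)
  have comm: "D v (D w f) = D w (D v f)" if "\<And>n. Ck_on n UNIV f" for v w f
    unfolding D_def using symmetric_second_derivative[OF that] by blast
  have der: "(f has_derivative (\<lambda>v. D v f x)) (at x)" if "\<And>n. Ck_on n UNIV f" for f x
    unfolding D_def by (rule Ck_on_has_derivative[OF that]) simp
  have D_eq: "D v f x = f' v" if "(f has_derivative f') (at x)" for f f' x v
    using frechet_derivative_at[OF that] by (simp add: D_def)
  have radial: "frechet_derivative f (at x) x = (\<Sum>b\<in>Basis. (x \<bullet> b) * D b f x)"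
    if "\<And>n. Ck_on n UNIV f" for f x
    using has_derivative_basis_expansion[OF der[OF that], of x x] by (simp add: D_def)
  have lap: "laplacian f = (\<lambda>x. \<Sum>b\<in>Basis. D b (D b f) x)" for f
    by (simp add: laplacian_def[abs_def] D_def)
  have "real N * D v \<kappa> x + D v \<kappa> x + frechet_derivative (D v \<kappa>) (at x) x = - laplacian (D v \<Lambda>) x" for x
  proof -
    \<comment> \<open>In the radial derivative the base point and the direction vary together;
      expanded in the basis it becomes a sum of products that can be differentiated.\<close>
    have "((\<lambda>x. real N * \<kappa> x + (\<Sum>b\<in>Basis. (x \<bullet> b) * D b \<kappa> x)) has_derivative
       (\<lambda>v. real N * D v \<kappa> x + (\<Sum>b\<in>Basis. (x \<bullet> b) * D v (D b \<kappa>) x + (v \<bullet> b) * D b \<kappa> x))) (at x)"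
      by (intro has_derivative_add has_derivative_sum has_derivative_mult has_derivative_mult_right
            has_derivative_inner_left has_derivative_ident der[OF \<kappa>] der[OF smooth[OF \<kappa>]])
    moreover have "(\<lambda>x. real N * \<kappa> x + (\<Sum>b\<in>Basis. (x \<bullet> b) * D b \<kappa> x)) = (\<lambda>x. - laplacian \<Lambda> x)"
      unfolding radial[OF \<kappa>, symmetric] eq by (rule refl)
    moreover have "((\<lambda>x. - laplacian \<Lambda> x) has_derivative (\<lambda>v. - (\<Sum>b\<in>Basis. D v (D b (D b \<Lambda>)) x))) (at x)"
      unfolding lap by (rule has_derivative_minus[OF has_derivative_sum[OF der[OF smooth[OF smooth[OF \<Lambda>]]]]])
    ultimately have "(\<lambda>v. real N * D v \<kappa> x + (\<Sum>b\<in>Basis. (x \<bullet> b) * D v (D b \<kappa>) x + (v \<bullet> b) * D b \<kappa> x))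
      = (\<lambda>v. - (\<Sum>b\<in>Basis. D v (D b (D b \<Lambda>)) x))"
      by (intro has_derivative_unique) (simp_all only:)
    then have "real N * D v \<kappa> x + (\<Sum>b\<in>Basis. (x \<bullet> b) * D v (D b \<kappa>) x + (v \<bullet> b) * D b \<kappa> x)
      = - (\<Sum>b\<in>Basis. D v (D b (D b \<Lambda>)) x)"
      by (rule fun_cong)
    moreover have "(\<Sum>b\<in>Basis. (x \<bullet> b) * D v (D b \<kappa>) x) = frechet_derivative (D v \<kappa>) (at x) x"
      unfolding comm[OF \<kappa>, of v] by (rule radial[symmetric]) (intro smooth \<kappa>)
    moreover have "(\<Sum>b\<in>Basis. (v \<bullet> b) * D b \<kappa> x) = D v \<kappa> x"
      by (rule has_derivative_basis_expansion[OF der[OF \<kappa>], symmetric])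
    moreover have "D v (D b (D b \<Lambda>)) = D b (D b (D v \<Lambda>))" for b
      unfolding comm[OF \<Lambda>, of v b, symmetric] by (rule comm[OF smooth[OF \<Lambda>]])
    then have "(\<Sum>b\<in>Basis. D v (D b (D b \<Lambda>)) x) = laplacian (D v \<Lambda>) x"
      unfolding lap by (intro sum.cong refl) metis
    ultimately show ?thesis
      unfolding sum.distrib by linarith
  qed
  note eq' = this
  show ?thesis
    unfolding kernel_pair_def D_def[symmetric]
  proof (intro conjI allI impI)
    show "Ck_on n UNIV (D v \<kappa>)" "Ck_on n UNIV (D v \<Lambda>)" for n
      by (rule smooth[OF \<kappa>], rule smooth[OF \<Lambda>])
    show "D v \<kappa> x = 0" "D v \<Lambda> x = 0" if "1 < norm x" for x
      using frechet_derivative_zero_outside[OF that out(1)] frechet_derivative_zero_outside[OF that out(2)]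
      by (simp_all add: D_def)
    show "real (Suc N) * D v \<kappa> x + frechet_derivative (D v \<kappa>) (at x) x = - laplacian (D v \<Lambda>) x" for x
      using eq'[of x] by (simp add: distrib_right)
  qed
qed

section \<open>Mollification\<close>

text \<open>No power of t is built in, because the right normalisation changes with the number of
  derivatives taken of the kernel. The fixed compact box permits differentiation under the integral
  for any continuous \<open>g\<close>.\<close>

definition mollify ::
  "'a::euclidean_space \<Rightarrow> 'a \<Rightarrow> ('a \<Rightarrow> real) \<Rightarrow> ('a \<Rightarrow> real) \<Rightarrow> real \<Rightarrow> 'a \<Rightarrow> real" where
  "mollify a b g \<kappa> t x = integral (cbox a b) (\<lambda>y. g y * \<kappa> ((1 / t) *\<^sub>R (x - y)))"

lemma continuous_mollify_integrand:
  fixes g \<kappa> :: "'a::euclidean_space \<Rightarrow> real"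
  assumes "continuous_on (cbox a b) g" "continuous_on UNIV \<kappa>"
  shows "continuous_on (cbox a b) (\<lambda>y. g y * \<kappa> ((1 / t) *\<^sub>R (x - y)))"
  by (intro continuous_on_compose2[OF assms(2)] assms(1) continuous_intros subset_UNIV)

lemma mollify_has_derivative:
  fixes g \<kappa> :: "'a::euclidean_space \<Rightarrow> real"
  assumes g: "continuous_on (cbox a b) g" and \<kappa>: "Ck_on 1 UNIV \<kappa>"
  shows "(mollify a b g \<kappa> t has_derivative
    (\<lambda>v. (1 / t) * mollify a b g (\<lambda>z. frechet_derivative \<kappa> (at z) v) t x)) (at x)"
proof -
  have der: "(\<kappa> has_derivative frechet_derivative \<kappa> (at z)) (at z)" for z
    using \<kappa> by (simp add: frechet_derivative_works)
  have cont: "continuous_on UNIV \<kappa>" "continuous_on UNIV (\<lambda>z. frechet_derivative \<kappa> (at z) v)" for v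
    using Ck_on_continuous[OF \<kappa>] \<kappa> by auto
  define F' where "F' x y v = g y * frechet_derivative \<kappa> (at ((1 / t) *\<^sub>R (x - y))) ((1 / t) *\<^sub>R v)" for x y v
  have F'_bl: "bounded_linear (F' x y)" for x y
    unfolding F'_def
    by (intro bounded_linear_intros bounded_linear_compose[OF has_derivative_bounded_linear[OF der]])
  have F'_eq: "F' x y v = (1 / t) * (g y * frechet_derivative \<kappa> (at ((1 / t) *\<^sub>R (x - y))) v)" for x y v
    using linear_scale[OF has_derivative_linear[OF der]] by (simp add: F'_def)
  have apply_F': "blinfun_apply (Blinfun (F' x y)) = F' x y" for x y
    by (rule bounded_linear_Blinfun_apply[OF F'_bl])
  \<comment> \<open>The Leibniz rule asks for joint continuity of the derivative as a bounded linear
    map; in finite dimension it suffices to test this on each vector.\<close>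
  have cont_F': "continuous_on (UNIV \<times> cbox a b) (\<lambda>(x, y). Blinfun (F' x y))"
  proof (rule continuous_on_blinfun_componentwise)
    fix v :: 'a
    have "continuous_on (UNIV \<times> cbox a b)
       (\<lambda>p. (1 / t) * (g (snd p) * frechet_derivative \<kappa> (at ((1 / t) *\<^sub>R (fst p - snd p))) v))"
      by (intro continuous_on_compose2[OF g] continuous_on_compose2[OF cont(2)] continuous_intros
          subset_UNIV) auto
    then show "continuous_on (UNIV \<times> cbox a b) (\<lambda>p. blinfun_apply (case p of (x, y) \<Rightarrow> Blinfun (F' x y)) v)"
      by (simp add: case_prod_beta apply_F' F'_eq)
  qed
  have "((\<lambda>x. integral (cbox a b) (\<lambda>y. g y * \<kappa> ((1 / t) *\<^sub>R (x - y)))) has_derivative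
     blinfun_apply (integral (cbox a b) (\<lambda>y. Blinfun (F' x y)))) (at x within UNIV)"
  proof (rule leibniz_rule[OF _ _ cont_F'])
    fix x y :: 'a
    have "((\<lambda>x. (1 / t) *\<^sub>R (x - y)) has_derivative (\<lambda>v. (1 / t) *\<^sub>R v)) (at x)"
      by (auto intro!: derivative_eq_intros)
    then have "((\<lambda>x. \<kappa> ((1 / t) *\<^sub>R (x - y))) has_derivative
        (\<lambda>v. frechet_derivative \<kappa> (at ((1 / t) *\<^sub>R (x - y))) ((1 / t) *\<^sub>R v))) (at x)"
      by (rule has_derivative_compose[OF _ der])
    then show "((\<lambda>x. g y * \<kappa> ((1 / t) *\<^sub>R (x - y))) has_derivative blinfun_apply (Blinfun (F' x y)))
        (at x within UNIV)"
      unfolding apply_F' unfolding F'_def by (rule has_derivative_mult_right)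
  qed (auto intro!: integrable_continuous continuous_mollify_integrand g cont)
  moreover have "blinfun_apply (integral (cbox a b) (\<lambda>y. Blinfun (F' x y))) =
     (\<lambda>v. (1 / t) * mollify a b g (\<lambda>z. frechet_derivative \<kappa> (at z) v) t x)"
  proof (rule ext)
    fix v
    have "continuous_on (cbox a b) (\<lambda>y. case (x, y) of (x, y) \<Rightarrow> Blinfun (F' x y))"
      by (rule continuous_on_compose2[OF cont_F']) (auto intro!: continuous_intros)
    then have "continuous_on (cbox a b) (\<lambda>y. Blinfun (F' x y))"
      by simp
    then have "blinfun_apply (integral (cbox a b) (\<lambda>y. Blinfun (F' x y))) v = integral (cbox a b) (\<lambda>y. F' x y v)"
      by (simp add: blinfun_apply_integral integrable_continuous apply_F')
    also have "\<dots> = (1 / t) * mollify a b g (\<lambda>z. frechet_derivative \<kappa> (at z) v) t x"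
      unfolding mollify_def F'_eq by (rule integral_mult_right)
    finally show "blinfun_apply (integral (cbox a b) (\<lambda>y. Blinfun (F' x y))) v =
      (1 / t) * mollify a b g (\<lambda>z. frechet_derivative \<kappa> (at z) v) t x" .
  qed
  ultimately show ?thesis
    by (simp add: mollify_def[abs_def])
qed

text \<open>For fixed x and y the argument z = (x - y)/t moves with velocity -z/t as t varies, so
  the scale derivative sees only the radial derivative of the kernel.\<close>

lemma mollify_has_real_derivative_scale:
  fixes g \<kappa> :: "'a::euclidean_space \<Rightarrow> real"
  assumes g: "continuous_on (cbox a b) g" and \<kappa>: "Ck_on 1 UNIV \<kappa>" and "0 < t"
  shows "((\<lambda>t. mollify a b g \<kappa> t x) has_real_derivative
    - (1 / t) * mollify a b g (\<lambda>z. frechet_derivative \<kappa> (at z) z) t x) (at t)"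
proof -
  have der: "(\<kappa> has_derivative frechet_derivative \<kappa> (at z)) (at z)" for z
    using \<kappa> by (simp add: frechet_derivative_works)
  have cont: "continuous_on UNIV \<kappa>" "continuous_on UNIV (\<lambda>z. frechet_derivative \<kappa> (at z) v)" for v
    using Ck_on_continuous[OF \<kappa>] \<kappa> by auto
  let ?R = "\<lambda>z. frechet_derivative \<kappa> (at z) z"
  have contR: "continuous_on UNIV ?R"
    by (subst has_derivative_basis_expansion[OF der]) (intro continuous_intros cont)
  have "((\<lambda>t. integral (cbox a b) (\<lambda>y. g y * \<kappa> ((1 / t) *\<^sub>R (x - y)))) has_real_derivative
     integral (cbox a b) (\<lambda>y. - (1 / t) * (g y * ?R ((1 / t) *\<^sub>R (x - y))))) (at t within {0<..})"
  proof (rule leibniz_rule_field_derivative)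
    show "((\<lambda>t. g y * \<kappa> ((1 / t) *\<^sub>R (x - y))) has_real_derivative
       - (1 / t) * (g y * ?R ((1 / t) *\<^sub>R (x - y)))) (at t within {0<..})" if "t \<in> {0<..}" for t y
    proof -
      let ?z = "(1 / t) *\<^sub>R (x - y)"
      have "((\<lambda>t. (1 / t) *\<^sub>R (x - y)) has_derivative (\<lambda>r. (- (1 / t) * r) *\<^sub>R ?z)) (at t)"
        using that by (auto intro!: derivative_eq_intros simp: divide_simps)
      from has_derivative_compose[OF this der]
      have "((\<lambda>t. \<kappa> ((1 / t) *\<^sub>R (x - y))) has_derivative
          (\<lambda>r. frechet_derivative \<kappa> (at ?z) ((- (1 / t) * r) *\<^sub>R ?z))) (at t)" .
      also have "(\<lambda>r. frechet_derivative \<kappa> (at ?z) ((- (1 / t) * r) *\<^sub>R ?z)) = (*) (- (1 / t) * ?R ?z)"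
        by (rule ext) (simp only: linear_scale[OF has_derivative_linear[OF der]] real_scaleR_def mult_ac)
      finally have "((\<lambda>t. \<kappa> ((1 / t) *\<^sub>R (x - y))) has_real_derivative - (1 / t) * ?R ?z) (at t)"
        unfolding has_field_derivative_def .
      from DERIV_cmult[OF this, of "g y"]
      have "((\<lambda>t. g y * \<kappa> ((1 / t) *\<^sub>R (x - y))) has_real_derivative - (1 / t) * (g y * ?R ?z)) (at t)"
        by (simp only: mult.left_commute)
      then show ?thesis
        by (rule has_field_derivative_at_within)
    qed
    show "continuous_on ({0<..} \<times> cbox a b) (\<lambda>(t, y). - (1 / t) * (g y * ?R ((1 / t) *\<^sub>R (x - y))))"
      unfolding case_prod_beta
      by (intro continuous_on_compose2[OF g] continuous_on_compose2[OF contR]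
          continuous_intros subset_UNIV) auto
  qed (use \<open>0 < t\<close> in \<open>auto intro!: integrable_continuous continuous_mollify_integrand g cont\<close>)
  then show ?thesis
    unfolding mollify_def integral_mult_right
    using \<open>0 < t\<close> by (simp add: at_within_open[of t "{0<..}"])
qed

text \<open>The substitution y = x - t z moves the scale from the kernel to \<open>g\<close>, so
  that all estimates use a fixed kernel on a fixed cube. The power of t is the Jacobian.\<close>

lemma mollify_rescale:
  fixes g \<kappa> :: "'a::euclidean_space \<Rightarrow> real"
  assumes g: "continuous_on (cbox a b) g" and \<kappa>: "continuous_on UNIV \<kappa>" and "0 < t"
    and out: "\<And>z. 1 < norm z \<Longrightarrow> \<kappa> z = 0"
    and sub: "cbox (x - t *\<^sub>R One) (x + t *\<^sub>R One) \<subseteq> cbox a b"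
  shows "((\<lambda>z. g (x - t *\<^sub>R z) * \<kappa> z) has_integral mollify a b g \<kappa> t x / t ^ DIM('a)) (cbox (- One) One)"
proof -
  have img: "x - t *\<^sub>R z \<in> cbox (x - t *\<^sub>R One) (x + t *\<^sub>R One)" if "z \<in> cbox (- One) One" for z
    using that \<open>0 < t\<close> unfolding mem_box
    by (auto simp: inner_diff_left inner_add_left) (smt (verit) mult_left_le mult_minus_right mult_le_cancel_left_pos)+
  have "continuous_on (cbox (- One) One) (\<lambda>z. g (x - t *\<^sub>R z) * \<kappa> z)"
    using img sub
    by (intro continuous_on_compose2[OF g] continuous_on_subset[OF \<kappa>] continuous_intros subset_UNIV) auto
  then obtain I where I: "((\<lambda>z. g (x - t *\<^sub>R z) * \<kappa> z) has_integral I) (cbox (- One) One)"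
    using integrable_continuous integrable_on_def by blast
  have "((\<lambda>y. g (x - t *\<^sub>R ((- (1 / t)) *\<^sub>R y + (1 / t) *\<^sub>R x)) * \<kappa> ((- (1 / t)) *\<^sub>R y + (1 / t) *\<^sub>R x)) has_integral
      (1 / \<bar>- (1 / t)\<bar> ^ DIM('a)) *\<^sub>R I)
      ((\<lambda>x'. (1 / - (1 / t)) *\<^sub>R x' + - ((1 / - (1 / t)) *\<^sub>R (1 / t) *\<^sub>R x)) ` cbox (- One) One)"
    using \<open>0 < t\<close> by (intro has_integral_affinity[OF I]) auto
  also have "(\<lambda>y. g (x - t *\<^sub>R ((- (1 / t)) *\<^sub>R y + (1 / t) *\<^sub>R x)) * \<kappa> ((- (1 / t)) *\<^sub>R y + (1 / t) *\<^sub>R x)) =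
      (\<lambda>y. g y * \<kappa> ((1 / t) *\<^sub>R (x - y)))"
    using \<open>0 < t\<close> by (auto simp: algebra_simps)
  also have "(1 / \<bar>- (1 / t)\<bar> ^ DIM('a)) *\<^sub>R I = t ^ DIM('a) * I"
    using \<open>0 < t\<close> by (simp add: power_divide)
  also have "(\<lambda>x'. (1 / - (1 / t)) *\<^sub>R x' + - ((1 / - (1 / t)) *\<^sub>R (1 / t) *\<^sub>R x)) = (\<lambda>x'. (- t) *\<^sub>R x' + x)"
    using \<open>0 < t\<close> by auto
  also have "(\<lambda>x'. (- t) *\<^sub>R x' + x) ` cbox (- One) One = cbox (x - t *\<^sub>R One) (x + t *\<^sub>R One)"
  proof -
    have ne: "cbox (- One) (One :: 'a) \<noteq> {}" by (auto simp: box_ne_empty)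
    show ?thesis
      unfolding image_affinity_cbox using ne \<open>0 < t\<close> by (simp add: algebra_simps)
  qed
  finally have "((\<lambda>y. g y * \<kappa> ((1 / t) *\<^sub>R (x - y))) has_integral t ^ DIM('a) * I) (cbox a b)"
  proof (rule has_integral_on_superset[OF _ _ sub])
    \<comment> \<open>Outside the cube some coordinate of x - y exceeds t, so the kernel argument
      has left the unit ball.\<close>
    fix y assume "y \<notin> cbox (x - t *\<^sub>R One) (x + t *\<^sub>R One)"
    then obtain b where b: "b \<in> Basis" "t < \<bar>(x - y) \<bullet> b\<bar>"
      unfolding mem_box by (force simp: inner_diff_left inner_add_left)
    then have "t < norm (x - y)" using Basis_le_norm[OF b(1), of "x - y"] by linarith
    then have "1 < norm ((1 / t) *\<^sub>R (x - y))" using \<open>0 < t\<close> by simp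
    then show "g y * \<kappa> ((1 / t) *\<^sub>R (x - y)) = 0" by (simp add: out)
  qed
  then have "mollify a b g \<kappa> t x = t ^ DIM('a) * I"
    unfolding mollify_def by (rule integral_unique)
  then show ?thesis using I \<open>0 < t\<close> by simp
qed

text \<open>The kernel vanishes beyond the unit ball, so only values of \<open>g\<close> within
  distance t of \<open>x\<close> count; the last factor is the volume of the reference cube.\<close>

lemma mollify_bound:
  fixes g \<kappa> :: "'a::euclidean_space \<Rightarrow> real"
  assumes g: "continuous_on (cbox a b) g" and \<kappa>: "continuous_on UNIV \<kappa>" and "0 < t"
    and out: "\<And>z. 1 < norm z \<Longrightarrow> \<kappa> z = 0"
    and sub: "cbox (x - t *\<^sub>R One) (x + t *\<^sub>R One) \<subseteq> cbox a b"
    and M: "\<And>y. norm (x - y) \<le> t \<Longrightarrow> \<bar>g y\<bar> \<le> M" and C: "\<And>z. \<bar>\<kappa> z\<bar> \<le> C"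
  shows "\<bar>mollify a b g \<kappa> t x / t ^ DIM('a)\<bar> \<le> M * C * 2 ^ DIM('a)"
proof -
  have "0 \<le> M" using M[of x] \<open>0 < t\<close> by auto
  have "0 \<le> C" using C[of 0] by auto
  have "norm (g (x - t *\<^sub>R z) * \<kappa> z) \<le> M * C" for z
  proof (cases "1 < norm z")
    case True
    then show ?thesis using out \<open>0 \<le> M\<close> \<open>0 \<le> C\<close> by simp
  next
    case False
    then have "norm (x - (x - t *\<^sub>R z)) \<le> t" using \<open>0 < t\<close> by (simp add: mult_le_cancel_left1)
    then show ?thesis using M C \<open>0 \<le> M\<close> by (simp add: abs_mult mult_mono)
  qed
  then have "norm (mollify a b g \<kappa> t x / t ^ DIM('a)) \<le> M * C * measure lborel (cbox (- One) (One::'a))"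
    using \<open>0 \<le> M\<close> \<open>0 \<le> C\<close> by (intro has_integral_bound[OF _ mollify_rescale[OF assms(1-5)]]) auto
  also have "measure lborel (cbox (- One) (One::'a)) = 2 ^ DIM('a)"
    by (subst content_cbox) (auto simp: inner_diff_left)
  finally show ?thesis by simp
qed

lemma cball_subset_cbox_One:
  fixes x y :: "'a::euclidean_space"
  shows "norm (x - y) \<le> t \<Longrightarrow> y \<in> cbox (x - t *\<^sub>R One) (x + t *\<^sub>R One)"
  unfolding mem_box using Basis_le_norm[of _ "x - y"]
  by (force simp: inner_diff_left inner_add_left dest: order.trans)

text \<open>For a kernel of mean zero the last term disappears, and \<open>g\<close> may be replaced
  by its deviation from a constant. This is how Hoelder continuity enters later.\<close>

lemma mollify_diff_const:
  fixes g \<kappa> :: "'a::euclidean_space \<Rightarrow> real"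
  assumes g: "continuous_on (cbox a b) g" and \<kappa>: "continuous_on UNIV \<kappa>" and "0 < t"
    and out: "\<And>z. 1 < norm z \<Longrightarrow> \<kappa> z = 0"
    and sub: "cbox (x - t *\<^sub>R One) (x + t *\<^sub>R One) \<subseteq> cbox a b"
  shows "mollify a b (\<lambda>y. g y - c) \<kappa> t x / t ^ DIM('a) =
     mollify a b g \<kappa> t x / t ^ DIM('a) - c * integral (cbox (- One) One) \<kappa>"
proof -
  have "((\<lambda>z. (g (x - t *\<^sub>R z) - c) * \<kappa> z) has_integral
      mollify a b (\<lambda>y. g y - c) \<kappa> t x / t ^ DIM('a)) (cbox (- One) One)"
    by (intro mollify_rescale assms continuous_intros)
  moreover have "((\<lambda>z. g (x - t *\<^sub>R z) * \<kappa> z - c * \<kappa> z) has_integral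
      mollify a b g \<kappa> t x / t ^ DIM('a) - c * integral (cbox (- One) One) \<kappa>) (cbox (- One) One)"
    by (intro has_integral_diff has_integral_mult_right integrable_integral mollify_rescale assms
        integrable_continuous continuous_on_subset[OF \<kappa>]) auto
  ultimately show ?thesis
    by (simp add: left_diff_distrib has_integral_unique)
qed

lemma continuous_on_bounded_support:
  fixes g \<kappa> :: "'a::euclidean_space \<Rightarrow> real"
  assumes "continuous_on UNIV \<kappa>" "\<And>z. 1 < norm z \<Longrightarrow> \<kappa> z = 0"
  obtains C where "0 < C" "\<And>z. \<bar>\<kappa> z\<bar> \<le> C"
proof -
  have "bounded (\<kappa> ` cball 0 1)"
    by (intro compact_imp_bounded compact_continuous_image continuous_on_subset[OF assms(1)]) auto
  then obtain C where "0 < C" "\<And>z. norm z \<le> 1 \<Longrightarrow> \<bar>\<kappa> z\<bar> \<le> C"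
    unfolding bounded_pos by auto
  then have "\<bar>\<kappa> z\<bar> \<le> C" for z using assms(2)[of z] by (cases "1 < norm z") auto
  then show ?thesis using that \<open>0 < C\<close> by blast
qed

lemma mollify_tendsto:
  fixes g \<kappa> :: "'a::euclidean_space \<Rightarrow> real"
  assumes g: "continuous_on (cbox a b) g" and \<kappa>: "continuous_on UNIV \<kappa>"
    and out: "\<And>z. 1 < norm z \<Longrightarrow> \<kappa> z = 0"
    and x: "x \<in> box a b"
    and sub: "\<And>n. cbox (x - t n *\<^sub>R One) (x + t n *\<^sub>R One) \<subseteq> cbox a b"
    and t: "\<And>n::nat. 0 < t n" "t \<longlonglongrightarrow> 0"
  shows "(\<lambda>n. mollify a b g \<kappa> (t n) x / t n ^ DIM('a)) \<longlonglongrightarrow> g x * integral (cbox (- One) One) \<kappa>"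
proof (rule LIMSEQ_I)
  fix e :: real assume "0 < e"
  obtain C where C: "0 < C" "\<And>z. \<bar>\<kappa> z\<bar> \<le> C"
    using continuous_on_bounded_support[OF \<kappa> out] by blast
  \<comment> \<open>Chosen so that \<open>mollify_bound\<close> with oscillation e' gives exactly e
    / 2.\<close>
  define e' where "e' = e / (2 * C * 2 ^ DIM('a))"
  have "0 < e'" using \<open>0 < e\<close> C by (simp add: e'_def)
  have "isCont g x"
    using g x by (meson continuous_on_eq_continuous_at continuous_on_subset box_subset_cbox open_box)
  then obtain d where d: "0 < d" "\<And>y. y \<noteq> x \<Longrightarrow> dist y x < d \<Longrightarrow> dist (g y) (g x) < e'"
    using metric_LIM_D[OF _ \<open>0 < e'\<close>, of g "g x" x] unfolding isCont_def by auto
  obtain N where N: "\<And>n. n \<ge> N \<Longrightarrow> t n < d"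
    using LIMSEQ_D[OF t(2) \<open>0 < d\<close>] by (auto simp: abs_less_iff)
  have "norm (mollify a b g \<kappa> (t n) x / t n ^ DIM('a) - g x * integral (cbox (- One) One) \<kappa>) < e" if "n \<ge> N" for n
  proof -
    have "\<bar>mollify a b (\<lambda>y. g y - g x) \<kappa> (t n) x / t n ^ DIM('a)\<bar> \<le> e' * C * 2 ^ DIM('a)"
    proof (rule mollify_bound[OF continuous_on_diff[OF g continuous_on_const] \<kappa> t(1) out sub _ C(2)])
      fix y assume "norm (x - y) \<le> t n"
      then show "\<bar>g y - g x\<bar> \<le> e'"
        using d(2)[of y] N[OF that] \<open>0 < e'\<close>
        by (cases "y = x") (auto simp: dist_norm norm_minus_commute less_imp_le)
    qed
    also have "\<dots> = e / 2" using C by (simp add: e'_def)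
    also have "\<dots> < e" using \<open>0 < e\<close> by simp
    also have "mollify a b (\<lambda>y. g y - g x) \<kappa> (t n) x / t n ^ DIM('a) =
        mollify a b g \<kappa> (t n) x / t n ^ DIM('a) - g x * integral (cbox (- One) One) \<kappa>"
      by (rule mollify_diff_const[OF g \<kappa> t(1) out sub])
    finally show ?thesis
      by (simp only: real_norm_def)
  qed
  then show "\<exists>N. \<forall>n\<ge>N. norm (mollify a b g \<kappa> (t n) x / t n ^ DIM('a) - g x * integral (cbox (- One) One) \<kappa>) < e"
    by blast
qed

text \<open>Mollifying the constant 1 gives the same value for every centre whose unit cube fits
  into the box. The derivative in the centre is therefore 0, and at the origin it is the integral in
  question.\<close>

lemma integral_derivative_zero:
  fixes \<Lambda> :: "'a::euclidean_space \<Rightarrow> real"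
  assumes \<Lambda>: "Ck_on 1 UNIV \<Lambda>" and out: "\<And>z. 1 < norm z \<Longrightarrow> \<Lambda> z = 0"
  shows "integral (cbox (- One) One) (\<lambda>z. frechet_derivative \<Lambda> (at z) v) = 0"
proof -
  \<comment> \<open>Cubes of half-side 1 centred in the unit ball reach at most to 2 in each
    coordinate.\<close>
  let ?a = "- (3 *\<^sub>R One) :: 'a" and ?b = "3 *\<^sub>R One :: 'a"
  have sub: "cbox (x - 1 *\<^sub>R One) (x + 1 *\<^sub>R One) \<subseteq> cbox ?a ?b" if "x \<in> ball 0 1" for x :: 'a
  proof -
    have "\<bar>x \<bullet> i\<bar> \<le> 1" if "i \<in> Basis" for i
      using Basis_le_norm[OF that, of x] \<open>x \<in> ball 0 1\<close> by simp
    then show ?thesis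
      by (auto simp: subset_box inner_diff_left inner_add_left abs_le_iff) (smt (verit))+
  qed
  have resc: "mollify ?a ?b (\<lambda>_. 1) \<kappa> 1 x = integral (cbox (- One) One) \<kappa>"
    if "x \<in> ball 0 1" "continuous_on UNIV \<kappa>" "\<And>z. 1 < norm z \<Longrightarrow> \<kappa> z = 0" for \<kappa> and x :: 'a
    using mollify_rescale[OF continuous_on_const that(2) zero_less_one that(3) sub[OF that(1)], of 1]
    by (simp add: integral_unique)
  have "(mollify ?a ?b (\<lambda>_. 1) \<Lambda> 1 has_derivative
     (\<lambda>v. (1 / 1) * mollify ?a ?b (\<lambda>_. 1) (\<lambda>z. frechet_derivative \<Lambda> (at z) v) 1 0)) (at 0)"
    by (intro mollify_has_derivative \<Lambda> continuous_intros)
  moreover have "(mollify ?a ?b (\<lambda>_. 1) \<Lambda> 1 has_derivative (\<lambda>v. 0)) (at 0)"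
  proof (rule has_derivative_transform_within_open)
    show "((\<lambda>_. integral (cbox (- One) One) \<Lambda>) has_derivative (\<lambda>v. 0)) (at (0::'a))" by simp
    show "integral (cbox (- One) One) \<Lambda> = mollify ?a ?b (\<lambda>_. 1) \<Lambda> 1 x" if "x \<in> ball 0 1" for x
      by (rule resc[symmetric]) (use that out Ck_on_continuous[OF \<Lambda>] in auto)
  qed auto
  ultimately have "(\<lambda>v. (1 / 1) * mollify ?a ?b (\<lambda>_. 1) (\<lambda>z. frechet_derivative \<Lambda> (at z) v) 1 0) = (\<lambda>v. 0)"
    by (rule has_derivative_unique)
  from fun_cong[OF this, of v]
  have "mollify ?a ?b (\<lambda>_. 1) (\<lambda>z. frechet_derivative \<Lambda> (at z) v) 1 0 = 0"
    by simp
  moreover have "frechet_derivative \<Lambda> (at z) v = 0" if "1 < norm z" for z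
    using frechet_derivative_zero_outside[OF that out] by simp
  ultimately show ?thesis
    using resc[of 0 "\<lambda>z. frechet_derivative \<Lambda> (at z) v"] \<Lambda> by simp
qed

section \<open>Mollified solutions of the Poisson equation\<close>

text \<open>The distributional equation with Laplacian of \<open>g\<close> equal to
  \<open>G\<close>, both derivatives resting on the test function. Continuity up to the boundary of
  the box makes \<open>G\<close> bounded and every integrand continuous on a compact set.\<close>

definition weak_poisson ::
  "'a::euclidean_space \<Rightarrow> 'a \<Rightarrow> ('a \<Rightarrow> real) \<Rightarrow> ('a \<Rightarrow> real) \<Rightarrow> bool" where
  "weak_poisson a b g G \<longleftrightarrow> continuous_on (cbox a b) g \<and> continuous_on (cbox a b) G \<and>
     (\<forall>\<psi>\<in>test_functions (box a b).
        integral (cbox a b) (\<lambda>y. g y * laplacian \<psi> y) = integral (cbox a b) (\<lambda>y. G y * \<psi> y))"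

lemma frechet_derivative_compose_affine:
  fixes f :: "'a::euclidean_space \<Rightarrow> real"
  assumes "f differentiable (at (c + m *\<^sub>R x))"
  shows "frechet_derivative (\<lambda>x. f (c + m *\<^sub>R x)) (at x) v = m * frechet_derivative f (at (c + m *\<^sub>R x)) v"
proof -
  have f: "(f has_derivative frechet_derivative f (at (c + m *\<^sub>R x))) (at (c + m *\<^sub>R x))"
    using assms by (simp add: frechet_derivative_works)
  have "((\<lambda>x. c + m *\<^sub>R x) has_derivative (\<lambda>v. m *\<^sub>R v)) (at x)"
    by (auto intro!: derivative_eq_intros)
  from frechet_derivative_at[OF has_derivative_compose[OF this f], symmetric]
  show ?thesis
    using linear_scale[OF has_derivative_linear[OF f]] by simp
qed

lemma laplacian_compose_affine:
  fixes f :: "'a::euclidean_space \<Rightarrow> real"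
  assumes "Ck_on 2 UNIV f"
  shows "laplacian (\<lambda>x. f (c + m *\<^sub>R x)) x = m\<^sup>2 * laplacian f (c + m *\<^sub>R x)"
proof -
  have 1: "f differentiable (at x)" and 2: "(\<lambda>y. frechet_derivative f (at y) b) differentiable (at x)" for x b
    using assms by (auto simp: numeral_2_eq_2)
  have D: "((\<lambda>y. frechet_derivative f (at (c + m *\<^sub>R y)) b) has_derivative
      frechet_derivative (\<lambda>y. frechet_derivative f (at (c + m *\<^sub>R y)) b) (at x)) (at x)" for b
    using Ck_on_compose_affine[OF Ck_on_frechet[of 1], of UNIV f UNIV c m b] assms
    by (intro Ck_on_has_derivative[of 0 UNIV]) (simp_all add: numeral_2_eq_2)
  have "frechet_derivative (\<lambda>y. frechet_derivative (\<lambda>x. f (c + m *\<^sub>R x)) (at y) b) (at x) b =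
      m\<^sup>2 * frechet_derivative (\<lambda>y. frechet_derivative f (at y) b) (at (c + m *\<^sub>R x)) b" for b
  proof -
    have "frechet_derivative (\<lambda>y. m * frechet_derivative f (at (c + m *\<^sub>R y)) b) (at x) =
       (\<lambda>v. m * frechet_derivative (\<lambda>y. frechet_derivative f (at (c + m *\<^sub>R y)) b) (at x) v)"
      by (rule frechet_derivative_at[symmetric, OF has_derivative_mult_right[OF D]])
    then show ?thesis
      by (simp add: frechet_derivative_compose_affine[OF 1] frechet_derivative_compose_affine[OF 2]
          power2_eq_square)
  qed
  then show ?thesis
    by (simp add: laplacian_def sum_distrib_left)
qed

text \<open>As a function of the integration variable the rescaled kernel is an admissible test
  function once its support lies in the open box. The sign change in x - y leaves the Laplacian
  alone, and the rescaling contributes t^2.\<close>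

lemma mollify_laplacian:
  fixes \<Lambda> :: "'a::euclidean_space \<Rightarrow> real"
  assumes weak: "weak_poisson a b g G" and \<Lambda>: "\<And>n. Ck_on n UNIV \<Lambda>"
    and out: "\<And>z. 1 < norm z \<Longrightarrow> \<Lambda> z = 0" and "0 < t"
    and sub: "cbox (x - t *\<^sub>R One) (x + t *\<^sub>R One) \<subseteq> box a b"
  shows "mollify a b g (laplacian \<Lambda>) t x = t\<^sup>2 * mollify a b G \<Lambda> t x"
proof -
  define \<psi> where "\<psi> = (\<lambda>y. \<Lambda> ((1 / t) *\<^sub>R x + (- (1 / t)) *\<^sub>R y))"
  have arg: "(1 / t) *\<^sub>R x + (- (1 / t)) *\<^sub>R y = (1 / t) *\<^sub>R (x - y)" for y
    by (simp add: algebra_simps)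
  have supp: "closure {y. \<psi> y \<noteq> 0} \<subseteq> cball x t"
  proof (rule closure_minimal)
    show "{y. \<psi> y \<noteq> 0} \<subseteq> cball x t"
    proof
      fix y assume "y \<in> {y. \<psi> y \<noteq> 0}"
      then have "\<not> 1 < norm ((1 / t) *\<^sub>R (x - y))"
        using out unfolding \<psi>_def arg by auto
      then show "y \<in> cball x t"
        using \<open>0 < t\<close> by (simp add: dist_norm)
    qed
  qed auto
  have "\<psi> \<in> test_functions (box a b)"
    unfolding test_functions_def
  proof (intro CollectI conjI allI)
    show "Ck_on n UNIV \<psi>" for n
      unfolding \<psi>_def by (rule Ck_on_compose_affine[OF \<Lambda>]) auto
    show "compact (closure {x. \<psi> x \<noteq> 0})"
      using supp by (meson bounded_cball bounded_subset closed_closure compact_eq_bounded_closed)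
    show "closure {x. \<psi> x \<noteq> 0} \<subseteq> box a b"
      using supp sub cball_subset_cbox_One[of x _ t] by (force simp: dist_norm)
  qed
  then have "integral (cbox a b) (\<lambda>y. g y * laplacian \<psi> y) = integral (cbox a b) (\<lambda>y. G y * \<psi> y)"
    using weak by (simp add: weak_poisson_def)
  moreover have "laplacian \<psi> y = (1 / t)\<^sup>2 * laplacian \<Lambda> ((1 / t) *\<^sub>R (x - y))" for y
    using laplacian_compose_affine[OF \<Lambda>, of "(1 / t) *\<^sub>R x" "- (1 / t)" y] unfolding \<psi>_def arg by simp
  ultimately have "(1 / t)\<^sup>2 * mollify a b g (laplacian \<Lambda>) t x = mollify a b G \<Lambda> t x"
    unfolding mollify_def \<psi>_def arg integral_mult_right[symmetric] by (simp add: mult_ac)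
  then show ?thesis
    using \<open>0 < t\<close> by (simp add: divide_simps mult.commute)
qed

text \<open>The power of t contributes the term with N and the scale derivative contributes the
  radial term. By the identity of the pair they combine to a Laplacian, which the weak equation
  transfers to \<open>G\<close>.\<close>

lemma mollify_has_real_derivative_kernel_pair:
  fixes \<kappa> \<Lambda> :: "'a::euclidean_space \<Rightarrow> real"
  assumes weak: "weak_poisson a b g G" and pair: "kernel_pair N \<kappa> \<Lambda>" and "0 < t"
    and sub: "cbox (x - t *\<^sub>R One) (x + t *\<^sub>R One) \<subseteq> box a b"
  shows "((\<lambda>t. mollify a b g \<kappa> t x / t ^ N) has_real_derivative t * mollify a b G \<Lambda> t x / t ^ N) (at t)"
proof -
  have \<kappa>: "Ck_on n UNIV \<kappa>" and \<Lambda>: "Ck_on n UNIV \<Lambda>"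
    and out: "1 < norm z \<Longrightarrow> \<Lambda> z = 0"
    and eq: "real N * \<kappa> z + frechet_derivative \<kappa> (at z) z = - laplacian \<Lambda> z" for n z
    using pair by (auto simp: kernel_pair_def)
  have g: "continuous_on (cbox a b) g"
    using weak by (simp add: weak_poisson_def)
  let ?R = "\<lambda>z. frechet_derivative \<kappa> (at z) z"
  have "mollify a b g ?R t x = - (real N * mollify a b g \<kappa> t x) - mollify a b g (laplacian \<Lambda>) t x"
  proof -
    have "?R z = - (real N * \<kappa> z) - laplacian \<Lambda> z" for z
      using eq[of z] by linarith
    then have "mollify a b g ?R t x = integral (cbox a b) (\<lambda>y. - (real N * (g y * \<kappa> ((1 / t) *\<^sub>R (x - y)))) -
        g y * laplacian \<Lambda> ((1 / t) *\<^sub>R (x - y)))"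
      unfolding mollify_def by (simp only: right_diff_distrib mult_minus_right mult.left_commute)
    also have "\<dots> = - (real N * mollify a b g \<kappa> t x) - mollify a b g (laplacian \<Lambda>) t x"
      unfolding mollify_def
      by (subst integral_diff)
        (auto intro!: integrable_continuous continuous_intros continuous_mollify_integrand g
          Ck_on_continuous[OF \<kappa>[of 0]] Ck_on_continuous[OF Ck_on_laplacian[OF \<Lambda>]])
    finally show ?thesis .
  qed
  also have "mollify a b g (laplacian \<Lambda>) t x = t\<^sup>2 * mollify a b G \<Lambda> t x"
    by (rule mollify_laplacian[OF weak \<Lambda> out \<open>0 < t\<close> sub])
  finally have R: "mollify a b g ?R t x = - (real N * mollify a b g \<kappa> t x) - t\<^sup>2 * mollify a b G \<Lambda> t x" .
  have "((\<lambda>t. 1 / t ^ N) has_real_derivative - (real N / t ^ Suc N)) (at t)"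
  proof (induction N)
    case (Suc N)
    have "((\<lambda>t. 1 / t) has_real_derivative - (1 / t\<^sup>2)) (at t)"
      using \<open>0 < t\<close> by (auto intro!: derivative_eq_intros simp: power2_eq_square)
    from DERIV_mult[OF Suc.IH this]
    have "((\<lambda>t. 1 / t ^ N * (1 / t)) has_real_derivative
        - (real N / t ^ Suc N) * (1 / t) + - (1 / t\<^sup>2) * (1 / t ^ N)) (at t)" .
    moreover have "- (real N / t ^ Suc N) * (1 / t) + - (1 / t\<^sup>2) * (1 / t ^ N) = - (real (Suc N) / t ^ Suc (Suc N))"
      using \<open>0 < t\<close> by (simp add: field_simps power2_eq_square)
    ultimately show ?case by (simp add: mult.commute)
  qed simp
  from DERIV_mult[OF mollify_has_real_derivative_scale[OF g \<kappa> \<open>0 < t\<close>, of x] this]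
  have "((\<lambda>t. mollify a b g \<kappa> t x * (1 / t ^ N)) has_real_derivative
      - (1 / t) * mollify a b g ?R t x * (1 / t ^ N) + - (real N / t ^ Suc N) * mollify a b g \<kappa> t x) (at t)" .
  also have "- (1 / t) * mollify a b g ?R t x * (1 / t ^ N) + - (real N / t ^ Suc N) * mollify a b g \<kappa> t x =
     t * mollify a b G \<Lambda> t x / t ^ N"
    unfolding R using \<open>0 < t\<close> by (simp add: field_simps power2_eq_square)
  finally show ?thesis by simp
qed

text \<open>Monotonicity replaces integration over t: adding to
  \<open>B / \<gamma> * t powr \<gamma>\<close> the normalised mollification with either sign gives
  a nondecreasing function.\<close>

lemma mollify_scale_diff_bound:
  fixes \<kappa> \<Lambda> :: "'a::euclidean_space \<Rightarrow> real"
  assumes weak: "weak_poisson a b g G" and pair: "kernel_pair N \<kappa> \<Lambda>"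
    and sub: "cbox (x - t0 *\<^sub>R One) (x + t0 *\<^sub>R One) \<subseteq> box a b" and "0 < \<gamma>"
    and bound: "\<And>t. 0 < t \<Longrightarrow> t \<le> t0 \<Longrightarrow> \<bar>t * mollify a b G \<Lambda> t x / t ^ N\<bar> \<le> B * t powr (\<gamma> - 1)"
    and st: "0 < s" "s \<le> t" "t \<le> t0"
  shows "\<bar>mollify a b g \<kappa> t x / t ^ N - mollify a b g \<kappa> s x / s ^ N\<bar> \<le> B / \<gamma> * t powr \<gamma>"
proof -
  let ?F = "\<lambda>t. mollify a b g \<kappa> t x / t ^ N"
  have sub_t: "cbox (x - t *\<^sub>R One) (x + t *\<^sub>R One) \<subseteq> box a b" if "t \<le> t0" for t
    using that by (intro order.trans[OF _ sub]) (auto simp: subset_box inner_diff_left inner_add_left)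
  have F: "(?F has_real_derivative t * mollify a b G \<Lambda> t x / t ^ N) (at t)" if "0 < t" "t \<le> t0" for t
    using that by (intro mollify_has_real_derivative_kernel_pair[OF weak pair] sub_t)
  have P: "((\<lambda>t. B / \<gamma> * t powr \<gamma>) has_real_derivative B * t powr (\<gamma> - 1)) (at t)" if "0 < t" for t
    using that \<open>0 < \<gamma>\<close> by (auto intro!: derivative_eq_intros)
  have "B / \<gamma> * s powr \<gamma> + \<sigma> * ?F s \<le> B / \<gamma> * t powr \<gamma> + \<sigma> * ?F t" if "\<bar>\<sigma>\<bar> = 1" for \<sigma> :: real
  proof (rule DERIV_nonneg_imp_nondecreasing[OF \<open>s \<le> t\<close>])
    fix r assume "s \<le> r" "r \<le> t"
    then have r: "0 < r" "r \<le> t0" using st by auto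
    have nonneg: "0 \<le> y + z" if "\<bar>z\<bar> \<le> y" for y z :: real
      using that by linarith
    have "\<bar>\<sigma> * (r * mollify a b G \<Lambda> r x / r ^ N)\<bar> \<le> B * r powr (\<gamma> - 1)"
      unfolding abs_mult that using bound[OF r] by simp
    then have "0 \<le> B * r powr (\<gamma> - 1) + \<sigma> * (r * mollify a b G \<Lambda> r x / r ^ N)"
      by (rule nonneg)
    then show "\<exists>y. ((\<lambda>t. B / \<gamma> * t powr \<gamma> + \<sigma> * ?F t) has_real_derivative y) (at r) \<and> 0 \<le> y"
      using DERIV_add[OF P[OF r(1)] DERIV_cmult[OF F[OF r], of \<sigma>]] by blast
  qed
  from this[of 1] this[of "-1"]
  have "\<bar>?F t - ?F s\<bar> \<le> B / \<gamma> * t powr \<gamma> - B / \<gamma> * s powr \<gamma>"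
    by (simp add: abs_le_iff)
  \<comment> \<open>Nonnegativity allows the term at s to be dropped, so the bound depends on the
    larger scale alone.\<close>
  moreover have "0 \<le> B"
  proof -
    have "0 \<le> B * t powr (\<gamma> - 1)" using order.trans[OF abs_ge_zero bound[of t]] st by simp
    then show ?thesis using st by (simp add: zero_le_mult_iff)
  qed
  then have "0 \<le> B / \<gamma> * s powr \<gamma>" using \<open>0 < \<gamma>\<close> by simp
  ultimately show ?thesis by linarith
qed

text \<open>The difference between two scales is controlled, uniformly on S, by a bound that depends
  on the larger one and tends to 0 with it: the sequence is uniformly Cauchy.\<close>

lemma mollify_uniform_limit:
  fixes \<kappa> \<Lambda> :: "'a::euclidean_space \<Rightarrow> real"
  assumes weak: "weak_poisson a b g G" and pair: "kernel_pair N \<kappa> \<Lambda>"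
    and sub: "\<And>x. x \<in> S \<Longrightarrow> cbox (x - t0 *\<^sub>R One) (x + t0 *\<^sub>R One) \<subseteq> box a b"
    and "0 < \<gamma>" "0 < t0"
    and bound: "\<And>x t. x \<in> S \<Longrightarrow> 0 < t \<Longrightarrow> t \<le> t0 \<Longrightarrow>
      \<bar>t * mollify a b G \<Lambda> t x / t ^ N\<bar> \<le> B * t powr (\<gamma> - 1)"
  shows "\<exists>p. uniform_limit S
    (\<lambda>n x. mollify a b g \<kappa> (t0 / real (Suc n)) x / (t0 / real (Suc n)) ^ N) p sequentially"
proof -
  let ?t = "\<lambda>n. t0 / real (Suc n)"
  have t: "0 < ?t n" "?t n \<le> t0" for n
    using \<open>0 < t0\<close> by (auto simp: divide_simps)
  have "?t \<longlonglongrightarrow> 0"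
    by (rule LIMSEQ_Suc[OF lim_const_over_n])
  then have "(\<lambda>n. ?t n powr \<gamma>) \<longlonglongrightarrow> 0"
    using t(1) \<open>0 < \<gamma>\<close> by (intro tendsto_zero_powrI) (auto intro!: always_eventually less_imp_le)
  then have lim: "(\<lambda>n. B / \<gamma> * ?t n powr \<gamma>) \<longlonglongrightarrow> 0"
    by (rule tendsto_mult_right_zero)
  have "uniformly_Cauchy_on S (\<lambda>n x. mollify a b g \<kappa> (?t n) x / ?t n ^ N)"
    unfolding uniformly_Cauchy_on_def
  proof (intro allI impI)
    fix e :: real assume "0 < e"
    obtain M where M: "\<And>n. n \<ge> M \<Longrightarrow> B / \<gamma> * ?t n powr \<gamma> < e"
      using order_tendstoD(2)[OF lim \<open>0 < e\<close>] unfolding eventually_sequentially by blast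
    have key: "dist (mollify a b g \<kappa> (?t m) x / ?t m ^ N) (mollify a b g \<kappa> (?t n) x / ?t n ^ N) < e"
      if "x \<in> S" "m \<ge> M" "n \<ge> m" for x m n
    proof -
      have "?t n \<le> ?t m" using \<open>0 < t0\<close> \<open>n \<ge> m\<close> by (simp add: divide_left_mono)
      from mollify_scale_diff_bound[OF weak pair sub[OF that(1)] \<open>0 < \<gamma>\<close> bound[OF that(1)] t(1) this t(2)]
      show ?thesis using M[OF that(2)] by (simp add: dist_real_def)
    qed
    show "\<exists>M. \<forall>x\<in>S. \<forall>m\<ge>M. \<forall>n\<ge>M.
       dist (mollify a b g \<kappa> (?t m) x / ?t m ^ N) (mollify a b g \<kappa> (?t n) x / ?t n ^ N) < e"
    proof (intro exI[of _ M] ballI allI impI)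
      fix x m n assume "x \<in> S" "M \<le> m" "M \<le> n"
      then show "dist (mollify a b g \<kappa> (?t m) x / ?t m ^ N) (mollify a b g \<kappa> (?t n) x / ?t n ^ N) < e"
        using key[of x m n] key[of x n m] by (cases "m \<le> n") (auto simp: dist_commute)
    qed
  qed
  then show ?thesis
    using Cauchy_uniformly_convergent uniformly_convergent_on_def by blast
qed

text \<open>Uniform convergence of the finitely many partial derivatives gives uniform convergence
  in operator norm, at the cost of a factor equal to the dimension. This is what differentiation of
  a limit on a convex set asks for.\<close>

lemma has_derivative_uniform_limit:
  fixes u :: "nat \<Rightarrow> 'a::euclidean_space \<Rightarrow> real"
  assumes S: "open S" "convex S"
    and u: "\<And>n x. x \<in> S \<Longrightarrow> (u n has_derivative u' n x) (at x)"
    and p: "\<And>b. b \<in> Basis \<Longrightarrow> uniform_limit S (\<lambda>n x. u' n x b) (p b) sequentially"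
    and f: "\<And>x. x \<in> S \<Longrightarrow> (\<lambda>n. u n x) \<longlonglongrightarrow> f x" and x: "x \<in> S"
  shows "(f has_derivative (\<lambda>h. \<Sum>b\<in>Basis. (h \<bullet> b) * p b x)) (at x)"
proof -
  have "\<exists>g. \<forall>x\<in>S. (\<lambda>n. u n x) \<longlonglongrightarrow> g x \<and>
      (g has_derivative (\<lambda>h. \<Sum>b\<in>Basis. (h \<bullet> b) * p b x)) (at x within S)"
  proof (rule has_derivative_sequence[where f = u and f' = u'])
    show "convex S" "x \<in> S" "(\<lambda>n. u n x) \<longlonglongrightarrow> f x" using S x f by auto
    show "(u n has_derivative u' n x) (at x within S)" if "x \<in> S" for n x
      by (rule has_derivative_at_withinI[OF u[OF that]])
    fix e :: real assume "0 < e"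
    then have pos: "0 < e / DIM('a)" by simp
    have "\<forall>\<^sub>F n in sequentially. \<forall>b\<in>Basis. \<forall>x\<in>S. dist (u' n x b) (p b x) < e / DIM('a)"
      by (rule eventually_ball_finite[OF finite_Basis]) (use p pos in \<open>auto dest: uniform_limitD\<close>)
    then show "\<forall>\<^sub>F n in sequentially. \<forall>x\<in>S. \<forall>h.
        norm (u' n x h - (\<Sum>b\<in>Basis. (h \<bullet> b) * p b x)) \<le> e * norm h"
    proof (rule eventually_mono, intro ballI allI)
      fix n x h
      assume n: "\<forall>b\<in>Basis. \<forall>x\<in>S. dist (u' n x b) (p b x) < e / DIM('a)" and "x \<in> S"
      have "u' n x h - (\<Sum>b\<in>Basis. (h \<bullet> b) * p b x) = (\<Sum>b\<in>Basis. (h \<bullet> b) * (u' n x b - p b x))"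
        unfolding has_derivative_basis_expansion[OF u[OF \<open>x \<in> S\<close>], of n h]
        by (simp add: sum_subtractf right_diff_distrib)
      also have "norm \<dots> \<le> (\<Sum>b\<in>(Basis::'a set). norm h * (e / DIM('a)))"
      proof (rule sum_norm_le)
        fix b :: 'a assume "b \<in> Basis"
        then show "norm (h \<bullet> b * (u' n x b - p b x)) \<le> norm h * (e / DIM('a))"
          using n \<open>x \<in> S\<close> Basis_le_norm[of b h] unfolding norm_mult
          by (intro mult_mono) (auto simp: dist_real_def less_imp_le)
      qed
      also have "\<dots> = e * norm h" by simp
      finally show "norm (u' n x h - (\<Sum>b\<in>Basis. (h \<bullet> b) * p b x)) \<le> e * norm h" .
    qed
  qed
  then obtain g where g: "\<And>x. x \<in> S \<Longrightarrow> (\<lambda>n. u n x) \<longlonglongrightarrow> g x"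
    "\<And>x. x \<in> S \<Longrightarrow> (g has_derivative (\<lambda>h. \<Sum>b\<in>Basis. (h \<bullet> b) * p b x)) (at x within S)"
    by auto
  have eq: "g y = f y" if "y \<in> S" for y
    by (rule LIMSEQ_unique[OF g(1)[OF that] f[OF that]])
  have "(g has_derivative (\<lambda>h. \<Sum>b\<in>Basis. (h \<bullet> b) * p b x)) (at x)"
    using g(2)[OF x] unfolding at_within_open[OF x S(1)] .
  then show ?thesis
    by (rule has_derivative_transform_within_open[OF _ S(1) x eq])
qed

section \<open>Interior regularity\<close>

lemma box_One_subset_ball:
  fixes x0 :: "'a::euclidean_space"
  assumes "open U" "x0 \<in> U"
  obtains r where "0 < r" "r \<le> 1"
    "\<And>x. x \<in> ball x0 r \<Longrightarrow> cbox (x - r *\<^sub>R One) (x + r *\<^sub>R One) \<subseteq> U"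
proof -
  obtain e where e: "0 < e" "ball x0 e \<subseteq> U"
    using assms openE by blast
  define k where "k = real DIM('a) + 1"
  \<comment> \<open>A point of the cube is at most r times the dimension away from its centre, and
    the centre is within r of \<open>x0\<close>; together this stays below e / 2.\<close>
  define r where "r = min 1 (e / (2 * k))"
  have "0 < k" by (simp add: k_def add_pos_pos)
  have "r * k \<le> e / (2 * k) * k"
    unfolding r_def using \<open>0 < k\<close> by (intro mult_right_mono) auto
  also have "\<dots> = e / 2" using \<open>0 < k\<close> by simp
  finally have r: "0 < r" "r \<le> 1" "r * (real DIM('a) + 1) \<le> e / 2"
    using e \<open>0 < k\<close> by (auto simp: r_def k_def)
  have "cbox (x - r *\<^sub>R One) (x + r *\<^sub>R One) \<subseteq> U" if "x \<in> ball x0 r" for x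
  proof
    fix y assume y: "y \<in> cbox (x - r *\<^sub>R One) (x + r *\<^sub>R One)"
    have "norm (x - y) \<le> (\<Sum>b\<in>Basis. \<bar>(x - y) \<bullet> b\<bar>)" by (rule norm_le_l1)
    also have "\<dots> \<le> (\<Sum>b\<in>(Basis::'a set). r)"
      using y unfolding mem_box
      by (intro sum_mono) (auto simp: inner_diff_left inner_add_left abs_le_iff algebra_simps)
    finally have "dist x y \<le> r * real DIM('a)" by (simp add: dist_norm mult.commute)
    moreover have "dist x0 y \<le> dist x0 x + dist x y" by (rule dist_triangle)
    moreover have "dist x0 x < r" using that by simp
    ultimately have "dist x0 y < e" using r(3) e(1) by (simp add: algebra_simps)
    then show "y \<in> U" using e(2) by auto
  qed
  then show ?thesis using that r by blast
qed

text \<open>A continuous nonnegative function with integral 0 vanishes identically, whereas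
  \<open>bump\<close> is positive at the origin. This is the constant by which the limits are later
  divided.\<close>

lemma integral_bump_pos: "0 < integral (cbox (- One) One) (bump :: 'a::euclidean_space \<Rightarrow> real)"
proof -
  have c: "continuous_on (cbox (- One) One) (bump :: 'a \<Rightarrow> real)"
    by (rule continuous_on_subset[OF Ck_on_continuous[OF Ck_on_bump[of 0]]]) simp
  then have "0 \<le> integral (cbox (- One) One) (bump :: 'a \<Rightarrow> real)"
    by (intro integral_nonneg integrable_continuous bump_nonneg)
  moreover have "integral (cbox (- One) One) (bump :: 'a \<Rightarrow> real) \<noteq> 0"
  proof
    assume "integral (cbox (- One) One) (bump :: 'a \<Rightarrow> real) = 0"
    then have i: "((bump :: 'a \<Rightarrow> real) has_integral 0) (cbox (- One) One)"
      using integrable_integral[OF integrable_continuous[OF c]] by simp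
    have "bump (0::'a) = 0"
      by (rule has_integral_0_cbox_imp_0[OF c bump_nonneg i]) (auto simp: box_ne_empty mem_box)
    then show False using bump_0_pos[where 'a = 'a] by simp
  qed
  ultimately show ?thesis by simp
qed

lemma sum_Basis_inner:
  fixes f :: "'a::euclidean_space \<Rightarrow> real"
  assumes "b \<in> Basis"
  shows "(\<Sum>b'\<in>Basis. (b \<bullet> b') * f b') = f b"
proof -
  have "(\<Sum>b'\<in>Basis. (b \<bullet> b') * f b') = (\<Sum>b'\<in>Basis. if b' = b then f b' else 0)"
    using assms by (intro sum.cong) (auto simp: inner_Basis)
  then show ?thesis using assms by simp
qed

section \<open>Uniform convergence of mollified derivatives near a point\<close>

context
  fixes lo hi :: "'a::euclidean_space" and g G :: "'a \<Rightarrow> real" and S :: "'a set" and r :: real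
  assumes weak: "weak_poisson lo hi g G" and S: "open S" "convex S" and r: "0 < r" "r \<le> 1"
    and room: "\<And>x. x \<in> S \<Longrightarrow> cbox (x - r *\<^sub>R One) (x + r *\<^sub>R One) \<subseteq> box lo hi"
begin

private definition scale :: "nat \<Rightarrow> real" where
  "scale n = r / real (Suc n)"

text \<open>N is the dimension plus the number of derivatives on the kernel: differentiating in x
  raises N by 1 and leaves no other factor.\<close>

private definition approx :: "nat \<Rightarrow> ('a \<Rightarrow> real) \<Rightarrow> nat \<Rightarrow> 'a \<Rightarrow> real" where
  "approx N \<kappa> n x = mollify lo hi g \<kappa> (scale n) x / scale n ^ N"

private lemma scale: "0 < scale n" "scale n \<le> r" "scale \<longlonglongrightarrow> 0"
proof -
  show "0 < scale n" "scale n \<le> r"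
    using r by (auto simp: scale_def divide_simps)
  show "scale \<longlonglongrightarrow> 0"
    unfolding scale_def[abs_def] by (rule LIMSEQ_Suc[OF lim_const_over_n])
qed

private lemma room_le:
  assumes "x \<in> S" "t \<le> r"
  shows "cbox (x - t *\<^sub>R One) (x + t *\<^sub>R One) \<subseteq> box lo hi"
  using assms(2)
  by (intro order.trans[OF _ room[OF assms(1)]]) (auto simp: subset_box inner_diff_left inner_add_left)

private lemma room_le_cbox:
  assumes "x \<in> S" "t \<le> r"
  shows "cbox (x - t *\<^sub>R One) (x + t *\<^sub>R One) \<subseteq> cbox lo hi"
  using room_le[OF assms] box_subset_cbox by blast

private lemma S_subset: "S \<subseteq> box lo hi"
proof
  fix x assume "x \<in> S"
  moreover have "x \<in> cbox (x - r *\<^sub>R One) (x + r *\<^sub>R One)"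
    using r by (intro cball_subset_cbox_One) auto
  ultimately show "x \<in> box lo hi" using room by blast
qed

private lemma g_cont: "continuous_on (cbox lo hi) g" and G_cont: "continuous_on (cbox lo hi) G"
  using weak by (auto simp: weak_poisson_def)

private lemma approx_has_derivative:
  assumes "Ck_on 1 UNIV \<kappa>"
  shows "(approx N \<kappa> n has_derivative
    (\<lambda>v. approx (Suc N) (\<lambda>z. frechet_derivative \<kappa> (at z) v) n x)) (at x)"
proof -
  have "((\<lambda>x. (1 / scale n ^ N) * mollify lo hi g \<kappa> (scale n) x) has_derivative
    (\<lambda>v. (1 / scale n ^ N) * ((1 / scale n) *
       mollify lo hi g (\<lambda>z. frechet_derivative \<kappa> (at z) v) (scale n) x))) (at x)"
    by (intro has_derivative_mult_right mollify_has_derivative g_cont assms)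
  then show ?thesis
    by (simp add: approx_def[abs_def] mult.commute)
qed

private lemma approx_continuous: "Ck_on 1 UNIV \<kappa> \<Longrightarrow> continuous_on S (approx N \<kappa> n)"
  by (rule continuous_at_imp_continuous_on) (blast intro: has_derivative_continuous approx_has_derivative)

private lemma approx_bump_tendsto:
  assumes "x \<in> S"
  shows "(\<lambda>n. approx DIM('a) bump n x) \<longlonglongrightarrow> g x * integral (cbox (- One) One) (bump :: 'a \<Rightarrow> real)"
  unfolding approx_def
  using assms S_subset
  by (intro mollify_tendsto g_cont Ck_on_continuous[OF Ck_on_bump[of 0]] bump_zero room_le_cbox scale) auto

text \<open>With d the dimension, a bounded \<open>G\<close> has mollifications of size t^d, so the
  scale derivative, of size t * t^d / t^(d+1), is bounded. This is the convergence result with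
  \<gamma> = 1.\<close>

private lemma approx_uniform_limit_1:
  assumes pair: "kernel_pair (Suc DIM('a)) \<kappa> \<Lambda>"
  shows "\<exists>p. uniform_limit S (approx (Suc DIM('a)) \<kappa>) p sequentially"
proof -
  have \<Lambda>: "continuous_on UNIV \<Lambda>" "1 < norm z \<Longrightarrow> \<Lambda> z = 0" for z
    using pair Ck_on_continuous[of 0 UNIV \<Lambda>] by (auto simp: kernel_pair_def)
  obtain C where C: "0 < C" "\<And>z. \<bar>\<Lambda> z\<bar> \<le> C"
    using continuous_on_bounded_support[OF \<Lambda>] by blast
  have "bounded (G ` cbox lo hi)"
    by (intro compact_imp_bounded compact_continuous_image G_cont compact_cbox)
  then obtain M where M: "\<And>y. y \<in> cbox lo hi \<Longrightarrow> \<bar>G y\<bar> \<le> M"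
    unfolding bounded_iff by auto
  show ?thesis
    unfolding approx_def scale_def
  proof (rule mollify_uniform_limit[OF weak pair room zero_less_one r(1)])
    fix x t assume "x \<in> S" and t: "0 < t" "t \<le> r"
    note sub = room_le_cbox[OF \<open>x \<in> S\<close> t(2)]
    have "\<bar>mollify lo hi G \<Lambda> t x / t ^ DIM('a)\<bar> \<le> M * C * 2 ^ DIM('a)"
      by (rule mollify_bound[OF G_cont \<Lambda>(1) t(1) \<Lambda>(2) sub _ C(2)])
        (use sub cball_subset_cbox_One M in blast)+
    then show "\<bar>t * mollify lo hi G \<Lambda> t x / t ^ Suc DIM('a)\<bar> \<le> (M * C * 2 ^ DIM('a)) * t powr (1 - 1)"
      using t by simp
  qed
qed

text \<open>Mean zero lets \<open>G x\<close> be subtracted, which gains t^\<gamma>. For second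
  derivatives the scale derivative then has size t * t^(d+\<gamma>) / t^(d+2) = t^(\<gamma>-1),
  still integrable at 0.\<close>

private lemma approx_uniform_limit_2:
  assumes pair: "kernel_pair (Suc (Suc DIM('a))) \<kappa> \<Lambda>"
    and mean: "integral (cbox (- One) One) \<Lambda> = 0"
    and \<gamma>: "0 < \<gamma>"
    and H: "\<And>x y. x \<in> S \<Longrightarrow> norm (x - y) \<le> r \<Longrightarrow> \<bar>G y - G x\<bar> \<le> H * norm (y - x) powr \<gamma>"
  shows "\<exists>p. uniform_limit S (approx (Suc (Suc DIM('a))) \<kappa>) p sequentially"
proof -
  have \<Lambda>: "continuous_on UNIV \<Lambda>" "1 < norm z \<Longrightarrow> \<Lambda> z = 0" for z
    using pair Ck_on_continuous[of 0 UNIV \<Lambda>] by (auto simp: kernel_pair_def)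
  obtain C where C: "0 < C" "\<And>z. \<bar>\<Lambda> z\<bar> \<le> C"
    using continuous_on_bounded_support[OF \<Lambda>] by blast
  show ?thesis
    unfolding approx_def scale_def
  proof (rule mollify_uniform_limit[OF weak pair room \<gamma> r(1)])
    fix x t assume "x \<in> S" and t: "0 < t" "t \<le> r"
    note sub = room_le_cbox[OF \<open>x \<in> S\<close> t(2)]
    have "mollify lo hi G \<Lambda> t x / t ^ DIM('a) = mollify lo hi (\<lambda>y. G y - G x) \<Lambda> t x / t ^ DIM('a)"
      using mollify_diff_const[OF G_cont \<Lambda>(1) t(1) \<Lambda>(2) sub, of "G x"]
      by (simp only: mean mult_zero_right diff_zero)
    moreover have "\<bar>mollify lo hi (\<lambda>y. G y - G x) \<Lambda> t x / t ^ DIM('a)\<bar> \<le> (\<bar>H\<bar> * t powr \<gamma>) * C * 2 ^ DIM('a)"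
    proof (rule mollify_bound[OF continuous_on_diff[OF G_cont continuous_on_const] \<Lambda>(1) t(1) \<Lambda>(2) sub _ C(2)])
      fix y assume y: "norm (x - y) \<le> t"
      have "\<bar>G y - G x\<bar> \<le> H * norm (y - x) powr \<gamma>"
        using H[OF \<open>x \<in> S\<close>, of y] y t by simp
      also have "\<dots> \<le> \<bar>H\<bar> * t powr \<gamma>"
        using y \<gamma> by (intro mult_mono powr_mono2) (auto simp: norm_minus_commute)
      finally show "\<bar>G y - G x\<bar> \<le> \<bar>H\<bar> * t powr \<gamma>" .
    qed
    ultimately have "\<bar>mollify lo hi G \<Lambda> t x / t ^ DIM('a)\<bar> \<le> (\<bar>H\<bar> * t powr \<gamma>) * C * 2 ^ DIM('a)"
      by (simp only:)
    then have "\<bar>mollify lo hi G \<Lambda> t x / t ^ DIM('a)\<bar> / t \<le> (\<bar>H\<bar> * t powr \<gamma>) * C * 2 ^ DIM('a) / t"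
      using t by (intro divide_right_mono) auto
    moreover have "\<bar>t * mollify lo hi G \<Lambda> t x / t ^ Suc (Suc DIM('a))\<bar> = \<bar>mollify lo hi G \<Lambda> t x / t ^ DIM('a)\<bar> / t"
      using t by (simp add: abs_mult)
    moreover have "t powr (\<gamma> - 1) = t powr \<gamma> / t"
      using t by (simp add: powr_diff)
    ultimately show "\<bar>t * mollify lo hi G \<Lambda> t x / t ^ Suc (Suc DIM('a))\<bar> \<le>
        (\<bar>H\<bar> * C * 2 ^ DIM('a)) * t powr (\<gamma> - 1)"
      by (simp add: mult_ac)
  qed
qed

private lemma Ck_bump': "Ck_on n UNIV (\<lambda>z. frechet_derivative (bump :: 'a \<Rightarrow> real) (at z) v)"
  by (rule Ck_on_frechet[OF Ck_on_bump])

private lemma Ck_bump'': "Ck_on n UNIV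
    (\<lambda>z. frechet_derivative (\<lambda>z. frechet_derivative (bump :: 'a \<Rightarrow> real) (at z) v) (at z) w)"
  by (rule Ck_on_frechet[OF Ck_bump'])

text \<open>Shared by both regularity steps: the second one differentiates the same limits
  \<open>p\<close> again. The mollifications tend to \<open>g\<close> times the integral of
  \<open>bump\<close>, hence the quotient.\<close>

private lemma limit_1:
  obtains p where
    "\<And>v. uniform_limit S (approx (Suc DIM('a)) (\<lambda>z. frechet_derivative bump (at z) v)) (p v) sequentially"
    "\<And>v. continuous_on S (p v)"
    "\<And>x. x \<in> S \<Longrightarrow> (g has_derivative (\<lambda>h. (1 / integral (cbox (- One) One) (bump :: 'a \<Rightarrow> real)) * (\<Sum>b\<in>Basis. (h \<bullet> b) * p b x))) (at x)"
proof -
  have "\<forall>v. \<exists>p. uniform_limit S (approx (Suc DIM('a)) (\<lambda>z. frechet_derivative bump (at z) v)) p sequentially"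
    by (intro allI approx_uniform_limit_1[OF kernel_pair_derivative[OF kernel_pair_bump]])
  from choice[OF this] obtain p where
    p: "\<And>v. uniform_limit S (approx (Suc DIM('a)) (\<lambda>z. frechet_derivative bump (at z) v)) (p v) sequentially"
    by blast
  have cont: "continuous_on S (p v)" for v
    by (rule uniform_limit_theorem[OF _ p]) (auto intro!: always_eventually approx_continuous Ck_bump')
  have g': "(g has_derivative (\<lambda>h. (1 / integral (cbox (- One) One) (bump :: 'a \<Rightarrow> real)) * (\<Sum>b\<in>Basis. (h \<bullet> b) * p b x))) (at x)" if "x \<in> S" for x
  proof -
    have "((\<lambda>x. g x * integral (cbox (- One) One) (bump :: 'a \<Rightarrow> real)) has_derivative (\<lambda>h. \<Sum>b\<in>Basis. (h \<bullet> b) * p b x)) (at x)"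
      by (rule has_derivative_uniform_limit[OF S approx_has_derivative[OF Ck_on_bump] p approx_bump_tendsto that])
    from has_derivative_mult_right[OF this, of "1 / (integral (cbox (- One) One) (bump :: 'a \<Rightarrow> real))"]
    show ?thesis using integral_bump_pos[where 'a = 'a] by simp
  qed
  show ?thesis by (rule that[OF p cont g'])
qed

lemma weak_poisson_C1_locally: "Ck_on 1 S g"
proof -
  obtain p where
    "\<And>v. uniform_limit S (approx (Suc DIM('a)) (\<lambda>z. frechet_derivative bump (at z) v)) (p v) sequentially"
    and cont: "\<And>v. continuous_on S (p v)"
    and g': "\<And>x. x \<in> S \<Longrightarrow> (g has_derivative (\<lambda>h. (1 / integral (cbox (- One) One) (bump :: 'a \<Rightarrow> real)) * (\<Sum>b\<in>Basis. (h \<bullet> b) * p b x))) (at x)"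
    by (fact limit_1)
  show ?thesis
    unfolding One_nat_def
    by (rule Ck_on_Suc_if_derivative[OF S(1) g'])
      (simp_all only: Ck_on.simps(1) continuous_on_mult continuous_on_sum continuous_on_const cont)
qed

lemma weak_poisson_C2_locally:
  assumes \<gamma>: "0 < \<gamma>"
    and H: "\<And>x y. x \<in> S \<Longrightarrow> norm (x - y) \<le> r \<Longrightarrow> \<bar>G y - G x\<bar> \<le> H * norm (y - x) powr \<gamma>"
  shows "Ck_on 2 S g" and "x \<in> S \<Longrightarrow> laplacian g x = G x"
proof -
  let ?c = "integral (cbox (- One) One) (bump :: 'a \<Rightarrow> real)"
  obtain p where p: "\<And>v. uniform_limit S (approx (Suc DIM('a)) (\<lambda>z. frechet_derivative bump (at z) v)) (p v) sequentially"
    and "\<And>v. continuous_on S (p v)"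
    and g': "\<And>x. x \<in> S \<Longrightarrow> (g has_derivative (\<lambda>h. (1 / ?c) * (\<Sum>b\<in>Basis. (h \<bullet> b) * p b x))) (at x)"
    by (fact limit_1)
  define \<kappa> where "\<kappa> v w = (\<lambda>z::'a. frechet_derivative (\<lambda>z. frechet_derivative bump (at z) v) (at z) w)" for v w
  define \<Lambda> where "\<Lambda> v w = (\<lambda>z::'a. frechet_derivative (\<lambda>z. frechet_derivative bump_potential (at z) v) (at z) w)" for v w
  have pair1: "kernel_pair (Suc DIM('a)) (\<lambda>z::'a. frechet_derivative bump (at z) v) (\<lambda>z. frechet_derivative bump_potential (at z) v)" for v
    by (rule kernel_pair_derivative[OF kernel_pair_bump])
  have pair2: "kernel_pair (Suc (Suc DIM('a))) (\<kappa> v w) (\<Lambda> v w)" for v w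
    unfolding \<kappa>_def \<Lambda>_def by (rule kernel_pair_derivative[OF pair1])
  \<comment> \<open>Each \<open>\<Lambda> v w\<close> is itself a directional derivative of a
    function supported in the unit ball, so its mean is zero.\<close>
  have mean: "integral (cbox (- One) One) (\<Lambda> v w) = 0" for v w
    unfolding \<Lambda>_def using pair1[of v] by (intro integral_derivative_zero) (auto simp: kernel_pair_def)
  have "\<forall>vw. \<exists>q. uniform_limit S (approx (Suc (Suc DIM('a))) (\<kappa> (fst vw) (snd vw))) q sequentially"
    by (rule allI, rule approx_uniform_limit_2[OF pair2 mean \<gamma> H])
  from choice[OF this] obtain q' where
    "\<And>vw. uniform_limit S (approx (Suc (Suc DIM('a))) (\<kappa> (fst vw) (snd vw))) (q' vw) sequentially"
    by blast
  from this[of "(v, w)" for v w] have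
    "uniform_limit S (approx (Suc (Suc DIM('a))) (\<kappa> v w)) (q' (v, w)) sequentially" for v w
    by simp
  define q where "q v w = q' (v, w)" for v w
  have q: "uniform_limit S (approx (Suc (Suc DIM('a))) (\<kappa> v w)) (q v w) sequentially" for v w
    unfolding q_def by fact
  have q_cont: "continuous_on S (q v w)" for v w
    by (rule uniform_limit_theorem[OF _ q])
      (auto intro!: always_eventually approx_continuous Ck_bump'' simp: \<kappa>_def)
  have p': "(p v has_derivative (\<lambda>h. \<Sum>b\<in>Basis. (h \<bullet> b) * q v b x)) (at x)" if "x \<in> S" for v x
  proof (rule has_derivative_uniform_limit[OF S _ _ _ that])
    show "(approx (Suc DIM('a)) (\<lambda>z. frechet_derivative bump (at z) v) n has_derivative
       (\<lambda>w. approx (Suc (Suc DIM('a))) (\<kappa> v w) n x)) (at x)" for n x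
      unfolding \<kappa>_def by (rule approx_has_derivative[OF Ck_bump'])
    show "uniform_limit S (\<lambda>n x. approx (Suc (Suc DIM('a))) (\<kappa> v b) n x) (q v b) sequentially" for b
      using q by simp
    show "(\<lambda>n. approx (Suc DIM('a)) (\<lambda>z. frechet_derivative bump (at z) v) n x) \<longlonglongrightarrow> p v x" if "x \<in> S" for x
      by (rule tendsto_uniform_limitI[OF p that])
  qed
  have p1: "Ck_on 1 S (p v)" for v
    unfolding One_nat_def
    by (rule Ck_on_Suc_if_derivative[OF S(1) p']) (auto intro!: continuous_intros q_cont)
  show "Ck_on 2 S g"
    unfolding numeral_2_eq_2
  proof (rule Ck_on_Suc_if_derivative[OF S(1) g'])
    show "Ck_on (Suc 0) S (\<lambda>x. (1 / ?c) * (\<Sum>b\<in>Basis. (v \<bullet> b) * p b x))" for v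
      by (intro Ck_on_mult Ck_on_sum Ck_on_const S p1[unfolded One_nat_def])
  qed
  assume x: "x \<in> S"
  have g'_eq: "frechet_derivative g (at y) v = (1 / ?c) * (\<Sum>b\<in>Basis. (v \<bullet> b) * p b y)" if "y \<in> S" for y v
    using fun_cong[OF frechet_derivative_at[OF g'[OF that]], of v] by simp
  have g''_eq: "frechet_derivative (\<lambda>y. frechet_derivative g (at y) b) (at x) b = (1 / ?c) * q b b x"
    if "b \<in> Basis" for b
  proof -
    have "(\<Sum>b'\<in>Basis. (b \<bullet> b') * p b' y) = p b y" for y
      by (rule sum_Basis_inner[OF that])
    then have eq: "(1 / ?c) * p b y = frechet_derivative g (at y) b" if "y \<in> S" for y
      using g'_eq[OF that, of b] by simp
    have "((\<lambda>y. (1 / ?c) * p b y) has_derivative (\<lambda>h. (1 / ?c) * (\<Sum>b'\<in>Basis. (h \<bullet> b') * q b b' x))) (at x)"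
      by (rule has_derivative_mult_right[OF p'[OF x]])
    then have "((\<lambda>y. frechet_derivative g (at y) b) has_derivative
        (\<lambda>h. (1 / ?c) * (\<Sum>b'\<in>Basis. (h \<bullet> b') * q b b' x))) (at x)"
      by (rule has_derivative_transform_within_open[OF _ S(1) x eq])
    from fun_cong[OF frechet_derivative_at[OF this], of b]
    show ?thesis by (simp add: sum_Basis_inner[OF that])
  qed
  \<comment> \<open>The second order kernels sum over the diagonal to the Laplacian of
    \<open>bump\<close>, so by the weak equation these sums are also mollifications of
    \<open>G\<close>. Comparing the two limits identifies the Laplacian of \<open>g\<close>
    pointwise.\<close>
  have "(\<lambda>n. \<Sum>b\<in>Basis. approx (Suc (Suc DIM('a))) (\<kappa> b b) n x) \<longlonglongrightarrow> (\<Sum>b\<in>Basis. q b b x)"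
    by (intro tendsto_sum tendsto_uniform_limitI[OF q x])
  moreover have "(\<Sum>b\<in>Basis. approx (Suc (Suc DIM('a))) (\<kappa> b b) n x) =
      mollify lo hi G bump (scale n) x / scale n ^ DIM('a)" for n
  proof -
    have \<kappa>_cont: "continuous_on UNIV (\<kappa> b b)" for b
      unfolding \<kappa>_def by (rule Ck_on_continuous[OF Ck_bump''[of 0]])
    have lap: "laplacian bump z = (\<Sum>b\<in>Basis. \<kappa> b b z)" for z :: 'a
      by (simp add: laplacian_def \<kappa>_def)
    have "(\<Sum>b\<in>Basis. mollify lo hi g (\<kappa> b b) (scale n) x) = mollify lo hi g (laplacian bump) (scale n) x"
      unfolding mollify_def lap sum_distrib_left
      by (rule integral_sum[symmetric])
        (auto intro!: integrable_continuous continuous_mollify_integrand g_cont \<kappa>_cont)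
    then have "(\<Sum>b\<in>Basis. approx (Suc (Suc DIM('a))) (\<kappa> b b) n x) =
       mollify lo hi g (laplacian bump) (scale n) x / scale n ^ Suc (Suc DIM('a))"
      by (simp only: approx_def sum_divide_distrib[symmetric])
    also have "mollify lo hi g (laplacian bump) (scale n) x = (scale n)\<^sup>2 * mollify lo hi G bump (scale n) x"
      by (rule mollify_laplacian[OF weak Ck_on_bump bump_zero scale(1) room_le[OF x scale(2)]])
    finally show ?thesis
      using scale(1)[of n] by (simp add: power2_eq_square)
  qed
  moreover have "(\<lambda>n. mollify lo hi G bump (scale n) x / scale n ^ DIM('a)) \<longlonglongrightarrow> G x * ?c"
    using x S_subset
    by (intro mollify_tendsto G_cont Ck_on_continuous[OF Ck_on_bump[of 0]] bump_zero room_le_cbox scale) auto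
  ultimately have "(\<Sum>b\<in>Basis. q b b x) = G x * ?c"
    by (simp add: LIMSEQ_unique)
  then show "laplacian g x = G x"
    using integral_bump_pos[where 'a = 'a] by (simp add: laplacian_def g''_eq sum_divide_distrib[symmetric])
qed

end

lemma weak_poisson_C1:
  assumes "weak_poisson a b g G"
  shows "Ck_on 1 (box a b) g"
proof (rule Ck_on_local)
  fix x assume x: "x \<in> box a b"
  obtain r where r: "0 < r" "r \<le> 1"
    "\<And>y. y \<in> ball x r \<Longrightarrow> cbox (y - r *\<^sub>R One) (y + r *\<^sub>R One) \<subseteq> box a b"
    by (fact box_One_subset_ball[OF open_box x])
  have "Ck_on 1 (ball x r) g"
    by (rule weak_poisson_C1_locally[OF assms open_ball[of x r] convex_ball[of x r] r])
  then show "\<exists>T. open T \<and> x \<in> T \<and> Ck_on 1 T g"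
    using r(1) by (intro exI[of _ "ball x r"]) auto
qed

lemma weak_poisson_C2:
  fixes g G :: "'a::euclidean_space \<Rightarrow> real"
  assumes weak: "weak_poisson a b g G" and G: "locally_hoelder_on (box a b) G"
  shows "Ck_on 2 (box a b) g" and "\<And>x. x \<in> box a b \<Longrightarrow> laplacian g x = G x"
proof -
  have *: "\<exists>r>0. Ck_on 2 (ball x r) g \<and> laplacian g x = G x" if x: "x \<in> box a b" for x
  proof -
    obtain \<rho> C \<gamma> where \<rho>: "0 < \<rho>" "0 < \<gamma>"
      "\<And>y z. y \<in> ball x \<rho> \<inter> box a b \<Longrightarrow> z \<in> ball x \<rho> \<inter> box a b \<Longrightarrow> \<bar>G y - G z\<bar> \<le> C * norm (y - z) powr \<gamma>"
      using G x unfolding locally_hoelder_on_def by blast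
    have U: "open (ball x \<rho> \<inter> box a b)" "x \<in> ball x \<rho> \<inter> box a b"
      using x \<rho>(1) by (auto intro: open_Int open_box)
    \<comment> \<open>The cubes are kept inside the ball on which one Hoelder constant and one
      exponent serve, so that ball contains each centre and all points within r of it.\<close>
    obtain r where r: "0 < r" "r \<le> 1"
      "\<And>y. y \<in> ball x r \<Longrightarrow> cbox (y - r *\<^sub>R One) (y + r *\<^sub>R One) \<subseteq> ball x \<rho> \<inter> box a b"
      by (fact box_One_subset_ball[OF U])
    have sub: "cbox (y - r *\<^sub>R One) (y + r *\<^sub>R One) \<subseteq> box a b" if "y \<in> ball x r" for y
      using r(3)[OF that] by simp
    have H: "\<bar>G z - G y\<bar> \<le> C * norm (z - y) powr \<gamma>" if "y \<in> ball x r" "norm (y - z) \<le> r" for y z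
    proof (rule \<rho>(3))
      show "z \<in> ball x \<rho> \<inter> box a b"
        using r(3)[OF that(1)] cball_subset_cbox_One[OF that(2)] by blast
      have "norm (y - y) \<le> r" using r by simp
      from cball_subset_cbox_One[OF this] show "y \<in> ball x \<rho> \<inter> box a b"
        using r(3)[OF that(1)] by blast
    qed
    have "Ck_on 2 (ball x r) g"
      by (rule weak_poisson_C2_locally(1)[OF weak open_ball[of x r] convex_ball[of x r] r(1,2) sub \<rho>(2) H])
    moreover have x_in: "x \<in> ball x r"
      using r(1) by simp
    have "laplacian g x = G x"
      by (rule weak_poisson_C2_locally(2)[OF weak open_ball[of x r] convex_ball[of x r] r(1,2) sub \<rho>(2) H]; (assumption | rule x_in))
    ultimately show ?thesis using r(1) by blast
  qed
  show "Ck_on 2 (box a b) g"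
  proof (rule Ck_on_local)
    fix x assume "x \<in> box a b"
    from *[OF this] obtain r where "0 < r" "Ck_on 2 (ball x r) g" by blast
    then show "\<exists>T. open T \<and> x \<in> T \<and> Ck_on 2 T g"
      by (intro exI[of _ "ball x r"]) auto
  qed
  show "laplacian g x = G x" if "x \<in> box a b" for x
    using *[OF that] by blast
qed

section \<open>Lebesgue measure and Hoelder continuity\<close>

lemma nn_integral_lborel_translate:
  fixes f :: "'a::euclidean_space \<Rightarrow> ennreal"
  assumes "f \<in> borel_measurable borel"
  shows "(\<integral>\<^sup>+z. f (c + z) \<partial>lborel) = (\<integral>\<^sup>+z. f z \<partial>lborel)"
proof -
  have "(\<integral>\<^sup>+z. f z \<partial>lborel) = (\<integral>\<^sup>+z. f z \<partial>distr lborel borel ((+) c))"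
    by (simp add: lborel_distr_plus)
  also have "\<dots> = (\<integral>\<^sup>+z. f (c + z) \<partial>lborel)"
    using assms by (intro nn_integral_distr) auto
  finally show ?thesis by simp
qed

text \<open>
  The uniqueness argument for Haar measure: the image measure under \<open>T\<close> is translation invariant, so Fubini
  shows that it is proportional to Lebesgue measure, and both agree on the unit ball.
\<close>

lemma nn_integral_lborel_orthogonal:
  fixes T :: "'a::euclidean_space \<Rightarrow> 'a" and g :: "'a \<Rightarrow> ennreal"
  assumes T: "orthogonal_transformation T" and g[measurable]: "g \<in> borel_measurable borel"
  shows "(\<integral>\<^sup>+z. g (T z) \<partial>lborel) = (\<integral>\<^sup>+z. g z \<partial>lborel)"
proof -
  have lin: "linear T" using T by (simp add: orthogonal_transformation_def)
  have norm_T: "norm (T z) = norm z" for z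
    using T by (rule orthogonal_transformation_norm)
  have [measurable]: "T \<in> borel_measurable borel"
    using lin by (intro borel_measurable_continuous_onI linear_continuous_on linear_conv_bounded_linear[THEN iffD1])
  have shift: "(\<integral>\<^sup>+z. F (x + T z) \<partial>lborel) = (\<integral>\<^sup>+z. F (T z) \<partial>lborel)"
    "(\<integral>\<^sup>+z. F (x - T z) \<partial>lborel) = (\<integral>\<^sup>+z. F (- T z) \<partial>lborel)"
    if [measurable]: "F \<in> borel_measurable borel" for F :: "'a \<Rightarrow> ennreal" and x
  proof -
    obtain x' where x': "x = T x'"
      using orthogonal_transformation_surj[OF T] by (auto simp: surj_def)
    show "(\<integral>\<^sup>+z. F (x + T z) \<partial>lborel) = (\<integral>\<^sup>+z. F (T z) \<partial>lborel)"
      using nn_integral_lborel_translate[of "\<lambda>z. F (T z)" x'] by (simp add: linear_add[OF lin] x')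
    show "(\<integral>\<^sup>+z. F (x - T z) \<partial>lborel) = (\<integral>\<^sup>+z. F (- T z) \<partial>lborel)"
      using nn_integral_lborel_translate[of "\<lambda>z. F (- T z)" "- x'"]
      by (simp add: linear_diff[OF lin] x')
  qed
  define f :: "'a \<Rightarrow> ennreal" where "f = indicator (ball 0 1)"
  have [measurable]: "f \<in> borel_measurable borel"
    unfolding f_def by (intro borel_measurable_indicator) simp
  let ?f = "\<integral>\<^sup>+x. f x \<partial>lborel"
  have "?f * (\<integral>\<^sup>+z. g (T z) \<partial>lborel) = (\<integral>\<^sup>+x. f x * (\<integral>\<^sup>+z. g (T z) \<partial>lborel) \<partial>lborel)"
    by (simp add: nn_integral_multc)
  also have "\<dots> = (\<integral>\<^sup>+x. (\<integral>\<^sup>+z. f x * g (x + T z) \<partial>lborel) \<partial>lborel)"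
    by (simp add: nn_integral_cmult shift(1))
  also have "\<dots> = (\<integral>\<^sup>+z. (\<integral>\<^sup>+x. f x * g (x + T z) \<partial>lborel) \<partial>lborel)"
    by (rule lborel_pair.Fubini'[symmetric]) measurable
  also have "\<dots> = (\<integral>\<^sup>+z. (\<integral>\<^sup>+x. f (x - T z) * g x \<partial>lborel) \<partial>lborel)"
  proof (rule nn_integral_cong)
    fix z
    show "(\<integral>\<^sup>+x. f x * g (x + T z) \<partial>lborel) = (\<integral>\<^sup>+x. f (x - T z) * g x \<partial>lborel)"
      using nn_integral_lborel_translate[of "\<lambda>x. f x * g (x + T z)" "- T z"] by simp
  qed
  also have "\<dots> = (\<integral>\<^sup>+x. (\<integral>\<^sup>+z. f (x - T z) * g x \<partial>lborel) \<partial>lborel)"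
    by (rule lborel_pair.Fubini') measurable
  also have "\<dots> = (\<integral>\<^sup>+x. (\<integral>\<^sup>+z. f (- T z) \<partial>lborel) * g x \<partial>lborel)"
    by (simp add: nn_integral_multc shift(2))
  also have "\<dots> = (\<integral>\<^sup>+z. f (- T z) \<partial>lborel) * (\<integral>\<^sup>+x. g x \<partial>lborel)"
    by (simp add: nn_integral_cmult)
  also have "(\<integral>\<^sup>+z. f (- T z) \<partial>lborel) = ?f"
    by (simp add: f_def indicator_def norm_T)
  finally have "?f * (\<integral>\<^sup>+z. g (T z) \<partial>lborel) = ?f * (\<integral>\<^sup>+x. g x \<partial>lborel)" .
  moreover have "?f = emeasure lborel (ball (0::'a) 1)" by (simp add: f_def)
  ultimately have "ennreal (unit_ball_vol (real DIM('a))) * (\<integral>\<^sup>+z. g (T z) \<partial>lborel) =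
      ennreal (unit_ball_vol (real DIM('a))) * (\<integral>\<^sup>+z. g z \<partial>lborel)"
    by (simp add: emeasure_ball[of 1])
  then show ?thesis
    by (simp add: ennreal_mult_cancel_left less_imp_neq[OF unit_ball_vol_pos, symmetric])
qed

lemma lborel_distr_orthogonal:
  fixes T :: "'a::euclidean_space \<Rightarrow> 'a"
  assumes T: "orthogonal_transformation T"
  shows "distr lborel borel T = lborel"
proof (rule measure_eqI)
  have T_meas: "T \<in> measurable lborel borel"
    using T by (simp add: orthogonal_transformation_def linear_conv_bounded_linear
        borel_measurable_continuous_onI linear_continuous_on)
  fix A assume "A \<in> sets (distr lborel borel T)"
  then have A: "A \<in> sets borel" by simp
  have "emeasure (distr lborel borel T) A = (\<integral>\<^sup>+z. indicator A z \<partial>distr lborel borel T)"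
    using A by simp
  also have "\<dots> = (\<integral>\<^sup>+z. indicator A (T z) \<partial>lborel)"
    using A T_meas by (intro nn_integral_distr) auto
  also have "\<dots> = emeasure lborel A"
    using A by (subst nn_integral_lborel_orthogonal[OF T]) auto
  finally show "emeasure (distr lborel borel T) A = emeasure lborel A" .
qed simp

lemma integrable_lborel_orthogonal:
  fixes T :: "'a::euclidean_space \<Rightarrow> 'a" and f :: "'a \<Rightarrow> real"
  assumes T: "orthogonal_transformation T" and f: "integrable lborel f"
  shows "integrable lborel (\<lambda>x. f (T x))" and "(LINT x|lborel. f (T x)) = (LINT x|lborel. f x)"
proof -
  have T_meas: "T \<in> measurable lborel borel"
    using T by (simp add: orthogonal_transformation_def linear_conv_bounded_linear
        borel_measurable_continuous_onI linear_continuous_on)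
  have f_meas: "f \<in> borel_measurable borel" using f by auto
  show "integrable lborel (\<lambda>x. f (T x))"
    using f by (subst integrable_distr_eq[OF T_meas f_meas, symmetric]) (simp add: lborel_distr_orthogonal[OF T])
  show "(LINT x|lborel. f (T x)) = (LINT x|lborel. f x)"
    using integral_distr[OF T_meas f_meas] by (simp add: lborel_distr_orthogonal[OF T])
qed

text \<open>The bridge from the Lebesgue integral over all space in the weak Dunkl equation to the
  integral over a box used for mollification.\<close>

lemma lborel_integral_eq_cbox:
  fixes u :: "'a::euclidean_space \<Rightarrow> real"
  assumes u: "continuous_on (cbox a b) u" and out: "\<And>x. x \<notin> cbox a b \<Longrightarrow> u x = 0"
  shows "integrable lborel u" and "(LINT x|lborel. u x) = integral (cbox a b) u"
proof -
  have "integrable lborel (\<lambda>x. indicator (cbox a b) x *\<^sub>R u x)"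
    by (rule borel_integrable_compact[OF compact_cbox u])
  moreover have "(\<lambda>x. indicator (cbox a b) x *\<^sub>R u x) = u"
    using out by (intro ext) (auto simp: indicator_def)
  ultimately show int: "integrable lborel u" by simp
  have "(u has_integral integral (cbox a b) u) UNIV"
    by (rule has_integral_on_superset[OF integrable_integral[OF integrable_continuous[OF u]]])
      (use out in auto)
  then show "(LINT x|lborel. u x) = integral (cbox a b) u"
    by (rule has_integral_unique[OF has_integral_integral_lborel[OF int]])
qed

section \<open>Algebra of locally Hoelder functions\<close>

lemma locally_hoelder_onE:
  assumes "locally_hoelder_on S f" "x \<in> S"
  obtains r \<gamma> C where "0 < r" "0 < \<gamma>" "\<gamma> \<le> 1"
    "\<And>y z. y \<in> ball x r \<inter> S \<Longrightarrow> z \<in> ball x r \<inter> S \<Longrightarrow> \<bar>f y - f z\<bar> \<le> C * norm (y - z) powr \<gamma>"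
proof -
  from bspec[OF assms(1)[unfolded locally_hoelder_on_def] assms(2)]
  obtain r C \<gamma> where "r > 0 \<and> 0 < \<gamma> \<and> \<gamma> \<le> 1 \<and>
      (\<forall>y\<in>ball x r \<inter> S. \<forall>z\<in>ball x r \<inter> S. \<bar>f y - f z\<bar> \<le> C * norm (y - z) powr \<gamma>)"
    by (elim exE conjE) (rule that, simp only: simp_thms)
  then have r: "0 < r" "0 < \<gamma>" "\<gamma> \<le> 1"
    and H: "\<forall>y\<in>ball x r \<inter> S. \<forall>z\<in>ball x r \<inter> S. \<bar>f y - f z\<bar> \<le> C * norm (y - z) powr \<gamma>"
    by auto
  show ?thesis
    by (rule that[OF r]) (use H in blast)
qed

lemma locally_hoelder_onI:
  assumes "\<And>x. x \<in> S \<Longrightarrow> \<exists>r C \<gamma>. 0 < r \<and> 0 < \<gamma> \<and> \<gamma> \<le> 1 \<and>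
    (\<forall>y\<in>ball x r \<inter> S. \<forall>z\<in>ball x r \<inter> S. \<bar>f y - f z\<bar> \<le> C * norm (y - z) powr \<gamma>)"
  shows "locally_hoelder_on S f"
  unfolding locally_hoelder_on_def
proof
  fix x assume "x \<in> S"
  from assms[OF this] obtain r C \<gamma> where r: "0 < r" "0 < \<gamma> \<and> \<gamma> \<le> 1 \<and>
    (\<forall>y\<in>ball x r \<inter> S. \<forall>z\<in>ball x r \<inter> S. \<bar>f y - f z\<bar> \<le> C * norm (y - z) powr \<gamma>)"
    by (elim exE conjE) (rule that, assumption, simp only: simp_thms)
  show "\<exists>r>0. \<exists>C \<gamma>. 0 < \<gamma> \<and> \<gamma> \<le> 1 \<and>
    (\<forall>y\<in>ball x r \<inter> S. \<forall>z\<in>ball x r \<inter> S. \<bar>f y - f z\<bar> \<le> C * norm (y - z) powr \<gamma>)"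
    by (rule exI[of _ r], rule conjI[OF r(1)], rule exI[of _ C], rule exI[of _ \<gamma>], rule r(2))
qed

lemma hoelder_witnesses:
  assumes "0 < r" "0 < \<gamma>" "\<gamma> \<le> 1"
    "\<And>y z. y \<in> ball x r \<inter> S \<Longrightarrow> z \<in> ball x r \<inter> S \<Longrightarrow> \<bar>f y - f z\<bar> \<le> C * norm (y - z) powr \<gamma>"
  shows "\<exists>r C \<gamma>. 0 < r \<and> 0 < \<gamma> \<and> \<gamma> \<le> 1 \<and>
    (\<forall>y\<in>ball x r \<inter> S. \<forall>z\<in>ball x r \<inter> S. \<bar>f y - f z\<bar> \<le> C * norm (y - z) powr \<gamma>)"
  by (rule exI[of _ r], rule exI[of _ C], rule exI[of _ \<gamma>]) (use assms in simp)

lemma locally_hoelder_on_cong: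
  assumes "locally_hoelder_on S f" "\<And>x. x \<in> S \<Longrightarrow> f x = g x"
  shows "locally_hoelder_on S g"
proof (rule locally_hoelder_onI)
  fix x assume "x \<in> S"
  obtain r C \<gamma> where r: "0 < r" "0 < \<gamma>" "\<gamma> \<le> 1"
    "\<And>y z. y \<in> ball x r \<inter> S \<Longrightarrow> z \<in> ball x r \<inter> S \<Longrightarrow> \<bar>f y - f z\<bar> \<le> C * norm (y - z) powr \<gamma>"
    by (fact locally_hoelder_onE[OF assms(1) \<open>x \<in> S\<close>])
  note H = this
  show "\<exists>r C \<gamma>. 0 < r \<and> 0 < \<gamma> \<and> \<gamma> \<le> 1 \<and>
    (\<forall>y\<in>ball x r \<inter> S. \<forall>z\<in>ball x r \<inter> S. \<bar>g y - g z\<bar> \<le> C * norm (y - z) powr \<gamma>)"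
    by (rule hoelder_witnesses[where r = r and C = "C" and \<gamma> = "\<gamma>"]) (use H assms(2) in auto)
qed

lemma locally_hoelder_on_subset:
  assumes "locally_hoelder_on S f" "T \<subseteq> S"
  shows "locally_hoelder_on T f"
proof (rule locally_hoelder_onI)
  fix x assume "x \<in> T"
  then have "x \<in> S" using assms(2) by blast
  obtain r C \<gamma> where r: "0 < r" "0 < \<gamma>" "\<gamma> \<le> 1"
    "\<And>y z. y \<in> ball x r \<inter> S \<Longrightarrow> z \<in> ball x r \<inter> S \<Longrightarrow> \<bar>f y - f z\<bar> \<le> C * norm (y - z) powr \<gamma>"
    by (fact locally_hoelder_onE[OF assms(1) \<open>x \<in> S\<close>])
  note H = this
  show "\<exists>r C \<gamma>. 0 < r \<and> 0 < \<gamma> \<and> \<gamma> \<le> 1 \<and>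
    (\<forall>y\<in>ball x r \<inter> T. \<forall>z\<in>ball x r \<inter> T. \<bar>f y - f z\<bar> \<le> C * norm (y - z) powr \<gamma>)"
    by (rule hoelder_witnesses[where r = r and C = "C" and \<gamma> = "\<gamma>"]) (use H assms(2) in auto)
qed

text \<open>In a ball of radius at most 1/2 distances stay below 1, where a smaller exponent gives a
  larger power. The smaller exponent and the sum of the absolute constants therefore serve both
  functions.\<close>

lemma locally_hoelder_on_pair:
  fixes f g :: "'a::euclidean_space \<Rightarrow> real"
  assumes "locally_hoelder_on S f" "locally_hoelder_on S g" "x \<in> S"
  obtains r C \<gamma> where "0 < r" "r \<le> 1 / 2" "0 \<le> C" "0 < \<gamma>" "\<gamma> \<le> 1"
    "\<And>y z. y \<in> ball x r \<inter> S \<Longrightarrow> z \<in> ball x r \<inter> S \<Longrightarrow>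
       \<bar>f y - f z\<bar> \<le> C * norm (y - z) powr \<gamma> \<and> \<bar>g y - g z\<bar> \<le> C * norm (y - z) powr \<gamma>"
proof -
  obtain r1 C1 \<gamma>1 where 1: "0 < r1" "0 < \<gamma>1" "\<gamma>1 \<le> 1"
    "\<And>y z. y \<in> ball x r1 \<inter> S \<Longrightarrow> z \<in> ball x r1 \<inter> S \<Longrightarrow> \<bar>f y - f z\<bar> \<le> C1 * norm (y - z) powr \<gamma>1"
    by (fact locally_hoelder_onE[OF assms(1,3)])
  obtain r2 C2 \<gamma>2 where 2: "0 < r2" "0 < \<gamma>2" "\<gamma>2 \<le> 1"
    "\<And>y z. y \<in> ball x r2 \<inter> S \<Longrightarrow> z \<in> ball x r2 \<inter> S \<Longrightarrow> \<bar>g y - g z\<bar> \<le> C2 * norm (y - z) powr \<gamma>2"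
    by (fact locally_hoelder_onE[OF assms(2,3)])
  define r where "r = min (1 / 2) (min r1 r2)"
  define C where "C = \<bar>C1\<bar> + \<bar>C2\<bar>"
  define \<gamma> where "\<gamma> = min \<gamma>1 \<gamma>2"
  have raise: "C' * norm (y - z) powr \<gamma>' \<le> C * norm (y - z) powr \<gamma>"
    if "C' \<le> C" "\<gamma> \<le> \<gamma>'" "y \<in> ball x r" "z \<in> ball x r" for C' \<gamma>' y z
  proof -
    have "norm (y - z) \<le> 1"
      using dist_triangle_less_add[of y x r z r] that(3,4) by (simp add: dist_norm r_def norm_minus_commute)
    then have "norm (y - z) powr \<gamma>' \<le> norm (y - z) powr \<gamma>"
      using that(2) by (intro powr_mono') auto
    then show ?thesis
      using that(1) by (intro mult_mono) (auto simp: C_def)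
  qed
  show ?thesis
  proof (rule that[of r C \<gamma>])
    fix y z assume y: "y \<in> ball x r \<inter> S" and z: "z \<in> ball x r \<inter> S"
    have "\<bar>f y - f z\<bar> \<le> C1 * norm (y - z) powr \<gamma>1"
      using y z by (intro 1(4)) (auto simp: r_def)
    also have "\<dots> \<le> C * norm (y - z) powr \<gamma>"
      using y z by (intro raise) (auto simp: C_def \<gamma>_def)
    finally have f: "\<bar>f y - f z\<bar> \<le> C * norm (y - z) powr \<gamma>" .
    have "\<bar>g y - g z\<bar> \<le> C2 * norm (y - z) powr \<gamma>2"
      using y z by (intro 2(4)) (auto simp: r_def)
    also have "\<dots> \<le> C * norm (y - z) powr \<gamma>"
      using y z by (intro raise) (auto simp: C_def \<gamma>_def)
    finally show "\<bar>f y - f z\<bar> \<le> C * norm (y - z) powr \<gamma> \<and> \<bar>g y - g z\<bar> \<le> C * norm (y - z) powr \<gamma>"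
      using f by simp
  qed (use 1(1-3) 2(1-3) in \<open>auto simp: r_def C_def \<gamma>_def\<close>)
qed

lemma locally_hoelder_on_add:
  fixes f g :: "'a::euclidean_space \<Rightarrow> real"
  assumes "locally_hoelder_on S f" "locally_hoelder_on S g"
  shows "locally_hoelder_on S (\<lambda>x. f x + g x)"
proof (rule locally_hoelder_onI)
  fix x assume "x \<in> S"
  obtain r C \<gamma> where r: "0 < r" "r \<le> 1 / 2" "0 \<le> C" "0 < \<gamma>" "\<gamma> \<le> 1"
    "\<And>y z. y \<in> ball x r \<inter> S \<Longrightarrow> z \<in> ball x r \<inter> S \<Longrightarrow>
       \<bar>f y - f z\<bar> \<le> C * norm (y - z) powr \<gamma> \<and> \<bar>g y - g z\<bar> \<le> C * norm (y - z) powr \<gamma>"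
    by (fact locally_hoelder_on_pair[OF assms \<open>x \<in> S\<close>])
  have "\<bar>f y + g y - (f z + g z)\<bar> \<le> (2 * C) * norm (y - z) powr \<gamma>"
    if "y \<in> ball x r \<inter> S" "z \<in> ball x r \<inter> S" for y z
  proof -
    have "\<bar>f y + g y - (f z + g z)\<bar> \<le> \<bar>f y - f z\<bar> + \<bar>g y - g z\<bar>" by linarith
    then show ?thesis using r(6)[OF that] by linarith
  qed
  note H = this
  show "\<exists>r C \<gamma>. 0 < r \<and> 0 < \<gamma> \<and> \<gamma> \<le> 1 \<and> (\<forall>y\<in>ball x r \<inter> S. \<forall>z\<in>ball x r \<inter> S.
      \<bar>f y + g y - (f z + g z)\<bar> \<le> C * norm (y - z) powr \<gamma>)"
    by (rule hoelder_witnesses[where r = r and C = "2 * C" and \<gamma> = "\<gamma>"]) (use H r in auto)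
qed

lemma locally_hoelder_on_mult:
  fixes f g :: "'a::euclidean_space \<Rightarrow> real"
  assumes "locally_hoelder_on S f" "locally_hoelder_on S g"
  shows "locally_hoelder_on S (\<lambda>x. f x * g x)"
proof (rule locally_hoelder_onI)
  fix x assume "x \<in> S"
  obtain r C \<gamma> where r: "0 < r" "r \<le> 1 / 2" "0 \<le> C" "0 < \<gamma>" "\<gamma> \<le> 1"
    "\<And>y z. y \<in> ball x r \<inter> S \<Longrightarrow> z \<in> ball x r \<inter> S \<Longrightarrow>
       \<bar>f y - f z\<bar> \<le> C * norm (y - z) powr \<gamma> \<and> \<bar>g y - g z\<bar> \<le> C * norm (y - z) powr \<gamma>"
    by (fact locally_hoelder_on_pair[OF assms \<open>x \<in> S\<close>])
  \<comment> \<open>Local boundedness comes from the Hoelder bound itself, compared with the centre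
    x.\<close>
  have bound: "\<bar>f y\<bar> \<le> \<bar>f x\<bar> + C" "\<bar>g y\<bar> \<le> \<bar>g x\<bar> + C" if "y \<in> ball x r \<inter> S" for y
  proof -
    have "norm (y - x) \<le> 1" using that r(2) by (simp add: dist_norm norm_minus_commute)
    then have "norm (y - x) powr \<gamma> \<le> 1" using r(4) by (intro powr_le1) auto
    then have "C * norm (y - x) powr \<gamma> \<le> C" using r(3) by (simp add: mult_left_le)
    moreover have "x \<in> ball x r \<inter> S" using r(1) \<open>x \<in> S\<close> by simp
    ultimately show "\<bar>f y\<bar> \<le> \<bar>f x\<bar> + C" "\<bar>g y\<bar> \<le> \<bar>g x\<bar> + C"
      using r(6)[OF that, of x] by linarith+
  qed
  have "\<bar>f y * g y - f z * g z\<bar> \<le> ((\<bar>f x\<bar> + C) * C + C * (\<bar>g x\<bar> + C)) * norm (y - z) powr \<gamma>"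
    if "y \<in> ball x r \<inter> S" "z \<in> ball x r \<inter> S" for y z
  proof -
    have "f y * g y - f z * g z = f y * (g y - g z) + (f y - f z) * g z" by (simp add: algebra_simps)
    also have "\<bar>\<dots>\<bar> \<le> \<bar>f y\<bar> * \<bar>g y - g z\<bar> + \<bar>f y - f z\<bar> * \<bar>g z\<bar>"
      by (simp add: abs_mult[symmetric] abs_triangle_ineq)
    also have "\<dots> \<le> (\<bar>f x\<bar> + C) * (C * norm (y - z) powr \<gamma>) + (C * norm (y - z) powr \<gamma>) * (\<bar>g x\<bar> + C)"
      using r(6)[OF that] bound that r(3) by (intro add_mono mult_mono) auto
    finally show ?thesis by (simp add: algebra_simps)
  qed
  note H = this
  show "\<exists>r C \<gamma>. 0 < r \<and> 0 < \<gamma> \<and> \<gamma> \<le> 1 \<and> (\<forall>y\<in>ball x r \<inter> S. \<forall>z\<in>ball x r \<inter> S.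
      \<bar>f y * g y - f z * g z\<bar> \<le> C * norm (y - z) powr \<gamma>)"
    by (rule hoelder_witnesses[where r = r and C = "(\<bar>f x\<bar> + C) * C + C * (\<bar>g x\<bar> + C)" and \<gamma> = "\<gamma>"]) (use H r(1,4,5) in auto)
qed

text \<open>Exponent 1: the partial derivatives are bounded on a compact ball, and the mean value
  inequality applies in its convex interior.\<close>

lemma Ck_on_imp_locally_hoelder_on:
  fixes f :: "'a::euclidean_space \<Rightarrow> real"
  assumes "open S" and f: "Ck_on 1 S f"
  shows "locally_hoelder_on S f"
proof (rule locally_hoelder_onI)
  fix x assume "x \<in> S"
  then obtain r where r: "0 < r" "cball x r \<subseteq> S"
    using \<open>open S\<close> open_contains_cball by blast
  have der: "(f has_derivative frechet_derivative f (at y)) (at y)" if "y \<in> S" for y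
    using Ck_on_has_derivative[of 0 S f y] f that by simp
  have "\<exists>M. \<forall>y\<in>cball x r. \<bar>frechet_derivative f (at y) b\<bar> \<le> M" for b
  proof -
    have "continuous_on (cball x r) (\<lambda>y. frechet_derivative f (at y) b)"
      using f r by (auto intro: continuous_on_subset)
    then have "bounded ((\<lambda>y. frechet_derivative f (at y) b) ` cball x r)"
      by (intro compact_imp_bounded compact_continuous_image compact_cball)
    then show ?thesis unfolding bounded_iff by auto
  qed
  then have "\<forall>b. \<exists>M. \<forall>y\<in>cball x r. \<bar>frechet_derivative f (at y) b\<bar> \<le> M"
    by blast
  from choice[OF this] obtain M where M: "\<And>b y. y \<in> cball x r \<Longrightarrow> \<bar>frechet_derivative f (at y) b\<bar> \<le> M b"
    by blast
  let ?B = "\<Sum>b\<in>Basis. M b"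
  have on: "onorm (frechet_derivative f (at y)) \<le> ?B" if y: "y \<in> cball x r" for y
  proof (rule onorm_le)
    fix v
    have "norm (frechet_derivative f (at y) v) \<le> (\<Sum>b\<in>Basis. \<bar>(v \<bullet> b) * frechet_derivative f (at y) b\<bar>)"
      using y r(2) by (subst has_derivative_basis_expansion[OF der]) (auto intro: sum_abs)
    also have "\<dots> \<le> (\<Sum>b\<in>Basis. norm v * M b)"
      unfolding abs_mult using M[OF y] Basis_le_norm
      by (intro sum_mono mult_mono) auto
    also have "\<dots> = ?B * norm v" unfolding sum_distrib_left[symmetric] by (rule mult.commute)
    finally show "norm (frechet_derivative f (at y) v) \<le> ?B * norm v" .
  qed
  have "\<bar>f y - f z\<bar> \<le> ?B * norm (y - z) powr 1" if "y \<in> ball x r \<inter> S" "z \<in> ball x r \<inter> S" for y z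
  proof -
    have "norm (f y - f z) \<le> ?B * norm (y - z)"
    proof (rule differentiable_bound[of "ball x r" f "\<lambda>y. frechet_derivative f (at y)"])
      fix w assume w: "w \<in> ball x r"
      then have "w \<in> S" "w \<in> cball x r" using r(2) by auto
      then show "(f has_derivative frechet_derivative f (at w)) (at w within ball x r)"
        "onorm (frechet_derivative f (at w)) \<le> ?B"
        using der on by (auto intro: has_derivative_at_withinI)
    qed (use that in auto)
    then show ?thesis by simp
  qed
  note H = this
  show "\<exists>r C \<gamma>. 0 < r \<and> 0 < \<gamma> \<and> \<gamma> \<le> 1 \<and> (\<forall>y\<in>ball x r \<inter> S. \<forall>z\<in>ball x r \<inter> S.
      \<bar>f y - f z\<bar> \<le> C * norm (y - z) powr \<gamma>)"
    by (rule hoelder_witnesses[where r = r and C = "?B" and \<gamma> = "1::real"]) (use H r(1) in auto)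
qed

lemma locally_hoelder_on_const: "open S \<Longrightarrow> locally_hoelder_on S (\<lambda>_. c)"
  by (intro Ck_on_imp_locally_hoelder_on Ck_on_const)

lemma locally_hoelder_on_sum:
  fixes f :: "'i \<Rightarrow> 'a::euclidean_space \<Rightarrow> real"
  assumes "open S" "\<And>i. i \<in> I \<Longrightarrow> locally_hoelder_on S (f i)"
  shows "locally_hoelder_on S (\<lambda>x. \<Sum>i\<in>I. f i x)"
  using assms(2)
  by (induction I rule: infinite_finite_induct)
    (auto intro: locally_hoelder_on_add locally_hoelder_on_const[OF \<open>open S\<close>])

lemma locally_hoelder_on_compose_isometry:
  assumes "locally_hoelder_on S f" and T: "T ` S' \<subseteq> S" "\<And>x y. norm (T x - T y) = norm (x - y)"
  shows "locally_hoelder_on S' (\<lambda>x. f (T x))"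
proof (rule locally_hoelder_onI)
  fix x assume "x \<in> S'"
  then have Tx: "T x \<in> S" using T by blast
  obtain r C \<gamma> where r: "0 < r" "0 < \<gamma>" "\<gamma> \<le> 1"
    "\<And>y z. y \<in> ball (T x) r \<inter> S \<Longrightarrow> z \<in> ball (T x) r \<inter> S \<Longrightarrow> \<bar>f y - f z\<bar> \<le> C * norm (y - z) powr \<gamma>"
    by (fact locally_hoelder_onE[OF assms(1) Tx])
  have "\<bar>f (T y) - f (T z)\<bar> \<le> C * norm (y - z) powr \<gamma>" if "y \<in> ball x r \<inter> S'" "z \<in> ball x r \<inter> S'" for y z
    using r(4)[of "T y" "T z"] that T by (auto simp: dist_norm)
  note H = this
  show "\<exists>r C \<gamma>. 0 < r \<and> 0 < \<gamma> \<and> \<gamma> \<le> 1 \<and> (\<forall>y\<in>ball x r \<inter> S'. \<forall>z\<in>ball x r \<inter> S'.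
      \<bar>f (T y) - f (T z)\<bar> \<le> C * norm (y - z) powr \<gamma>)"
    by (rule hoelder_witnesses[where r = r and C = "C" and \<gamma> = "\<gamma>"]) (use H r(1-3) in auto)
qed

section \<open>Reflections and the conjugated Dunkl Laplacian\<close>

lemma reflection_inner: "reflection \<alpha> x \<bullet> \<beta> = x \<bullet> reflection \<alpha> \<beta>"
  by (simp add: reflection_def inner_diff_left inner_diff_right inner_commute)

lemma linear_reflection: "linear (reflection \<alpha>)"
  by (rule linearI)
    (simp_all add: reflection_def inner_add_left algebra_simps add_divide_distrib)

lemma reflection_reflection [simp]: "reflection \<alpha> (reflection \<alpha> x) = x"
  by (cases "\<alpha> = 0") (simp_all add: reflection_def inner_diff_left power2_norm_eq_inner field_simps)

lemma reflection_self: "\<alpha> \<noteq> 0 \<Longrightarrow> reflection \<alpha> \<alpha> = - \<alpha>"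
  by (simp add: reflection_def power2_norm_eq_inner scaleR_2)

lemma orthogonal_transformation_reflection: "orthogonal_transformation (reflection \<alpha>)"
  unfolding orthogonal_transformation_def by (simp add: linear_reflection reflection_inner)

lemma norm_reflection_diff: "norm (reflection \<alpha> x - reflection \<alpha> y) = norm (x - y)"
  using orthogonal_transformation_norm[OF orthogonal_transformation_reflection, of \<alpha> "x - y"]
  by (simp add: linear_diff[OF linear_reflection])

definition half_weight :: "'a::euclidean_space set \<Rightarrow> ('a \<Rightarrow> real) \<Rightarrow> 'a \<Rightarrow> real" where
  "half_weight P k x = (\<Prod>\<alpha>\<in>P. \<bar>x \<bullet> \<alpha>\<bar> powr k \<alpha>)"

text \<open>The addition rule for \<open>powr\<close> needs no sign condition, so the identity also
  holds on the hyperplanes, including where 0 powr 0 = 0.\<close>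

lemma dunkl_weight_half: "dunkl_weight P k x = (half_weight P k x)\<^sup>2"
  unfolding dunkl_weight_def half_weight_def power2_eq_square prod.distrib[symmetric]
  by (intro prod.cong refl) (simp only: powr_add mult_2)

section \<open>Invariance of the weight under the reflections of the root system\<close>

context
  fixes R P :: "'a::euclidean_space set" and k :: "'a \<Rightarrow> real"
  assumes R: "root_system R" and P: "positive_subsystem R P" and k: "multiplicity_function R k"
begin

lemma finite_positive: "finite P" and zero_notin_positive: "0 \<notin> P"
  and positive_subset: "P \<subseteq> R"
  using R P by (auto simp: root_system_def positive_subsystem_def intro: finite_subset)

lemma root_uminus: "\<alpha> \<in> R \<Longrightarrow> - \<alpha> \<in> R"
  using R unfolding root_system_def by blast

lemma roots_eq: "R = P \<union> uminus ` P" "P \<inter> uminus ` P = {}"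
proof -
  obtain \<beta> where \<beta>: "\<And>\<alpha>. \<alpha> \<in> R \<Longrightarrow> \<alpha> \<bullet> \<beta> \<noteq> 0" "P = {\<alpha>\<in>R. \<alpha> \<bullet> \<beta> > 0}"
    using P unfolding positive_subsystem_def by blast
  show "R = P \<union> uminus ` P"
  proof (intro equalityI subsetI)
    fix \<alpha> assume \<alpha>: "\<alpha> \<in> R"
    then consider "\<alpha> \<bullet> \<beta> > 0" | "- \<alpha> \<bullet> \<beta> > 0" using \<beta>(1)[OF \<alpha>] by fastforce
    then show "\<alpha> \<in> P \<union> uminus ` P"
    proof cases
      case 2
      then have "- \<alpha> \<in> P" using \<beta>(2) root_uminus[OF \<alpha>] by simp
      then show ?thesis by (intro UnI2 image_eqI[of _ _ "- \<alpha>"]) auto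
    qed (use \<beta>(2) \<alpha> in auto)
  qed (use positive_subset root_uminus in auto)
  show "P \<inter> uminus ` P = {}"
    unfolding \<beta>(2) by auto
qed

lemma multiplicity_reflection: "\<alpha> \<in> R \<Longrightarrow> \<beta> \<in> R \<Longrightarrow> k (reflection \<alpha> \<beta>) = k \<beta>"
  using k reflection_group.comp[OF _ reflection_group.id, of \<alpha> R]
  unfolding multiplicity_function_def by fastforce

lemma multiplicity_uminus:
  assumes "\<beta> \<in> R"
  shows "k (- \<beta>) = k \<beta>"
proof -
  have "\<beta> \<noteq> 0" using R assms unfolding root_system_def by auto
  then show ?thesis
    using multiplicity_reflection[OF assms assms] by (simp add: reflection_self)
qed

text \<open>A reflection permutes all roots but not the positive ones, so invariance is visible only
  in the product over \<open>R\<close>. The exponent is halved because opposite roots give equal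
  factors: the reflection in a root negates that root and preserves \<open>k\<close>.\<close>

lemma dunkl_weight_eq_prod_roots: "dunkl_weight P k x = (\<Prod>\<beta>\<in>R. \<bar>x \<bullet> \<beta>\<bar> powr k \<beta>)"
proof -
  have "(\<Prod>\<beta>\<in>R. \<bar>x \<bullet> \<beta>\<bar> powr k \<beta>) =
      (\<Prod>\<beta>\<in>P. \<bar>x \<bullet> \<beta>\<bar> powr k \<beta>) * (\<Prod>\<beta>\<in>uminus ` P. \<bar>x \<bullet> \<beta>\<bar> powr k \<beta>)"
    by (subst roots_eq(1)) (intro prod.union_disjoint finite_positive finite_imageI roots_eq(2))
  also have "(\<Prod>\<beta>\<in>uminus ` P. \<bar>x \<bullet> \<beta>\<bar> powr k \<beta>) = (\<Prod>\<beta>\<in>P. \<bar>x \<bullet> \<beta>\<bar> powr k (- \<beta>))"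
    by (subst prod.reindex) (auto simp: inj_on_def)
  also have "\<dots> = (\<Prod>\<beta>\<in>P. \<bar>x \<bullet> \<beta>\<bar> powr k \<beta>)"
    using positive_subset by (intro prod.cong) (auto simp: multiplicity_uminus)
  finally show ?thesis
    by (simp only: dunkl_weight_half half_weight_def power2_eq_square)
qed

lemma dunkl_weight_reflection:
  assumes "\<alpha> \<in> R"
  shows "dunkl_weight P k (reflection \<alpha> x) = dunkl_weight P k x"
proof -
  have img: "reflection \<alpha> ` R = R" using R assms unfolding root_system_def by blast
  have inj: "inj_on (reflection \<alpha>) R" by (rule inj_on_inverseI[of _ "reflection \<alpha>"]) simp
  have "(\<Prod>\<beta>\<in>R. \<bar>x \<bullet> \<beta>\<bar> powr k \<beta>) = (\<Prod>\<beta>\<in>reflection \<alpha> ` R. \<bar>x \<bullet> \<beta>\<bar> powr k \<beta>)"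
    by (simp only: img)
  also have "\<dots> = (\<Prod>\<beta>\<in>R. \<bar>x \<bullet> reflection \<alpha> \<beta>\<bar> powr k (reflection \<alpha> \<beta>))"
    by (simp add: prod.reindex[OF inj])
  also have "\<dots> = (\<Prod>\<beta>\<in>R. \<bar>reflection \<alpha> x \<bullet> \<beta>\<bar> powr k \<beta>)"
    using assms by (intro prod.cong) (auto simp: multiplicity_reflection reflection_inner)
  finally show ?thesis by (simp add: dunkl_weight_eq_prod_roots)
qed

end

section \<open>Conjugation by the square root of the weight\<close>

lemma abs_powr_has_derivative:
  fixes s c :: real
  assumes "s \<noteq> 0"
  shows "((\<lambda>s. \<bar>s\<bar> powr c) has_real_derivative \<bar>s\<bar> powr c * (c / s)) (at s)"
proof (cases "s > 0")
  case True
  have "((\<lambda>s. s powr c) has_real_derivative s powr c * (c / s)) (at s)"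
    using True by (auto intro!: derivative_eq_intros simp: powr_diff)
  then have "((\<lambda>s. \<bar>s\<bar> powr c) has_real_derivative s powr c * (c / s)) (at s)"
    by (rule has_field_derivative_transform_within_open[of _ _ _ "{0<..}"]) (use True in auto)
  then show ?thesis using True by simp
next
  case False
  then have "s < 0" using assms by simp
  have "((\<lambda>s. (- s) powr c) has_real_derivative (- s) powr c * (c / s)) (at s)"
    using \<open>s < 0\<close> by (auto intro!: derivative_eq_intros simp: powr_diff)
  then have "((\<lambda>s. \<bar>s\<bar> powr c) has_real_derivative (- s) powr c * (c / s)) (at s)"
    by (rule has_field_derivative_transform_within_open[of _ _ _ "{..<0}"]) (use \<open>s < 0\<close> in auto)
  then show ?thesis using \<open>s < 0\<close> by simp
qed

text \<open>The derivative of log \<open>half_weight\<close> in direction \<open>v\<close>, away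
  from the hyperplanes.\<close>

definition log_drift :: "'a::euclidean_space set \<Rightarrow> ('a \<Rightarrow> real) \<Rightarrow> 'a \<Rightarrow> 'a \<Rightarrow> real" where
  "log_drift P k v x = (\<Sum>\<alpha>\<in>P. k \<alpha> * (v \<bullet> \<alpha>) * (1 / (x \<bullet> \<alpha>)))"

text \<open>The squared length of the gradient of log \<open>half_weight\<close>.\<close>

definition drift_energy :: "'a::euclidean_space set \<Rightarrow> ('a \<Rightarrow> real) \<Rightarrow> 'a \<Rightarrow> real" where
  "drift_energy P k x = (\<Sum>b\<in>Basis. (log_drift P k b x)\<^sup>2)"

text \<open>The part of the Dunkl Laplacian that reads \<open>f\<close> at reflected points; the
  outer factor 2 has cancelled against the 1/2.\<close>

definition jump_term :: "'a::euclidean_space set \<Rightarrow> ('a \<Rightarrow> real) \<Rightarrow> ('a \<Rightarrow> real) \<Rightarrow> 'a \<Rightarrow> real" where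
  "jump_term P k f x = (\<Sum>\<alpha>\<in>P. k \<alpha> * (norm \<alpha>)\<^sup>2 * (f (reflection \<alpha> x) / (\<alpha> \<bullet> x)\<^sup>2))"

lemma sum_Basis_inner_power2: "(\<Sum>b\<in>Basis. (b \<bullet> \<alpha>)\<^sup>2) = (norm \<alpha>)\<^sup>2"
  for \<alpha> :: "'a::euclidean_space"
  unfolding power2_norm_eq_inner euclidean_inner[of \<alpha> \<alpha>]
  by (simp only: power2_eq_square inner_commute)

context
  fixes P U :: "'a::euclidean_space set" and k :: "'a \<Rightarrow> real"
  assumes P: "finite P" and U: "open U" "U \<subseteq> - (\<Union>\<alpha>\<in>P. hyperplane \<alpha>)"
begin

lemma inner_nonzero: "x \<in> U \<Longrightarrow> \<alpha> \<in> P \<Longrightarrow> x \<bullet> \<alpha> \<noteq> 0"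
  using U(2) by (auto simp: hyperplane_def)

lemma half_weight_pos: "x \<in> U \<Longrightarrow> 0 < half_weight P k x"
  unfolding half_weight_def by (intro prod_pos) (simp add: inner_nonzero)

lemma half_weight_has_derivative:
  assumes "x \<in> U"
  shows "(half_weight P k has_derivative (\<lambda>v. half_weight P k x * log_drift P k v x)) (at x)"
proof -
  have factor: "((\<lambda>x. \<bar>x \<bullet> \<alpha>\<bar> powr k \<alpha>) has_derivative
      (\<lambda>v. \<bar>x \<bullet> \<alpha>\<bar> powr k \<alpha> * (k \<alpha> * (v \<bullet> \<alpha>) * (1 / (x \<bullet> \<alpha>))))) (at x)" if "\<alpha> \<in> P" for \<alpha>
  proof -
    have "((\<lambda>x. x \<bullet> \<alpha>) has_derivative (\<lambda>v. v \<bullet> \<alpha>)) (at x)"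
      by (auto intro!: derivative_eq_intros)
    from has_derivative_compose[OF this abs_powr_has_derivative[OF inner_nonzero[OF assms that],
        THEN has_field_derivative_imp_has_derivative]]
    show ?thesis by (simp add: mult_ac)
  qed
  have "(half_weight P k has_derivative
    (\<lambda>v. \<Sum>\<alpha>\<in>P. \<bar>x \<bullet> \<alpha>\<bar> powr k \<alpha> * (k \<alpha> * (v \<bullet> \<alpha>) * (1 / (x \<bullet> \<alpha>))) * (\<Prod>\<beta>\<in>P - {\<alpha>}. \<bar>x \<bullet> \<beta>\<bar> powr k \<beta>))) (at x)"
    unfolding half_weight_def[abs_def] by (rule has_derivative_prod[OF factor])
  also have "(\<lambda>v. \<Sum>\<alpha>\<in>P. \<bar>x \<bullet> \<alpha>\<bar> powr k \<alpha> * (k \<alpha> * (v \<bullet> \<alpha>) * (1 / (x \<bullet> \<alpha>))) * (\<Prod>\<beta>\<in>P - {\<alpha>}. \<bar>x \<bullet> \<beta>\<bar> powr k \<beta>)) =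
      (\<lambda>v. half_weight P k x * log_drift P k v x)"
  proof (rule ext)
    fix v
    have "\<bar>x \<bullet> \<alpha>\<bar> powr k \<alpha> * (k \<alpha> * (v \<bullet> \<alpha>) * (1 / (x \<bullet> \<alpha>))) * (\<Prod>\<beta>\<in>P - {\<alpha>}. \<bar>x \<bullet> \<beta>\<bar> powr k \<beta>) =
       half_weight P k x * (k \<alpha> * (v \<bullet> \<alpha>) * (1 / (x \<bullet> \<alpha>)))" if "\<alpha> \<in> P" for \<alpha>
      unfolding half_weight_def prod.remove[OF P that] by (simp only: mult_ac)
    then show "(\<Sum>\<alpha>\<in>P. \<bar>x \<bullet> \<alpha>\<bar> powr k \<alpha> * (k \<alpha> * (v \<bullet> \<alpha>) * (1 / (x \<bullet> \<alpha>))) * (\<Prod>\<beta>\<in>P - {\<alpha>}. \<bar>x \<bullet> \<beta>\<bar> powr k \<beta>)) =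
       half_weight P k x * log_drift P k v x"
      unfolding log_drift_def sum_distrib_left by (intro sum.cong) simp_all
  qed
  finally show ?thesis .
qed

lemma Ck_on_log_drift: "Ck_on n U (log_drift P k v)"
  unfolding log_drift_def[abs_def]
  by (intro Ck_on_sum Ck_on_mult Ck_on_const Ck_on_inverse_inner U(1) inner_nonzero)

lemma Ck_on_half_weight: "Ck_on n U (half_weight P k)"
  by (rule Ck_on_if_derivative_factors[OF U(1) half_weight_has_derivative Ck_on_log_drift])

lemma Ck_on_inverse_half_weight: "Ck_on n U (\<lambda>x. 1 / half_weight P k x)"
proof (rule Ck_on_if_derivative_factors[OF U(1)])
  fix x assume x: "x \<in> U"
  have "half_weight P k x \<noteq> 0" using half_weight_pos[OF x] by simp
  from has_derivative_divide[OF has_derivative_const half_weight_has_derivative[OF x] this, of 1]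
  show "((\<lambda>x. 1 / half_weight P k x) has_derivative
      (\<lambda>v. 1 / half_weight P k x * (- 1 * log_drift P k v x))) (at x)"
    by (rule has_derivative_eq_rhs) (use half_weight_pos[OF x] in \<open>simp add: fun_eq_iff field_simps\<close>)
qed (intro Ck_on_mult Ck_on_const U(1) Ck_on_log_drift)

lemma Ck_on_drift_energy: "Ck_on n U (drift_energy P k)"
  unfolding drift_energy_def[abs_def] power2_eq_square
  by (intro Ck_on_sum Ck_on_mult Ck_on_log_drift U(1))

text \<open>The zeroth order part of the conjugated operator: the divergence of the drift cancels against
  the potential \<open>\<Sum>\<alpha>\<in>P. k \<alpha> * (norm \<alpha>)\<^sup>2 / (\<alpha> \<bullet> x)\<^sup>2\<close> of the Dunkl Laplacian, leaving only \<open>drift_energy\<close>.\<close>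

lemma half_weight_dunkl_laplacian:
  assumes S: "open S" "S \<subseteq> U" and \<phi>: "Ck_on 2 S \<phi>" and x: "x \<in> S"
    and \<psi>: "\<And>y. y \<in> S \<Longrightarrow> \<psi> y = half_weight P k y * \<phi> y"
  shows "half_weight P k x * dunkl_laplacian P k \<phi> x =
    laplacian \<psi> x - drift_energy P k x * \<psi> x + half_weight P k x * jump_term P k \<phi> x"
proof -
  let ?w = "half_weight P k" and ?d = "log_drift P k"
  have xU: "x \<in> U" using x S by blast
  have \<phi>1: "(\<phi> has_derivative frechet_derivative \<phi> (at y)) (at y)" if "y \<in> S" for y
    using \<phi> that by (intro Ck_on_has_derivative[of 1 S]) (simp_all add: numeral_2_eq_2)
  have \<phi>2: "((\<lambda>y. frechet_derivative \<phi> (at y) b) has_derivative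
      frechet_derivative (\<lambda>y. frechet_derivative \<phi> (at y) b) (at x)) (at x)" for b
    using \<phi> x by (intro Ck_on_has_derivative[of 0 S]) (simp_all add: numeral_2_eq_2)
  have \<psi>': "frechet_derivative \<psi> (at y) b = ?w y * (?d b y * \<phi> y + frechet_derivative \<phi> (at y) b)"
    if y: "y \<in> S" for y b
  proof -
    have "((\<lambda>y. ?w y * \<phi> y) has_derivative
        (\<lambda>v. ?w y * frechet_derivative \<phi> (at y) v + ?w y * ?d v y * \<phi> y)) (at y)"
      using y S by (intro has_derivative_mult half_weight_has_derivative \<phi>1) auto
    then have "(\<psi> has_derivative
        (\<lambda>v. ?w y * frechet_derivative \<phi> (at y) v + ?w y * ?d v y * \<phi> y)) (at y)"
      by (rule has_derivative_transform_within_open[OF _ S(1) y]) (simp add: \<psi>)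
    from fun_cong[OF frechet_derivative_at[OF this], of b]
    show ?thesis by (simp add: algebra_simps)
  qed
  have d': "(?d b has_derivative (\<lambda>v. \<Sum>\<alpha>\<in>P. k \<alpha> * (b \<bullet> \<alpha>) * (- (v \<bullet> \<alpha>) / (x \<bullet> \<alpha>)\<^sup>2))) (at x)" for b
    unfolding log_drift_def[abs_def]
  proof (intro has_derivative_sum has_derivative_mult_right)
    fix \<alpha> assume "\<alpha> \<in> P"
    then show "((\<lambda>x. 1 / (x \<bullet> \<alpha>)) has_derivative (\<lambda>v. - (v \<bullet> \<alpha>) / (x \<bullet> \<alpha>)\<^sup>2)) (at x)"
      using inner_nonzero[OF xU] by (auto intro!: derivative_eq_intros simp: power2_eq_square)
  qed
  have \<psi>'': "frechet_derivative (\<lambda>y. frechet_derivative \<psi> (at y) b) (at x) b =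
      ?w x * ((?d b x)\<^sup>2 * \<phi> x + 2 * (?d b x * frechet_derivative \<phi> (at x) b)
        - (\<Sum>\<alpha>\<in>P. k \<alpha> * (b \<bullet> \<alpha>)\<^sup>2 / (x \<bullet> \<alpha>)\<^sup>2) * \<phi> x
        + frechet_derivative (\<lambda>y. frechet_derivative \<phi> (at y) b) (at x) b)" for b
  proof -
    have "((\<lambda>y. ?w y * (?d b y * \<phi> y + frechet_derivative \<phi> (at y) b)) has_derivative
       (\<lambda>v. ?w x * (?d b x * frechet_derivative \<phi> (at x) v +
            (\<Sum>\<alpha>\<in>P. k \<alpha> * (b \<bullet> \<alpha>) * (- (v \<bullet> \<alpha>) / (x \<bullet> \<alpha>)\<^sup>2)) * \<phi> x +
            frechet_derivative (\<lambda>y. frechet_derivative \<phi> (at y) b) (at x) v) +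
          ?w x * ?d v x * (?d b x * \<phi> x + frechet_derivative \<phi> (at x) b))) (at x)"
      by (intro has_derivative_mult has_derivative_add half_weight_has_derivative[OF xU] d' \<phi>1[OF x] \<phi>2)
    then have "((\<lambda>y. frechet_derivative \<psi> (at y) b) has_derivative
       (\<lambda>v. ?w x * (?d b x * frechet_derivative \<phi> (at x) v +
            (\<Sum>\<alpha>\<in>P. k \<alpha> * (b \<bullet> \<alpha>) * (- (v \<bullet> \<alpha>) / (x \<bullet> \<alpha>)\<^sup>2)) * \<phi> x +
            frechet_derivative (\<lambda>y. frechet_derivative \<phi> (at y) b) (at x) v) +
          ?w x * ?d v x * (?d b x * \<phi> x + frechet_derivative \<phi> (at x) b))) (at x)"
      by (rule has_derivative_transform_within_open[OF _ S(1) x]) (simp add: \<psi>')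
    from fun_cong[OF frechet_derivative_at[OF this], of b]
    have "frechet_derivative (\<lambda>y. frechet_derivative \<psi> (at y) b) (at x) b =
       ?w x * (?d b x * frechet_derivative \<phi> (at x) b +
            (\<Sum>\<alpha>\<in>P. k \<alpha> * (b \<bullet> \<alpha>) * (- (b \<bullet> \<alpha>) / (x \<bullet> \<alpha>)\<^sup>2)) * \<phi> x +
            frechet_derivative (\<lambda>y. frechet_derivative \<phi> (at y) b) (at x) b) +
          ?w x * ?d b x * (?d b x * \<phi> x + frechet_derivative \<phi> (at x) b)" by simp
    moreover have "(\<Sum>\<alpha>\<in>P. k \<alpha> * (b \<bullet> \<alpha>) * (- (b \<bullet> \<alpha>) / (x \<bullet> \<alpha>)\<^sup>2)) =
        - (\<Sum>\<alpha>\<in>P. k \<alpha> * (b \<bullet> \<alpha>)\<^sup>2 / (x \<bullet> \<alpha>)\<^sup>2)"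
      by (simp add: sum_negf[symmetric] power2_eq_square mult.assoc)
    ultimately show ?thesis
      by (simp only: ) (simp add: algebra_simps power2_eq_square)
  qed
  define V where "V = (\<Sum>\<alpha>\<in>P. k \<alpha> * (norm \<alpha>)\<^sup>2 / (x \<bullet> \<alpha>)\<^sup>2)"
  have V: "(\<Sum>b\<in>(Basis::'a set). \<Sum>\<alpha>\<in>P. k \<alpha> * (b \<bullet> \<alpha>)\<^sup>2 / (x \<bullet> \<alpha>)\<^sup>2) = V"
    unfolding V_def
    by (subst sum.swap) (simp add: sum_divide_distrib[symmetric] sum_distrib_left[symmetric] sum_Basis_inner_power2)
  have grad: "(\<Sum>b\<in>Basis. ?d b x * frechet_derivative \<phi> (at x) b) =
      (\<Sum>\<alpha>\<in>P. k \<alpha> * ((grad \<phi> x \<bullet> \<alpha>) / (\<alpha> \<bullet> x)))"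
  proof -
    have "grad \<phi> x \<bullet> \<alpha> = (\<Sum>b\<in>Basis. frechet_derivative \<phi> (at x) b * (b \<bullet> \<alpha>))" for \<alpha>
      by (simp add: grad_def inner_sum_left)
    then show ?thesis
      unfolding log_drift_def sum_distrib_right
      by (subst sum.swap, intro sum.cong)
        (simp_all add: sum_distrib_left sum_divide_distrib inner_commute[of x] mult_ac)
  qed
  have lap: "laplacian \<psi> x = ?w x * (drift_energy P k x * \<phi> x +
      2 * (\<Sum>\<alpha>\<in>P. k \<alpha> * ((grad \<phi> x \<bullet> \<alpha>) / (\<alpha> \<bullet> x))) - V * \<phi> x + laplacian \<phi> x)"
    unfolding laplacian_def \<psi>'' drift_energy_def grad[symmetric] V[symmetric]
    by (simp only: sum_distrib_left[symmetric] sum_distrib_right sum.distrib sum_subtractf)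
  have dunkl: "dunkl_laplacian P k \<phi> x = laplacian \<phi> x + 2 * (\<Sum>\<alpha>\<in>P. k \<alpha> * ((grad \<phi> x \<bullet> \<alpha>) / (\<alpha> \<bullet> x)))
      - V * \<phi> x + jump_term P k \<phi> x"
  proof -
    have "2 * (\<Sum>\<alpha>\<in>P. k \<alpha> * ((grad \<phi> x \<bullet> \<alpha>) / (\<alpha> \<bullet> x)
         - (norm \<alpha>)\<^sup>2 / 2 * ((\<phi> x - \<phi> (reflection \<alpha> x)) / (\<alpha> \<bullet> x)\<^sup>2))) =
      (\<Sum>\<alpha>\<in>P. 2 * (k \<alpha> * ((grad \<phi> x \<bullet> \<alpha>) / (\<alpha> \<bullet> x))) - k \<alpha> * (norm \<alpha>)\<^sup>2 / (x \<bullet> \<alpha>)\<^sup>2 * \<phi> x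
         + k \<alpha> * (norm \<alpha>)\<^sup>2 * (\<phi> (reflection \<alpha> x) / (\<alpha> \<bullet> x)\<^sup>2))"
      unfolding sum_distrib_left
      by (intro sum.cong) (simp_all add: inner_commute[of x] algebra_simps diff_divide_distrib)
    then show ?thesis
      unfolding dunkl_laplacian_def jump_term_def V_def
      by (simp only: sum.distrib sum_subtractf sum_distrib_left sum_distrib_right)
  qed
  show ?thesis
    unfolding dunkl lap \<psi>[OF x] by (simp add: algebra_simps)
qed

end

section \<open>The Dunkl Dirichlet problem\<close>

text \<open>The reflected point first appears in the test function. Since each reflection preserves
  Lebesgue measure and the weight, a change of variables in every summand puts it into
  \<open>h\<close>; afterwards all integrands vanish outside the box.\<close>

lemma dunkl_solution_weak_poisson:
  fixes R P D U :: "'a::euclidean_space set" and k h :: "'a \<Rightarrow> real"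
  assumes R: "root_system R" and P: "positive_subsystem R P" and k: "multiplicity_function R k"
    and U: "open U" "U \<subseteq> - (\<Union>\<alpha>\<in>P. hyperplane \<alpha>)" and D: "cbox a b \<subseteq> D" "D \<subseteq> U"
    and h: "continuous_on UNIV h"
    and weak: "\<And>\<phi>. \<phi> \<in> test_functions D \<Longrightarrow>
      (LINT x|lborel. h x * dunkl_laplacian P k \<phi> x * dunkl_weight P k x) = 0"
  shows "weak_poisson a b (\<lambda>x. half_weight P k x * h x)
    (\<lambda>x. drift_energy P k x * (half_weight P k x * h x) - half_weight P k x * jump_term P k h x)"
proof -
  let ?w = "half_weight P k" and ?W = "dunkl_weight P k" and ?B = "drift_energy P k"
  have finP: "finite P" by (rule finite_positive[OF R P k])
  have sub: "cbox a b \<subseteq> U" "box a b \<subseteq> U" using D box_subset_cbox by blast+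
  have nz: "x \<bullet> \<alpha> \<noteq> 0" if "x \<in> U" "\<alpha> \<in> P" for x \<alpha>
    by (rule inner_nonzero[OF finP U that])
  have w_pos: "0 < ?w x" if "x \<in> U" for x
    by (rule half_weight_pos[OF finP U that])
  have w_cont: "continuous_on (cbox a b) ?w"
    by (rule continuous_on_subset[OF Ck_on_continuous[OF Ck_on_half_weight[OF finP U, of 0]] sub(1)])
  have B_cont: "continuous_on (cbox a b) ?B"
    by (rule continuous_on_subset[OF Ck_on_continuous[OF Ck_on_drift_energy[OF finP U, of 0]] sub(1)])
  have h_cont: "continuous_on (cbox a b) h"
    using h by (rule continuous_on_subset) simp
  have refl_cont: "continuous_on (cbox a b) (\<lambda>x. h (reflection \<alpha> x))" for \<alpha>
    by (rule continuous_on_compose2[OF h])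
      (auto intro!: linear_continuous_on simp: linear_conv_bounded_linear[symmetric] linear_reflection)
  have inner_cont: "continuous_on (cbox a b) (\<lambda>x. F x / (\<alpha> \<bullet> x)\<^sup>2)"
    if "\<alpha> \<in> P" "continuous_on (cbox a b) F" for \<alpha> and F :: "'a \<Rightarrow> real"
    using nz[OF _ that(1)] sub(1) that(2)
    by (intro continuous_on_divide continuous_intros) (auto simp: inner_commute)
  have jump_cont: "continuous_on (cbox a b) (jump_term P k h)"
    unfolding jump_term_def[abs_def]
    by (intro continuous_on_sum continuous_on_mult continuous_on_const inner_cont refl_cont)
  let ?g = "\<lambda>x. ?w x * h x" and ?G = "\<lambda>x. ?B x * (?w x * h x) - ?w x * jump_term P k h x"
  have g_cont: "continuous_on (cbox a b) ?g" and G_cont: "continuous_on (cbox a b) ?G"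
    by (intro continuous_intros w_cont B_cont h_cont jump_cont)+
  have "integral (cbox a b) (\<lambda>y. ?g y * laplacian \<psi> y) = integral (cbox a b) (\<lambda>y. ?G y * \<psi> y)"
    if \<psi>: "\<psi> \<in> test_functions (box a b)" for \<psi>
  proof -
    define K where "K = closure {x. \<psi> x \<noteq> 0}"
    have \<psi>_Ck: "Ck_on n UNIV \<psi>" for n using \<psi> by (simp add: test_functions_def)
    have K: "compact K" "K \<subseteq> box a b" "open (- K)"
      using \<psi> by (auto simp: test_functions_def K_def)
    have \<psi>_0: "\<psi> x = 0" if "x \<in> - K" for x
      using that closure_subset[of "{x. \<psi> x \<noteq> 0}"] by (auto simp: K_def)
    have outside: "x \<in> - K" if "x \<notin> cbox a b" for x
      using that K(2) box_subset_cbox by blast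
    \<comment> \<open>Off K the numerator is 0, so zeros of \<open>half_weight\<close> on the
      hyperplanes do no harm. Smoothness is glued from the box, where the weight is positive, and
      the open complement of K.\<close>
    define \<phi> where "\<phi> = (\<lambda>x. \<psi> x * (1 / ?w x))"
    have \<phi>_0: "\<phi> x = 0" if "x \<in> - K" for x using \<psi>_0[OF that] by (simp add: \<phi>_def)
    have \<phi>_Ck: "Ck_on n UNIV \<phi>" for n
    proof (rule Ck_on_local)
      fix x :: 'a
      have "Ck_on n (box a b) \<phi>"
        unfolding \<phi>_def
        by (intro Ck_on_mult open_box Ck_on_subset[OF \<psi>_Ck subset_UNIV]
            Ck_on_subset[OF Ck_on_inverse_half_weight[OF finP U] sub(2)])
      moreover have "Ck_on n (- K) \<phi>"
        by (rule Ck_on_cong[OF K(3) _ Ck_on_const[OF K(3), of n 0]]) (simp add: \<phi>_0)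
      ultimately show "\<exists>T. open T \<and> x \<in> T \<and> Ck_on n T \<phi>"
        using K(2,3) open_box by (cases "x \<in> K") blast+
    qed
    have supp: "closure {x. \<phi> x \<noteq> 0} \<subseteq> K"
      unfolding K_def by (intro closure_mono) (auto simp: \<phi>_def)
    have "\<phi> \<in> test_functions D"
      unfolding test_functions_def
    proof (intro CollectI conjI allI \<phi>_Ck)
      show "compact (closure {x. \<phi> x \<noteq> 0})"
        using compact_Int_closed[OF K(1) closed_closure[of "{x. \<phi> x \<noteq> 0}"]] supp
        by (simp add: Int_absorb1)
      show "closure {x. \<phi> x \<noteq> 0} \<subseteq> D"
        using supp K(2) D(1) box_subset_cbox by blast
    qed
    note weak_\<phi> = weak[OF this]
    have w\<phi>: "?w x * \<phi> x = \<psi> x" if "x \<in> U" for x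
      using w_pos[OF that] by (simp add: \<phi>_def)
    \<comment> \<open>\<open>T\<close> has the reflected point in the test function,
      \<open>T'\<close> has it in \<open>h\<close>. Only \<open>T'\<close> is known to vanish
      outside the box, so integrability is shown for \<open>T'\<close> and carried over to
      \<open>T\<close>.\<close>
    define T where "T \<alpha> x = k \<alpha> * (norm \<alpha>)\<^sup>2 * (h x * \<phi> (reflection \<alpha> x) * ?W x / (\<alpha> \<bullet> x)\<^sup>2)" for \<alpha> x
    define T' where "T' \<alpha> x = k \<alpha> * (norm \<alpha>)\<^sup>2 * (h (reflection \<alpha> x) * \<phi> x * ?W x / (\<alpha> \<bullet> x)\<^sup>2)" for \<alpha> x
    define u where "u x = ?g x * (laplacian \<psi> x - ?B x * \<psi> x)" for x
    have sum_T: "(\<Sum>\<alpha>\<in>P. T \<alpha> x) = h x * ?W x * jump_term P k \<phi> x" for x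
      unfolding T_def jump_term_def sum_distrib_left by (intro sum.cong) simp_all
    \<comment> \<open>The identity is needed on all of space. Off K the function \<phi> vanishes
      near x, but not necessarily at the reflections of x, so the jump term survives there.\<close>
    have decomp: "h x * dunkl_laplacian P k \<phi> x * ?W x = u x + (\<Sum>\<alpha>\<in>P. T \<alpha> x)" for x
    proof (cases "x \<in> K")
      case True
      then have x: "x \<in> box a b" using K by blast
      have "?w x * dunkl_laplacian P k \<phi> x = laplacian \<psi> x - ?B x * \<psi> x + ?w x * jump_term P k \<phi> x"
        by (rule half_weight_dunkl_laplacian[OF finP U open_box sub(2) Ck_on_subset[OF \<phi>_Ck subset_UNIV] x])
          (use w\<phi> sub(2) in auto)
      then have "h x * ?w x * (?w x * dunkl_laplacian P k \<phi> x) =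
          h x * ?w x * (laplacian \<psi> x - ?B x * \<psi> x + ?w x * jump_term P k \<phi> x)"
        by (simp only:)
      then show ?thesis
        unfolding sum_T u_def dunkl_weight_half by (simp add: algebra_simps power2_eq_square)
    next
      case False
      then have x: "x \<in> - K" by simp
      have "frechet_derivative \<phi> (at x) = (\<lambda>_. 0)"
        by (rule frechet_derivative_zero[OF K(3) x \<phi>_0])
      then have "grad \<phi> x = 0"
        by (simp add: grad_def)
      moreover have "laplacian \<phi> x = 0" "laplacian \<psi> x = 0"
        by (rule laplacian_zero[OF K(3) x \<phi>_0], assumption) (rule laplacian_zero[OF K(3) x \<psi>_0])
      ultimately have "dunkl_laplacian P k \<phi> x = jump_term P k \<phi> x"
        unfolding dunkl_laplacian_def jump_term_def sum_distrib_left
        by (simp add: \<phi>_0[OF x] mult.assoc)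
      then show ?thesis
        unfolding sum_T u_def by (simp add: \<psi>_0[OF x] \<open>laplacian \<psi> x = 0\<close>)
    qed
    have lap_cont: "continuous_on (cbox a b) (laplacian \<psi>)" and \<psi>_cont: "continuous_on (cbox a b) \<psi>"
      by (rule continuous_on_subset[OF Ck_on_continuous[OF Ck_on_laplacian[OF \<psi>_Ck]]];
          simp)
        (rule continuous_on_subset[OF Ck_on_continuous[OF \<psi>_Ck[of 0]]]; simp)
    have \<phi>_cont: "continuous_on (cbox a b) \<phi>"
      by (rule continuous_on_subset[OF Ck_on_continuous[OF \<phi>_Ck[of 0]]]) simp
    have W_cont: "continuous_on (cbox a b) ?W"
      unfolding dunkl_weight_half[abs_def] by (intro continuous_intros w_cont)
    have u_cont: "continuous_on (cbox a b) u"
      unfolding u_def[abs_def] by (intro continuous_intros w_cont h_cont B_cont lap_cont \<psi>_cont)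
    have u_0: "u x = 0" if "x \<notin> cbox a b" for x
    proof -
      have "laplacian \<psi> x = 0" by (rule laplacian_zero[OF K(3) outside[OF that] \<psi>_0])
      then show ?thesis by (simp add: u_def \<psi>_0[OF outside[OF that]])
    qed
    have T'_cont: "continuous_on (cbox a b) (T' \<alpha>)" if "\<alpha> \<in> P" for \<alpha>
      unfolding T'_def[abs_def]
      by (intro continuous_on_mult continuous_on_const inner_cont[OF that] refl_cont \<phi>_cont W_cont)
    have T'_0: "T' \<alpha> x = 0" if "x \<notin> cbox a b" for x \<alpha>
      unfolding T'_def by (simp add: \<phi>_0[OF outside[OF that]])
    have T_T': "T \<alpha> x = T' \<alpha> (reflection \<alpha> x)" if "\<alpha> \<in> P" for \<alpha> x
    proof -
      have \<alpha>: "\<alpha> \<in> R" "\<alpha> \<noteq> 0"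
        using that positive_subset[OF R P k] zero_notin_positive[OF R P k] by auto
      \<comment> \<open>The sign is absorbed by the square in the denominator.\<close>
      have "\<alpha> \<bullet> reflection \<alpha> x = - (\<alpha> \<bullet> x)"
        using reflection_inner[of \<alpha> x \<alpha>] by (simp add: reflection_self[OF \<alpha>(2)] inner_commute)
      then show ?thesis
        by (simp add: T_def T'_def dunkl_weight_reflection[OF R P k \<alpha>(1)])
    qed
    have T_int: "integrable lborel (T \<alpha>)" "(LINT x|lborel. T \<alpha> x) = (LINT x|lborel. T' \<alpha> x)"
      "integrable lborel (T' \<alpha>)" if "\<alpha> \<in> P" for \<alpha>
    proof -
      show int: "integrable lborel (T' \<alpha>)"
        by (rule lborel_integral_eq_cbox(1)[OF T'_cont[OF that] T'_0])
      have T: "T \<alpha> = (\<lambda>x. T' \<alpha> (reflection \<alpha> x))" by (rule ext) (rule T_T'[OF that])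
      show "integrable lborel (T \<alpha>)" "(LINT x|lborel. T \<alpha> x) = (LINT x|lborel. T' \<alpha> x)"
        unfolding T by (rule integrable_lborel_orthogonal[OF orthogonal_transformation_reflection int])+
    qed
    have u_int: "integrable lborel u" by (rule lborel_integral_eq_cbox(1)[OF u_cont u_0])
    have "0 = (LINT x|lborel. u x + (\<Sum>\<alpha>\<in>P. T \<alpha> x))"
      using weak_\<phi> by (simp only: decomp)
    also have "\<dots> = (LINT x|lborel. u x) + (\<Sum>\<alpha>\<in>P. (LINT x|lborel. T \<alpha> x))"
      by (simp add: Bochner_Integration.integral_add Bochner_Integration.integral_sum u_int T_int(1))
    also have "\<dots> = (LINT x|lborel. u x) + (\<Sum>\<alpha>\<in>P. (LINT x|lborel. T' \<alpha> x))"
      by (simp add: T_int(2))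
    also have "\<dots> = (LINT x|lborel. u x + (\<Sum>\<alpha>\<in>P. T' \<alpha> x))"
      by (simp add: Bochner_Integration.integral_add Bochner_Integration.integral_sum u_int T_int(3))
    also have "\<dots> = integral (cbox a b) (\<lambda>x. u x + (\<Sum>\<alpha>\<in>P. T' \<alpha> x))"
      by (rule lborel_integral_eq_cbox(2)) (auto intro!: continuous_intros u_cont T'_cont simp: u_0 T'_0)
    also have "\<dots> = integral (cbox a b) (\<lambda>x. ?g x * laplacian \<psi> x - ?G x * \<psi> x)"
    proof (rule integral_cong)
      fix x assume "x \<in> cbox a b"
      then have x: "x \<in> U" using sub by blast
      have "(\<Sum>\<alpha>\<in>P. T' \<alpha> x) = ?w x * (?w x * \<phi> x) * jump_term P k h x"
        unfolding T'_def jump_term_def sum_distrib_left dunkl_weight_half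
        by (intro sum.cong) (simp_all add: power2_eq_square)
      then show "u x + (\<Sum>\<alpha>\<in>P. T' \<alpha> x) = ?g x * laplacian \<psi> x - ?G x * \<psi> x"
        unfolding w\<phi>[OF x] u_def by (simp add: algebra_simps)
    qed
    also have "\<dots> = integral (cbox a b) (\<lambda>x. ?g x * laplacian \<psi> x) - integral (cbox a b) (\<lambda>x. ?G x * \<psi> x)"
      by (intro integral_diff integrable_continuous continuous_on_mult[OF g_cont lap_cont]
          continuous_on_mult[OF G_cont \<psi>_cont])
    finally show ?thesis by simp
  qed
  then show ?thesis
    unfolding weak_poisson_def using g_cont G_cont by blast
qed

text \<open>The reflection changes the sign of \<alpha> \<bullet> x, so a connected set containing
  both points would meet the hyperplane.\<close>

lemma reflection_notin:
  assumes U: "connected U" "U \<subseteq> - hyperplane \<alpha>" and x: "x \<in> U" and "\<alpha> \<noteq> 0"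
  shows "reflection \<alpha> x \<notin> U"
proof
  assume y: "reflection \<alpha> x \<in> U"
  have eq: "\<alpha> \<bullet> reflection \<alpha> x = - (\<alpha> \<bullet> x)"
    using reflection_inner[of \<alpha> x \<alpha>] by (simp add: reflection_self[OF \<open>\<alpha> \<noteq> 0\<close>] inner_commute)
  have "\<exists>z\<in>U. \<alpha> \<bullet> z = 0"
  proof (cases "\<alpha> \<bullet> x \<le> 0")
    case True
    then show ?thesis by (intro connected_ivt_hyperplane[OF U(1) x y]) (auto simp: eq)
  next
    case False
    then show ?thesis by (intro connected_ivt_hyperplane[OF U(1) y x]) (auto simp: eq)
  qed
  then show False using U(2) by (auto simp: hyperplane_def inner_commute)
qed

theorem corollary4:
  fixes R P D :: "'a::euclidean_space set"
    and k f h :: "'a \<Rightarrow> real"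
  assumes "root_system R"
    and "positive_subsystem R P"
    and "multiplicity_function R k"
    and "open D" and "bounded D" and "laplace_regular D"
    and "\<exists>U. open U \<and> connected U \<and> U \<subseteq> - (\<Union>\<alpha>\<in>P. hyperplane \<alpha>) \<and> closure D \<subseteq> U"
    and "continuous_on (- D) f"
    and "locally_hoelder_on (\<Union>\<alpha>\<in>P. reflection \<alpha> ` D) f"
    and "is_dunkl_dirichlet_solution P k D f h"
  shows "Ck_on 2 D h \<and> (\<forall>x\<in>D. dunkl_laplacian P k h x = 0)"
proof -
  note R = assms(1) and P = assms(2) and k = assms(3) and D = assms(4)
  obtain U where U: "open U" "connected U" "U \<subseteq> - (\<Union>\<alpha>\<in>P. hyperplane \<alpha>)" "closure D \<subseteq> U"
    using assms(7) by blast
  have DU: "D \<subseteq> U" using U(4) closure_subset by blast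
  have h: "continuous_on UNIV h" "\<And>x. x \<notin> D \<Longrightarrow> h x = f x"
    and weak: "\<And>\<phi>. \<phi> \<in> test_functions D \<Longrightarrow>
      (LINT x|lborel. h x * dunkl_laplacian P k \<phi> x * dunkl_weight P k x) = 0"
    using assms(10) unfolding is_dunkl_dirichlet_solution_def by blast+
  have finP: "finite P" by (rule finite_positive[OF R P k])
  let ?w = "half_weight P k" and ?B = "drift_energy P k" and ?J = "jump_term P k h"
  let ?g = "\<lambda>x. ?w x * h x"
  let ?G = "\<lambda>x. ?B x * (?w x * h x) - ?w x * ?J x"
  have box: "\<exists>a b. x \<in> box a b \<and> box a b \<subseteq> D \<and> weak_poisson a b ?g ?G" if x: "x \<in> D" for x
  proof -
    obtain r where r: "0 < r" "r \<le> 1"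
      "\<And>y. y \<in> ball x r \<Longrightarrow> cbox (y - r *\<^sub>R One) (y + r *\<^sub>R One) \<subseteq> D"
      by (fact box_One_subset_ball[OF D x])
    let ?a = "x - r *\<^sub>R One" and ?b = "x + r *\<^sub>R One"
    have sub: "cbox ?a ?b \<subseteq> D" using r(1) by (intro r(3)) simp
    have "weak_poisson ?a ?b ?g ?G"
      by (rule dunkl_solution_weak_poisson[OF R P k U(1,3) sub DU h(1) weak])
    moreover have "x \<in> box ?a ?b"
      using r(1) by (simp add: mem_box inner_diff_left inner_add_left)
    moreover have "box ?a ?b \<subseteq> D" using sub box_subset_cbox by blast
    ultimately show ?thesis by blast
  qed
  \<comment> \<open>First pass, from continuity of the right hand side alone; it makes the summand
    with \<open>?g\<close> Hoelder.\<close>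
  have g1: "Ck_on 1 D ?g"
  proof (rule Ck_on_local)
    fix x assume "x \<in> D"
    then obtain a b where ab: "x \<in> box a b" "weak_poisson a b ?g ?G" using box by blast
    show "\<exists>T. open T \<and> x \<in> T \<and> Ck_on 1 T ?g"
      by (intro exI[of _ "box a b"] conjI open_box ab(1) weak_poisson_C1[OF ab(2)])
  qed
  \<comment> \<open>Here the nonlocal term becomes data: reflected points of D lie outside U, hence
    outside D, where \<open>h\<close> equals \<open>f\<close>. The inverse square is written as a
    product to match the closure rules.\<close>
  have J_hoelder: "locally_hoelder_on D ?J"
  proof (rule locally_hoelder_on_cong)
    show "locally_hoelder_on D (\<lambda>x. \<Sum>\<alpha>\<in>P. k \<alpha> * (norm \<alpha>)\<^sup>2 *
        (f (reflection \<alpha> x) * (1 / (x \<bullet> \<alpha>) * (1 / (x \<bullet> \<alpha>)))))"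
    proof (intro locally_hoelder_on_sum locally_hoelder_on_mult locally_hoelder_on_const D)
      fix \<alpha> assume \<alpha>: "\<alpha> \<in> P"
      show "locally_hoelder_on D (\<lambda>x. f (reflection \<alpha> x))"
        by (rule locally_hoelder_on_compose_isometry[OF assms(9) _ norm_reflection_diff]) (use \<alpha> in blast)
      show "locally_hoelder_on D (\<lambda>x. 1 / (x \<bullet> \<alpha>))"
        using inner_nonzero[OF finP U(1,3) _ \<alpha>] DU
        by (intro Ck_on_imp_locally_hoelder_on Ck_on_inverse_inner D) blast
      then show "locally_hoelder_on D (\<lambda>x. 1 / (x \<bullet> \<alpha>))" .
    qed
    fix x assume x: "x \<in> D"
    have "h (reflection \<alpha> x) = f (reflection \<alpha> x)" if "\<alpha> \<in> P" for \<alpha>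
    proof -
      have "reflection \<alpha> x \<notin> U"
        using U(2,3) x DU that zero_notin_positive[OF R P k] by (intro reflection_notin) auto
      then show ?thesis using DU h(2) by blast
    qed
    then show "(\<Sum>\<alpha>\<in>P. k \<alpha> * (norm \<alpha>)\<^sup>2 * (f (reflection \<alpha> x) * (1 / (x \<bullet> \<alpha>) * (1 / (x \<bullet> \<alpha>))))) = ?J x"
      unfolding jump_term_def by (intro sum.cong) (simp_all add: inner_commute power2_eq_square)
  qed
  have w_Ck: "Ck_on n D ?w" and B_Ck: "Ck_on n D ?B" and iw_Ck: "Ck_on n D (\<lambda>x. 1 / ?w x)" for n
    by (rule Ck_on_subset[OF Ck_on_half_weight[OF finP U(1,3)] DU],
        rule Ck_on_subset[OF Ck_on_drift_energy[OF finP U(1,3)] DU],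
        rule Ck_on_subset[OF Ck_on_inverse_half_weight[OF finP U(1,3)] DU])
  \<comment> \<open>The difference is rewritten as a sum with a factor -1, since closure is
    available for sums and products.\<close>
  have "locally_hoelder_on D (\<lambda>x. ?B x * ?g x + (- 1) * (?w x * ?J x))"
    by (intro locally_hoelder_on_add locally_hoelder_on_mult[of D ?B ?g] locally_hoelder_on_mult[of D "\<lambda>_. - 1"]
        locally_hoelder_on_mult[of D ?w ?J] locally_hoelder_on_const D J_hoelder
        Ck_on_imp_locally_hoelder_on[OF D g1] Ck_on_imp_locally_hoelder_on[OF D w_Ck]
        Ck_on_imp_locally_hoelder_on[OF D B_Ck])
  then have G_hoelder: "locally_hoelder_on D ?G" by simp
  have g2: "Ck_on 2 D ?g"
  proof (rule Ck_on_local)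
    fix x assume "x \<in> D"
    then obtain a b where ab: "x \<in> box a b" "box a b \<subseteq> D" "weak_poisson a b ?g ?G" using box by blast
    show "\<exists>T. open T \<and> x \<in> T \<and> Ck_on 2 T ?g"
      by (intro exI[of _ "box a b"] conjI open_box ab(1)
          weak_poisson_C2(1)[OF ab(3) locally_hoelder_on_subset[OF G_hoelder ab(2)]])
  qed
  have lap: "laplacian ?g x = ?G x" if x: "x \<in> D" for x
  proof -
    obtain a b where ab: "x \<in> box a b" "box a b \<subseteq> D" "weak_poisson a b ?g ?G" using box[OF x] by blast
    show ?thesis
      by (rule weak_poisson_C2(2)[OF ab(3) locally_hoelder_on_subset[OF G_hoelder ab(2)] ab(1)])
  qed
  have h2: "Ck_on 2 D h"
  proof (rule Ck_on_cong[OF D _ Ck_on_mult[OF D g2 iw_Ck]])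
    show "?w x * h x * (1 / ?w x) = h x" if "x \<in> D" for x
    proof -
      have "0 < ?w x" using half_weight_pos[OF finP U(1,3)] that DU by blast
      then show ?thesis by simp
    qed
  qed
  \<comment> \<open>The conjugation identity is used once more, now with \<open>h\<close> on D in
    place of a test function. It differentiates only inside D; at reflected points just the values
    of \<open>h\<close> enter.\<close>
  moreover have "dunkl_laplacian P k h x = 0" if x: "x \<in> D" for x
  proof -
    have "?w x * dunkl_laplacian P k h x = laplacian ?g x - ?B x * (?w x * h x) + ?w x * ?J x"
      by (rule half_weight_dunkl_laplacian[OF finP U(1,3) D DU h2 x]) simp
    then have "?w x * dunkl_laplacian P k h x = 0" by (simp add: lap[OF x])
    moreover have "0 < ?w x" using half_weight_pos[OF finP U(1,3)] x DU by blast
    ultimately show ?thesis by simp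
  qed
  ultimately show ?thesis by blast
qed

end
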